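(* Let $D=D_1\cup D_2\Subset\Omega$ be a bowtie-shaped domain and let $T_D:H^1_0(\Omega)\to H^1_0(\Omega)$ be its Poincaré variational operator. Then $T_D$ has only essential spectrum, and $$\sigma(T_D)=\sigma_{\mathrm{ess}}(T_D)=[0,1].$$
   Context: Setting. $\Omega\subset\mathbf{R}^2$ is a bounded open set with smooth boundary containing the origin $0$; $B_r$ is the open disc of radius $r$ centred at $0$. A bowtie-shaped domain is an open set $D=D_1\cup D_2$ with $\overline{D}\subset\Omega$, where $D_1,D_2$ are connected open sets whose boundaries are smooth except at $0$, whose closures meet only at $0$, and such that there exist $r_0>0$ and $0<\alpha<\pi$ with (in polar coordinates) $$D_1\cap B_{r_0}=\{(r\cos\theta,r\sin\theta):0<r<r_0,\ -\alpha/2<\theta<\alpha/2\},$$ $$D_2\cap B_{r_0}=\{(r\cos\theta,r\sin\theta):0<r<r_0,\ \pi-\alpha/2<\theta<\pi+\alpha/2\}.$$ $H^1_0(\Omega)$ is equipped with the inner product $\langle u,v\rangle=\int_\Omega\nabla u\cdot\nabla v\,dx$ and the associated norm. The Poincaré variational operator $T_D$ is defined as follows: for $u\in H^1_0(\Omega)$, $T_Du$ is the unique element of $H^1_0(\Omega)$ with $$\int_\Omega\nabla(T_Du)\cdot\nabla v\,dx=\int_D\nabla u\cdot\nabla v\,dx\qquad\text{for all }v\in H^1_0(\Omega).$$ For a bounded self-adjoint operator $T$, $\sigma(T)$ is its spectrum; the discrete spectrum is the set of isolated points of $\sigma(T)$ that are eigenvalues of finite multiplicity, and $\sigma_{\mathrm{ess}}(T)$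 is the complement of the discrete spectrum in $\sigma(T)$. *)

theory Defs
  imports "HOL-Analysis.Analysis"
begin

section \<open>Lebesgue measurable functions modulo equality almost everywhere\<close>

definition ae_eq :: "('a::euclidean_space \<Rightarrow> 'b::euclidean_space) \<Rightarrow> ('a \<Rightarrow> 'b) \<Rightarrow> bool" where
  "ae_eq f g \<longleftrightarrow> f \<in> borel_measurable lebesgue \<and> g \<in> borel_measurable lebesgue \<and>
     (AE x in lebesgue. f x = g x)"

quotient_type (overloaded) ('a, 'b) aefun =
  "'a::euclidean_space \<Rightarrow> 'b::euclidean_space" / partial: ae_eq
proof (rule part_equivpI)
  show "\<exists>f::'a \<Rightarrow> 'b. ae_eq f f"
    by (rule exI[of _ "\<lambda>_. 0"]) (simp add: ae_eq_def)
  show "symp (ae_eq :: ('a \<Rightarrow> 'b) \<Rightarrow> _)"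
    by (rule sympI) (auto simp: ae_eq_def elim: AE_mp)
  show "transp (ae_eq :: ('a \<Rightarrow> 'b) \<Rightarrow> _)"
  proof (rule transpI)
    fix f g h :: "'a \<Rightarrow> 'b"
    assume "ae_eq f g" "ae_eq g h"
    moreover have "AE x in lebesgue. f x = h x"
      if "AE x in lebesgue. f x = g x" "AE x in lebesgue. g x = h x"
      using that by eventually_elim simp
    ultimately show "ae_eq f h"
      by (auto simp: ae_eq_def)
  qed
qed

instantiation aefun :: (euclidean_space, euclidean_space) real_vector
begin

lift_definition zero_aefun :: "('a, 'b) aefun" is "\<lambda>_. 0"
  by (simp add: ae_eq_def)

lift_definition plus_aefun :: "('a, 'b) aefun \<Rightarrow> ('a, 'b) aefun \<Rightarrow> ('a, 'b) aefun"
  is "\<lambda>f g x. f x + g x"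
  unfolding ae_eq_def by (auto intro: borel_measurable_add elim: eventually_elim2)

lift_definition minus_aefun :: "('a, 'b) aefun \<Rightarrow> ('a, 'b) aefun \<Rightarrow> ('a, 'b) aefun"
  is "\<lambda>f g x. f x - g x"
  unfolding ae_eq_def by (auto intro: borel_measurable_diff elim: eventually_elim2)

lift_definition uminus_aefun :: "('a, 'b) aefun \<Rightarrow> ('a, 'b) aefun" is "\<lambda>f x. - f x"
  unfolding ae_eq_def by (auto intro: borel_measurable_uminus elim: eventually_mono)

lift_definition scaleR_aefun :: "real \<Rightarrow> ('a, 'b) aefun \<Rightarrow> ('a, 'b) aefun"
  is "\<lambda>c f x. c *\<^sub>R f x"
  unfolding ae_eq_def by (auto intro: borel_measurable_scaleR elim: eventually_mono)

instance
  by standard (transfer, auto simp: ae_eq_def algebra_simps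
      intro: borel_measurable_add borel_measurable_diff borel_measurable_uminus
        borel_measurable_scaleR)+

end


section \<open>Smooth functions and smooth boundaries\<close>

text \<open>These notions are meant for open \<open>S\<close>.\<close>

primrec k_times_cont_diff_on ::
    "nat \<Rightarrow> 'a::euclidean_space set \<Rightarrow> ('a \<Rightarrow> real) \<Rightarrow> bool" where
  "k_times_cont_diff_on 0 S f \<longleftrightarrow> continuous_on S f"
| "k_times_cont_diff_on (Suc k) S f \<longleftrightarrow> f differentiable_on S \<and>
     (\<forall>b\<in>Basis. k_times_cont_diff_on k S (\<lambda>x. frechet_derivative f (at x) b))"

definition smooth_on :: "'a::euclidean_space set \<Rightarrow> ('a \<Rightarrow> real) \<Rightarrow> bool" where
  "smooth_on S f \<longleftrightarrow> (\<forall>k. k_times_cont_diff_on k S f)"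

text \<open>Near \<open>p\<close>, the open set \<open>S\<close> is a strict sublevel set of a smooth function without critical
  points; in particular it lies on one side of its boundary there.\<close>

definition smooth_boundary_at :: "'a::euclidean_space set \<Rightarrow> 'a \<Rightarrow> bool" where
  "smooth_boundary_at S p \<longleftrightarrow>
     (\<exists>U \<psi>. open U \<and> p \<in> U \<and> smooth_on U \<psi> \<and>
        (\<forall>x\<in>U. frechet_derivative \<psi> (at x) \<noteq> (\<lambda>_. 0)) \<and>
        S \<inter> U = {x \<in> U. \<psi> x < 0})"


section \<open>The Sobolev space \<open>H\<^sup>1\<^sub>0(\<Omega>)\<close>\<close>

definition test_function :: "'a::euclidean_space set \<Rightarrow> ('a \<Rightarrow> real) \<Rightarrow> bool" where
  "test_function \<Omega> \<phi> \<longleftrightarrow> smooth_on UNIV \<phi> \<and>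
     (\<exists>K. compact K \<and> K \<subseteq> \<Omega> \<and> (\<forall>x. x \<notin> K \<longrightarrow> \<phi> x = 0))"

text \<open>Functions on \<open>\<Omega>\<close> are represented by their extension by zero.  Below, integrals of
  \<open>rep_aefun u\<close> do not depend on the representative of the class \<open>u\<close> that is chosen.\<close>

definition L2 :: "'a::euclidean_space set \<Rightarrow> ('a, 'b::euclidean_space) aefun set" where
  "L2 \<Omega> = {u. (AE x in lebesgue. x \<notin> \<Omega> \<longrightarrow> rep_aefun u x = 0) \<and>
     set_integrable lebesgue \<Omega> (\<lambda>x. (norm (rep_aefun u x))\<^sup>2)}"

definition is_weak_gradient ::
    "'a::euclidean_space set \<Rightarrow> ('a, real) aefun \<Rightarrow> ('a, 'a) aefun \<Rightarrow> bool" where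
  "is_weak_gradient \<Omega> u g \<longleftrightarrow>
     (\<forall>\<phi>. test_function \<Omega> \<phi> \<longrightarrow> (\<forall>b\<in>Basis.
        set_lebesgue_integral lebesgue \<Omega>
          (\<lambda>x. rep_aefun u x * frechet_derivative \<phi> (at x) b) =
        - set_lebesgue_integral lebesgue \<Omega> (\<lambda>x. (rep_aefun g x \<bullet> b) * \<phi> x)))"

definition H1 :: "'a::euclidean_space set \<Rightarrow> ('a, real) aefun set" where
  "H1 \<Omega> = {u \<in> L2 \<Omega>. \<exists>g \<in> L2 \<Omega>. is_weak_gradient \<Omega> u g}"

definition weak_gradient ::
    "'a::euclidean_space set \<Rightarrow> ('a, real) aefun \<Rightarrow> ('a, 'a) aefun" where
  "weak_gradient \<Omega> u = (THE g. g \<in> L2 \<Omega> \<and> is_weak_gradient \<Omega> u g)"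

text \<open>The form \<open>\<integral>\<^sub>S \<nabla>u \<cdot> \<nabla>v\<close>, for \<open>S \<subseteq> \<Omega>\<close> and \<open>u\<close>, \<open>v\<close> in \<open>H1 \<Omega>\<close>.\<close>

definition gradient_form ::
    "'a::euclidean_space set \<Rightarrow> 'a set \<Rightarrow> ('a, real) aefun \<Rightarrow> ('a, real) aefun \<Rightarrow> real" where
  "gradient_form \<Omega> S u v =
     set_lebesgue_integral lebesgue S
       (\<lambda>x. rep_aefun (weak_gradient \<Omega> u) x \<bullet> rep_aefun (weak_gradient \<Omega> v) x)"

definition H1_norm :: "'a::euclidean_space set \<Rightarrow> ('a, real) aefun \<Rightarrow> real" where
  "H1_norm \<Omega> u =
     sqrt (set_lebesgue_integral lebesgue \<Omega> (\<lambda>x. (rep_aefun u x)\<^sup>2) + gradient_form \<Omega> \<Omega> u u)"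

definition H10 :: "'a::euclidean_space set \<Rightarrow> ('a, real) aefun set" where
  "H10 \<Omega> = {u \<in> H1 \<Omega>. \<forall>\<epsilon>>0. \<exists>\<phi>. test_function \<Omega> \<phi> \<and> H1_norm \<Omega> (u - abs_aefun \<phi>) < \<epsilon>}"

definition H10_inner ::
    "'a::euclidean_space set \<Rightarrow> ('a, real) aefun \<Rightarrow> ('a, real) aefun \<Rightarrow> real" where
  "H10_inner \<Omega> u v = gradient_form \<Omega> \<Omega> u v"

definition poincare_op ::
    "'a::euclidean_space set \<Rightarrow> 'a set \<Rightarrow> ('a, real) aefun \<Rightarrow> ('a, real) aefun" where
  "poincare_op \<Omega> D u =
     (THE w. w \<in> H10 \<Omega> \<and> (\<forall>v \<in> H10 \<Omega>. H10_inner \<Omega> w v = gradient_form \<Omega> D u v))"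


section \<open>Spectra of bounded operators on a real inner product space\<close>

text \<open>The space is a linear subspace \<open>V\<close> of an ambient vector space, with inner product \<open>ip\<close>
  on \<open>V\<close>; operators are only considered on \<open>V\<close>.\<close>

definition bounded_op ::
    "'v::real_vector set \<Rightarrow> ('v \<Rightarrow> 'v \<Rightarrow> real) \<Rightarrow> ('v \<Rightarrow> 'v) \<Rightarrow> bool" where
  "bounded_op V ip A \<longleftrightarrow>
     (\<forall>x\<in>V. A x \<in> V) \<and>
     (\<forall>x\<in>V. \<forall>y\<in>V. A (x + y) = A x + A y) \<and>
     (\<forall>c. \<forall>x\<in>V. A (c *\<^sub>R x) = c *\<^sub>R A x) \<and>
     (\<exists>C. \<forall>x\<in>V. sqrt (ip (A x) (A x)) \<le> C * sqrt (ip x x))"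

definition invertible_op ::
    "'v::real_vector set \<Rightarrow> ('v \<Rightarrow> 'v \<Rightarrow> real) \<Rightarrow> ('v \<Rightarrow> 'v) \<Rightarrow> bool" where
  "invertible_op V ip A \<longleftrightarrow> bounded_op V ip A \<and>
     (\<exists>B. bounded_op V ip B \<and> (\<forall>x\<in>V. B (A x) = x \<and> A (B x) = x))"

definition op_spectrum ::
    "'v::real_vector set \<Rightarrow> ('v \<Rightarrow> 'v \<Rightarrow> real) \<Rightarrow> ('v \<Rightarrow> 'v) \<Rightarrow> real set" where
  "op_spectrum V ip A = {\<mu>. \<not> invertible_op V ip (\<lambda>x. A x - \<mu> *\<^sub>R x)}"

definition eigenspace :: "'v::real_vector set \<Rightarrow> ('v \<Rightarrow> 'v) \<Rightarrow> real \<Rightarrow> 'v set" where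
  "eigenspace V A \<mu> = {x \<in> V. A x = \<mu> *\<^sub>R x}"

definition discrete_spectrum ::
    "'v::real_vector set \<Rightarrow> ('v \<Rightarrow> 'v \<Rightarrow> real) \<Rightarrow> ('v \<Rightarrow> 'v) \<Rightarrow> real set" where
  "discrete_spectrum V ip A =
     {\<mu>. \<mu> isolated_in op_spectrum V ip A \<and>
         eigenspace V A \<mu> \<noteq> {0} \<and>
         (\<exists>B. finite B \<and> eigenspace V A \<mu> \<subseteq> span B)}"

definition essential_spectrum ::
    "'v::real_vector set \<Rightarrow> ('v \<Rightarrow> 'v \<Rightarrow> real) \<Rightarrow> ('v \<Rightarrow> 'v) \<Rightarrow> real set" where
  "essential_spectrum V ip A = op_spectrum V ip A - discrete_spectrum V ip A"


section \<open>Bowtie-shaped domains\<close>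

definition sector :: "real \<Rightarrow> real \<Rightarrow> real \<Rightarrow> (real^2) set" where
  "sector r\<^sub>0 a b = {vector [r * cos \<theta>, r * sin \<theta>] | r \<theta>. 0 < r \<and> r < r\<^sub>0 \<and> a < \<theta> \<and> \<theta> < b}"

definition bowtie :: "(real^2) set \<Rightarrow> (real^2) set \<Rightarrow> (real^2) set \<Rightarrow> bool" where
  "bowtie \<Omega> D\<^sub>1 D\<^sub>2 \<longleftrightarrow>
     open D\<^sub>1 \<and> open D\<^sub>2 \<and> connected D\<^sub>1 \<and> connected D\<^sub>2 \<and>
     closure (D\<^sub>1 \<union> D\<^sub>2) \<subseteq> \<Omega> \<and>
     (\<forall>p \<in> frontier D\<^sub>1 - {0}. smooth_boundary_at D\<^sub>1 p) \<and>
     (\<forall>p \<in> frontier D\<^sub>2 - {0}. smooth_boundary_at D\<^sub>2 p) \<and>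
     closure D\<^sub>1 \<inter> closure D\<^sub>2 = {0} \<and>
     (\<exists>r\<^sub>0 \<alpha>. 0 < r\<^sub>0 \<and> 0 < \<alpha> \<and> \<alpha> < pi \<and>
        D\<^sub>1 \<inter> ball 0 r\<^sub>0 = sector r\<^sub>0 (- \<alpha> / 2) (\<alpha> / 2) \<and>
        D\<^sub>2 \<inter> ball 0 r\<^sub>0 = sector r\<^sub>0 (pi - \<alpha> / 2) (pi + \<alpha> / 2))"

end

theory Submission
  imports Defs
begin

text \<open>
The idea is that the whole spectrum is already visible at the corner. The two halves of the proof
are \<open>poincare_spectrum_subset\<close> and \<open>poincare_spectrum_Weyl\<close>, the latter fed by
\<open>approx_transmission_double_sector\<close>.

Let \<open>T\<close> be the operator. It is self-adjoint with \<open>0 \<le> \<langle>T u, u\<rangle> = \<integral>\<^sub>D \<bar>\<nabla>u\<bar>\<^sup>2 \<le> \<langle>u, u\<rangle>\<close>. For \<open>\<mu>\<close>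
outside \<open>[0, 1]\<close> the form of \<open>T - \<mu>\<close> is therefore definite, and the Riesz theorem for this form
inverts \<open>T - \<mu>\<close>. The analytic input is that \<open>H\<^sup>1\<^sub>0\<close> with the gradient inner product is complete
(\<open>hilbert_H10\<close>), which rests on the completeness of L2, the fundamental lemma of the calculus of
variations and the Poincare inequality.

Conversely let \<open>\<mu> \<in> [0, 1]\<close> and \<open>a = 1\<^sub>D - \<mu>\<close>. A field of the form \<open>rot \<nabla>S\<close>, with \<open>S\<close> a test
function, is orthogonal to all gradients of \<open>H\<^sup>1\<^sub>0\<close>. Hence test functions \<open>u\<close>, \<open>S\<close> for which
\<open>a \<nabla>u - rot \<nabla>S\<close> is small in L2 compared with \<open>\<nabla>u\<close> show that \<open>u\<close> is an approximate eigenvector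
(\<open>residual_bound\<close>). Such pairs are constructed in an arbitrarily small disc around \<open>0\<close>, where \<open>D\<close>
is the double sector of half-angle \<open>\<beta> = \<alpha>/2\<close>. There \<open>a\<close> is invariant under dilations, so the
equation \<open>a \<nabla>u = rot \<nabla>S\<close> has solutions with separated variables: \<open>u\<close> is \<open>cos(\<xi> ln r)\<close> times a
function of the angle, and \<open>S\<close> is the derivative of the cosine times another such function. If \<open>u\<close>
is odd in \<open>x\<close> and even in \<open>y\<close>, continuity of \<open>u\<close> and \<open>S\<close> across the sides of the sector amounts to
\<open>\<mu> / (1 - \<mu>) = tanh(\<xi>\<beta>) tanh(\<xi>(\<pi>/2 - \<beta>))\<close>, and the right-hand side takes all values in \<open>(0, 1)\<close> as
\<open>\<xi>\<close> varies over the positive numbers; this gives \<open>0 < \<mu> < 1/2\<close>. The energy of \<open>u\<close> is infinite, but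
it is distributed evenly: each period of \<open>cos(\<xi> ln r)\<close> in \<open>ln r\<close> carries the same amount. Cutting
off to \<open>N\<close> periods produces an energy of order \<open>N\<close> and a squared residual that stays bounded,
because only the two ends of the cut-off contribute (\<open>Weyl_pair\<close>). Exchanging \<open>u\<close> and \<open>S\<close> turns
\<open>\<mu>\<close> into \<open>1 - \<mu>\<close>, and the set of admissible \<open>\<mu>\<close> is closed, so all of \<open>[0, 1]\<close> is obtained.

The separated solutions have a kink on the sides of the sector. They are made into test functions
by replacing the angular factors by polynomials in \<open>x/r\<close> and \<open>y/r\<close> which converge together with
their derivatives, boundedly and almost everywhere (\<open>profile_approximation\<close>,
\<open>smooth_approximation\<close>). In this way no Sobolev theory on the interface and no integration in
polar coordinates is involved.

Finally, \<open>[0, 1]\<close> has no isolated points, so the discrete spectrum is empty.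
\<close>

section \<open>Symmetric bilinear forms on a subspace\<close>

text \<open>The first order condition at a minimum: a quadratic that stays nonnegative and vanishes at
\<open>0\<close> has no linear term. In the Riesz theorem it turns minimality along every line into the
representing equation.\<close>

lemma linear_term_vanishes:
  fixes q d :: real
  assumes "\<And>t. 0 \<le> t\<^sup>2 * q + 2 * t * d"
  shows "d = 0"
proof (rule ccontr)
  assume d: "d \<noteq> 0"
  define s where "s = 1 / (\<bar>q\<bar> + 1)"
  have s: "s > 0" "s * \<bar>q\<bar> < 1"
    by (auto simp: s_def field_simps)
  have "0 \<le> (- s * d)\<^sup>2 * q + 2 * (- s * d) * d"
    by (rule assms)
  also have "\<dots> = s * d\<^sup>2 * (s * q - 2)"
    by (simp add: power2_eq_square algebra_simps)
  also have "s * d\<^sup>2 * (s * q - 2) < 0"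
  proof (rule mult_pos_neg)
    have "s * q \<le> s * \<bar>q\<bar>" using s by (intro mult_left_mono) auto
    then show "s * q - 2 < 0" using s by linarith
  qed (use s d in auto)
  finally show False by simp
qed

text \<open>The forms \<open>\<integral>\<^sub>D \<nabla>u \<cdot> \<nabla>v\<close> are only semidefinite, several of them live on the same space, and
the spaces are subspaces of one type of equivalence classes; hence the form and the subspace are
parameters.\<close>

locale semi_inner =
  fixes V :: "'v::real_vector set" and ip :: "'v \<Rightarrow> 'v \<Rightarrow> real"
  assumes subspace: "subspace V"
    and sym: "\<And>x y. x \<in> V \<Longrightarrow> y \<in> V \<Longrightarrow> ip x y = ip y x"
    and add_left: "\<And>x y z. x \<in> V \<Longrightarrow> y \<in> V \<Longrightarrow> z \<in> V \<Longrightarrow> ip (x + y) z = ip x z + ip y z"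
    and scale_left: "\<And>c x y. x \<in> V \<Longrightarrow> y \<in> V \<Longrightarrow> ip (c *\<^sub>R x) y = c * ip x y"
    and nonneg: "\<And>x. x \<in> V \<Longrightarrow> 0 \<le> ip x x"
begin

lemma mem [simp, intro]:
  "0 \<in> V" "x \<in> V \<Longrightarrow> y \<in> V \<Longrightarrow> x + y \<in> V" "x \<in> V \<Longrightarrow> y \<in> V \<Longrightarrow> x - y \<in> V"
  "x \<in> V \<Longrightarrow> c *\<^sub>R x \<in> V"
  using subspace by (auto simp: subspace_0 subspace_add subspace_diff subspace_scale)

lemma add_right: "x \<in> V \<Longrightarrow> y \<in> V \<Longrightarrow> z \<in> V \<Longrightarrow> ip z (x + y) = ip z x + ip z y"
  by (metis add_left mem(2) sym)

lemma scale_right: "x \<in> V \<Longrightarrow> y \<in> V \<Longrightarrow> ip y (c *\<^sub>R x) = c * ip y x"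
  by (metis scale_left mem(4) sym)

lemma diff_left: "x \<in> V \<Longrightarrow> y \<in> V \<Longrightarrow> z \<in> V \<Longrightarrow> ip (x - y) z = ip x z - ip y z"
  by (metis add_left add_diff_cancel_right' diff_add_cancel mem(3))

lemma diff_right: "x \<in> V \<Longrightarrow> y \<in> V \<Longrightarrow> z \<in> V \<Longrightarrow> ip z (x - y) = ip z x - ip z y"
  by (metis diff_left mem(3) sym)

lemmas bilin = add_left add_right scale_left scale_right diff_left diff_right

lemma expand: "x \<in> V \<Longrightarrow> y \<in> V \<Longrightarrow>
    ip (x + t *\<^sub>R y) (x + t *\<^sub>R y) = ip x x + 2 * t * ip x y + t\<^sup>2 * ip y y"
  by (simp add: bilin sym[of y x] power2_eq_square algebra_simps)

definition nrm :: "'v \<Rightarrow> real" where "nrm x = sqrt (ip x x)"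

lemma nrm_nonneg [simp]: "x \<in> V \<Longrightarrow> 0 \<le> nrm x"
  by (simp add: nrm_def nonneg)

lemma nrm_sq: "x \<in> V \<Longrightarrow> (nrm x)\<^sup>2 = ip x x"
  by (simp add: nrm_def nonneg)

lemma Cauchy_Schwarz_sq:
  assumes "x \<in> V" "y \<in> V"
  shows "(ip x y)\<^sup>2 \<le> ip x x * ip y y"
proof (cases "ip x x = 0")
  case True
  have A: "0 \<le> ip y y + 2 * s * ip y x" for s
    using nonneg[of "y + s *\<^sub>R x"] assms True by (simp add: expand)
  have "ip y x = 0"
  proof (rule ccontr)
    assume "ip y x \<noteq> 0"
    then have "2 * (- (ip y y + 1) / (2 * ip y x)) * ip y x = - (ip y y + 1)" by simp
    then show False using A[of "- (ip y y + 1) / (2 * ip y x)"] by linarith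
  qed
  then show ?thesis using sym assms True by simp
next
  case False
  then have pos: "ip x x > 0" using nonneg[of x] assms by simp
  have "0 \<le> ip y y + 2 * (- ip y x / ip x x) * ip y x + (- ip y x / ip x x)\<^sup>2 * ip x x"
    using nonneg[of "y + (- ip y x / ip x x) *\<^sub>R x"] assms
    by (simp only: expand) auto
  also have "\<dots> = ip y y - (ip y x)\<^sup>2 / ip x x"
    using pos by (simp add: power2_eq_square field_simps)
  finally show ?thesis using pos sym assms by (simp add: field_simps)
qed

lemma Cauchy_Schwarz: "x \<in> V \<Longrightarrow> y \<in> V \<Longrightarrow> \<bar>ip x y\<bar> \<le> nrm x * nrm y"
  using Cauchy_Schwarz_sq[of x y] unfolding nrm_def
  by (metis real_sqrt_abs real_sqrt_le_iff real_sqrt_mult)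

lemma nrm_triangle:
  assumes "x \<in> V" "y \<in> V"
  shows "nrm (x + y) \<le> nrm x + nrm y"
proof (rule power2_le_imp_le)
  have "(nrm (x + y))\<^sup>2 = ip x x + 2 * ip x y + ip y y"
    using assms by (simp add: nrm_sq bilin sym[of y x])
  also have "\<dots> \<le> (nrm x + nrm y)\<^sup>2"
    using Cauchy_Schwarz[OF assms] assms by (simp add: power2_sum nrm_sq)
  finally show "(nrm (x + y))\<^sup>2 \<le> (nrm x + nrm y)\<^sup>2" .
qed (use assms in auto)

lemma nrm_triangle_diff: "x \<in> V \<Longrightarrow> y \<in> V \<Longrightarrow> z \<in> V \<Longrightarrow> nrm (x - z) \<le> nrm (x - y) + nrm (y - z)"
  using nrm_triangle[of "x - y" "y - z"] by simp

lemma nrm_scale: "x \<in> V \<Longrightarrow> nrm (c *\<^sub>R x) = \<bar>c\<bar> * nrm x"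
  by (simp add: nrm_def bilin real_sqrt_mult flip: power2_eq_square mult.assoc)

lemma nrm_minus: "x \<in> V \<Longrightarrow> y \<in> V \<Longrightarrow> nrm (x - y) = nrm (y - x)"
  using nrm_scale[of "x - y" "-1"] by simp

lemma zero_left: "y \<in> V \<Longrightarrow> ip 0 y = 0"
  using scale_left[of 0 y 0] by simp

text \<open>Pairing with a fixed vector is continuous; identities tested against fixed vectors
therefore survive passage to the limit.\<close>

lemma tendsto_left:
  assumes X: "\<And>n. X n \<in> V" and x: "x \<in> V" and v: "v \<in> V"
    and lim: "(\<lambda>n. ip (X n - x) (X n - x)) \<longlonglongrightarrow> 0"
  shows "(\<lambda>n. ip (X n) v) \<longlonglongrightarrow> ip x v"
proof -
  have "(\<lambda>n. nrm (X n - x) * nrm v) \<longlonglongrightarrow> sqrt 0 * nrm v"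
    unfolding nrm_def by (intro tendsto_intros lim)
  then have lim0: "(\<lambda>n. nrm (X n - x) * nrm v) \<longlonglongrightarrow> 0" by simp
  have "norm (ip (X n - x) v) \<le> nrm (X n - x) * nrm v" for n
    using Cauchy_Schwarz[of "X n - x" v] X[of n] x v by simp
  then have "(\<lambda>n. ip (X n - x) v) \<longlonglongrightarrow> 0"
    by (intro Lim_null_comparison[OF _ lim0] always_eventually allI)
  then show ?thesis
    using X x v by (simp add: diff_left LIM_zero_iff)
qed

text \<open>A bounded inverse \<open>B\<close> of \<open>A - \<mu>\<close> gives \<open>\<parallel>x\<parallel> \<le> C \<parallel>(A - \<mu>) x\<parallel>\<close>, so approximate eigenvectors
exclude it.\<close>

lemma Weyl_criterion:
  assumes A: "\<And>x. x \<in> V \<Longrightarrow> A x \<in> V"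
    and weyl: "\<And>\<epsilon>. 0 < \<epsilon> \<Longrightarrow> \<exists>x\<in>V. nrm x > 0 \<and> nrm (A x - \<mu> *\<^sub>R x) \<le> \<epsilon> * nrm x"
  shows "\<mu> \<in> op_spectrum V ip A"
proof (rule ccontr)
  assume "\<mu> \<notin> op_spectrum V ip A"
  then obtain B where "bounded_op V ip B" and B: "\<And>x. x \<in> V \<Longrightarrow> B (A x - \<mu> *\<^sub>R x) = x"
    by (auto simp: op_spectrum_def invertible_op_def)
  then obtain C where "\<forall>x\<in>V. nrm (B x) \<le> C * nrm x"
    unfolding bounded_op_def nrm_def by blast
  then have C: "\<And>x. x \<in> V \<Longrightarrow> nrm (B x) \<le> C * nrm x" by blast
  have "0 < 1 / (2 * (\<bar>C\<bar> + 1))" by simp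
  from weyl[OF this] obtain x where x: "x \<in> V" "nrm x > 0"
    and *: "nrm (A x - \<mu> *\<^sub>R x) \<le> (1 / (2 * (\<bar>C\<bar> + 1))) * nrm x"
    by blast
  have "nrm x \<le> C * nrm (A x - \<mu> *\<^sub>R x)"
    using C[of "A x - \<mu> *\<^sub>R x"] B x A by simp
  also have "\<dots> \<le> (\<bar>C\<bar> + 1) * nrm (A x - \<mu> *\<^sub>R x)"
    using x A by (intro mult_right_mono) auto
  also have "\<dots> \<le> (\<bar>C\<bar> + 1) * ((1 / (2 * (\<bar>C\<bar> + 1))) * nrm x)"
    by (intro mult_left_mono *) auto
  also have "\<dots> = nrm x / 2" by (simp add: field_simps)
  finally show False using x by simp
qed

end

locale hilbert_on = semi_inner V ip
  for V :: "'v::real_vector set" and ip :: "'v \<Rightarrow> 'v \<Rightarrow> real" +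
  assumes definite: "\<And>x. x \<in> V \<Longrightarrow> ip x x = 0 \<Longrightarrow> x = 0"
    and complete: "\<And>X. (\<And>n::nat. X n \<in> V) \<Longrightarrow>
      (\<And>e. 0 < e \<Longrightarrow> \<exists>N. \<forall>m\<ge>N. \<forall>n\<ge>N. ip (X m - X n) (X m - X n) < e) \<Longrightarrow>
      \<exists>x\<in>V. (\<lambda>n. ip (X n - x) (X n - x)) \<longlonglongrightarrow> 0"
begin

lemma nondegenerate:
  assumes "x \<in> V" "y \<in> V" "\<And>v. v \<in> V \<Longrightarrow> ip x v = ip y v"
  shows "x = y"
proof -
  have "ip (x - y) (x - y) = 0"
    using assms by (simp add: diff_left)
  then show ?thesis using definite[of "x - y"] assms by simp
qed

text \<open>Minimise \<open>\<langle>w, w\<rangle> - 2 l(w)\<close>. The parallelogram law makes a minimising sequence Cauchy, and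
the minimality of its limit along the lines \<open>w + t v\<close> is the equation \<open>\<langle>w, v\<rangle> = l(v)\<close>.\<close>

theorem Riesz_representation:
  assumes add: "\<And>x y. x \<in> V \<Longrightarrow> y \<in> V \<Longrightarrow> l (x + y) = l x + l y"
    and scale: "\<And>c x. x \<in> V \<Longrightarrow> l (c *\<^sub>R x) = c * l x"
    and bound: "\<And>x. x \<in> V \<Longrightarrow> \<bar>l x\<bar> \<le> C * nrm x"
  shows "\<exists>w\<in>V. \<forall>v\<in>V. ip w v = l v"
proof -
  define J where "J w = ip w w - 2 * l w" for w
  define m where "m = Inf (J ` V)"
  have "- C\<^sup>2 \<le> J w" if "w \<in> V" for w
  proof -
    have "l w \<le> C * nrm w" using bound[OF that] by simp
    moreover have "0 \<le> (nrm w - C)\<^sup>2" by simp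
    ultimately show ?thesis
      using nrm_sq[OF that] by (simp add: J_def power2_diff algebra_simps)
  qed
  then have bdd: "bdd_below (J ` V)" by (auto simp: bdd_below_def)
  have m_le: "m \<le> J w" if "w \<in> V" for w
    unfolding m_def using bdd that by (intro cINF_lower) auto
  have "\<exists>w\<in>V. J w < m + 1 / real (Suc n)" for n
  proof -
    have "\<exists>y\<in>J ` V. y < m + 1 / real (Suc n)"
    proof (subst cInf_less_iff[symmetric])
      show "J ` V \<noteq> {}" using mem(1) by blast
    qed (use bdd m_def in auto)
    then show ?thesis by blast
  qed
  then obtain X where X: "\<And>n. X n \<in> V" "\<And>n. J (X n) < m + 1 / real (Suc n)"
    by metis
  \<comment> \<open>By the parallelogram law, the distance of two near-minimisers is controlled by how much
    \<open>J\<close> exceeds its infimum.\<close>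
  have near: "ip (X i - X j) (X i - X j) < 2 / real (Suc i) + 2 / real (Suc j)" for i j
  proof -
    have V: "X i \<in> V" "X j \<in> V" by (rule X)+
    have s: "ip (X j) (X i) = ip (X i) (X j)" by (rule sym[OF V(2,1)])
    have "J ((1/2) *\<^sub>R (X i + X j)) =
        (ip (X i) (X i) + 2 * ip (X i) (X j) + ip (X j) (X j)) / 4 - (l (X i) + l (X j))"
      using V by (simp add: J_def bilin add scale s) argo
    moreover have "ip (X i - X j) (X i - X j) = ip (X i) (X i) - 2 * ip (X i) (X j) + ip (X j) (X j)"
      using V by (simp add: bilin s)
    ultimately have "ip (X i - X j) (X i - X j) = 2 * J (X i) + 2 * J (X j)
        - 4 * J ((1/2) *\<^sub>R (X i + X j))"
      by (simp only: J_def) argo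
    moreover have "m \<le> J ((1/2) *\<^sub>R (X i + X j))"
      using m_le X(1) by simp
    moreover have "2 / real (Suc i) = 2 * (1 / real (Suc i))"
      "2 / real (Suc j) = 2 * (1 / real (Suc j))" by simp_all
    ultimately show ?thesis using X(2)[of i] X(2)[of j] by linarith
  qed
  have "\<exists>x\<in>V. (\<lambda>n. ip (X n - x) (X n - x)) \<longlonglongrightarrow> 0"
  proof (rule complete)
    fix e :: real assume "0 < e"
    obtain N where N: "1 / real (Suc N) < e / 4"
      using nat_approx_posE[of "e/4"] \<open>0 < e\<close> by auto
    have "ip (X i - X j) (X i - X j) < e" if "i \<ge> N" "j \<ge> N" for i j
    proof -
      have "1 / real (Suc i) \<le> 1 / real (Suc N)" "1 / real (Suc j) \<le> 1 / real (Suc N)"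
        using that by (auto simp: frac_le)
      then show ?thesis using near[of i j] N by linarith
    qed
    then show "\<exists>N. \<forall>m\<ge>N. \<forall>n\<ge>N. ip (X m - X n) (X m - X n) < e" by blast
  qed (rule X)
  then obtain w where w: "w \<in> V" and lim: "(\<lambda>n. ip (X n - w) (X n - w)) \<longlonglongrightarrow> 0"
    by blast
  have "ip w v - l v = 0" if v: "v \<in> V" for v
  proof (rule linear_term_vanishes[of "ip v v"])
    fix t :: real
    have "(\<lambda>n. ip (X n) v) \<longlonglongrightarrow> ip w v" by (rule tendsto_left[OF X(1) w v lim])
    then have "(\<lambda>n. t\<^sup>2 * ip v v + 2 * t * (ip (X n) v - l v) + 1 / real (Suc n))
        \<longlonglongrightarrow> t\<^sup>2 * ip v v + 2 * t * (ip w v - l v) + 0"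
      by (intro tendsto_intros LIMSEQ_Suc lim_const_over_n)
    moreover have "0 \<le> t\<^sup>2 * ip v v + 2 * t * (ip (X n) v - l v) + 1 / real (Suc n)" for n
    proof -
      have "J (X n + t *\<^sub>R v) = ip (X n) (X n) + 2 * t * ip (X n) v + t\<^sup>2 * ip v v
          - 2 * (l (X n) + t * l v)"
        using X(1)[of n] v by (simp add: J_def expand add scale)
      moreover have "m \<le> J (X n + t *\<^sub>R v)" using m_le X(1) v by simp
      moreover have "2 * t * (ip (X n) v - l v) = 2 * t * ip (X n) v - 2 * (t * l v)"
        by (simp add: right_diff_distrib)
      moreover have "J (X n) = ip (X n) (X n) - 2 * l (X n)" by (simp add: J_def)
      ultimately show ?thesis
        using X(2)[of n] by argo
    qed
    ultimately show "0 \<le> t\<^sup>2 * ip v v + 2 * t * (ip w v - l v)"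
      by (intro LIMSEQ_le_const[where a = 0]) auto
  qed
  then show ?thesis using w by auto
qed

text \<open>The form \<open>s \<langle>A x, y\<rangle>\<close> is a second complete inner product, equivalent to the first.
Representing \<open>y \<mapsto> s \<langle>f, y\<rangle>\<close> by it solves \<open>A x = f\<close>, and the coercivity constant bounds the
solution.\<close>

lemma definite_imp_invertible:
  assumes A: "bounded_op V ip A"
    and selfadj: "\<And>x y. x \<in> V \<Longrightarrow> y \<in> V \<Longrightarrow> ip (A x) y = ip x (A y)"
    and c: "0 < c" and coercive: "\<And>x. x \<in> V \<Longrightarrow> c * ip x x \<le> s * ip (A x) x"
    and s: "s = 1 \<or> s = -1"
  shows "invertible_op V ip A"
proof -
  have AV: "\<And>x. x \<in> V \<Longrightarrow> A x \<in> V"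
    and Aadd: "\<And>x y. x \<in> V \<Longrightarrow> y \<in> V \<Longrightarrow> A (x + y) = A x + A y"
    and Ascale: "\<And>r x. x \<in> V \<Longrightarrow> A (r *\<^sub>R x) = r *\<^sub>R A x"
    using A by (auto simp: bounded_op_def)
  obtain M where "\<forall>x\<in>V. nrm (A x) \<le> M * nrm x"
    using A unfolding bounded_op_def nrm_def by blast
  then have M: "\<And>x. x \<in> V \<Longrightarrow> nrm (A x) \<le> M * nrm x" by blast
  define ip' where "ip' x y = s * ip (A x) y" for x y
  interpret a: semi_inner V ip'
  proof
    show "0 \<le> ip' x x" if "x \<in> V" for x
      using coercive[OF that] nonneg[OF that] c unfolding ip'_def
      by (meson mult_nonneg_nonneg less_imp_le order_trans)
  qed (use subspace selfadj sym AV in \<open>auto simp: ip'_def Aadd Ascale bilin algebra_simps\<close>)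
  have le1: "c * ip x x \<le> ip' x x" if "x \<in> V" for x
    using coercive[OF that] by (simp add: ip'_def)
  have le2: "ip' x x \<le> \<bar>M\<bar> * ip x x" if "x \<in> V" for x
  proof -
    have "ip' x x \<le> \<bar>ip (A x) x\<bar>" using s by (auto simp: ip'_def)
    also have "\<dots> \<le> nrm (A x) * nrm x" using that AV by (intro Cauchy_Schwarz) auto
    also have "\<dots> \<le> (\<bar>M\<bar> * nrm x) * nrm x"
    proof (intro mult_right_mono)
      have "M * nrm x \<le> \<bar>M\<bar> * nrm x" using that by (intro mult_right_mono) auto
      then show "nrm (A x) \<le> \<bar>M\<bar> * nrm x" using M[OF that] by linarith
    qed (use that in auto)
    finally show ?thesis using nrm_sq[OF that] by (simp add: power2_eq_square mult.assoc)
  qed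
  interpret a: hilbert_on V ip'
  proof
    show "x = 0" if "x \<in> V" "ip' x x = 0" for x
      using le1[of x] nonneg[of x] that c definite[of x]
      by (metis mult_le_cancel_left_pos mult_zero_right order_antisym)
    fix X :: "nat \<Rightarrow> 'v"
    assume X: "\<And>n. X n \<in> V"
      and C: "\<And>e. 0 < e \<Longrightarrow> \<exists>N. \<forall>m\<ge>N. \<forall>n\<ge>N. ip' (X m - X n) (X m - X n) < e"
    have "\<exists>x\<in>V. (\<lambda>n. ip (X n - x) (X n - x)) \<longlonglongrightarrow> 0"
    proof (rule complete[OF X])
      fix e :: real assume "0 < e"
      then obtain N where N: "\<forall>m\<ge>N. \<forall>n\<ge>N. ip' (X m - X n) (X m - X n) < c * e"
        using C[of "c * e"] c by auto
      have "ip (X m - X n) (X m - X n) < e" if "m \<ge> N" "n \<ge> N" for m n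
      proof -
        have "c * ip (X m - X n) (X m - X n) < c * e"
          using N that le1[of "X m - X n"] X by (meson mem(3) le_less_trans)
        then show ?thesis using c by simp
      qed
      then show "\<exists>N. \<forall>m\<ge>N. \<forall>n\<ge>N. ip (X m - X n) (X m - X n) < e" by blast
    qed
    then obtain x where x: "x \<in> V" "(\<lambda>n. ip (X n - x) (X n - x)) \<longlonglongrightarrow> 0" by blast
    have "(\<lambda>n. \<bar>M\<bar> * ip (X n - x) (X n - x)) \<longlonglongrightarrow> \<bar>M\<bar> * 0"
      by (intro tendsto_intros x)
    then have lim: "(\<lambda>n. \<bar>M\<bar> * ip (X n - x) (X n - x)) \<longlonglongrightarrow> 0" by simp
    have "norm (ip' (X n - x) (X n - x)) \<le> \<bar>M\<bar> * ip (X n - x) (X n - x)" for n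
      using le2[of "X n - x"] a.nonneg[of "X n - x"] X[of n] x(1) by simp
    then have "(\<lambda>n. ip' (X n - x) (X n - x)) \<longlonglongrightarrow> 0"
      by (intro Lim_null_comparison[OF _ lim] always_eventually allI)
    with x show "\<exists>x\<in>V. (\<lambda>n. ip' (X n - x) (X n - x)) \<longlonglongrightarrow> 0" by blast
  qed
  have solve: "\<exists>w\<in>V. \<forall>v\<in>V. ip' w v = s * ip f v" if f: "f \<in> V" for f
  proof (rule a.Riesz_representation)
    show "\<bar>s * ip f x\<bar> \<le> (nrm f / sqrt c) * a.nrm x" if x: "x \<in> V" for x
    proof -
      have "\<bar>s * ip f x\<bar> \<le> nrm f * nrm x"
        using s Cauchy_Schwarz[OF f x] by auto
      also have "nrm x \<le> a.nrm x / sqrt c"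
        using le1[OF x] c by (simp add: nrm_def a.nrm_def field_simps flip: real_sqrt_mult)
      finally show ?thesis using f by (simp add: mult_left_mono)
    qed
  qed (use f in \<open>auto simp: bilin algebra_simps\<close>)
  have inj: "x = y" if "x \<in> V" "y \<in> V" "A x = A y" for x y
    by (rule a.nondegenerate) (use that in \<open>auto simp: ip'_def\<close>)
  have "\<exists>w\<in>V. A w = f" if f: "f \<in> V" for f
  proof -
    obtain w where w: "w \<in> V" "\<forall>v\<in>V. ip' w v = s * ip f v" using solve[OF f] by blast
    have "A w = f"
    proof (rule nondegenerate)
      show "ip (A w) v = ip f v" if "v \<in> V" for v
        using w(2) that s unfolding ip'_def by auto
    qed (use w f AV in auto)
    then show ?thesis using w by blast
  qed
  then obtain B where B: "\<And>f. f \<in> V \<Longrightarrow> B f \<in> V" "\<And>f. f \<in> V \<Longrightarrow> A (B f) = f"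
    by metis
  have BA: "B (A x) = x" if "x \<in> V" for x
    by (rule inj) (use B AV that in auto)
  have "bounded_op V ip B"
    unfolding bounded_op_def
  proof (intro conjI ballI allI exI[of _ "1 / c"])
    show "B (x + y) = B x + B y" if "x \<in> V" "y \<in> V" for x y
      by (rule inj) (use B that in \<open>auto simp: Aadd\<close>)
    show "B (r *\<^sub>R x) = r *\<^sub>R B x" if "x \<in> V" for x r
      by (rule inj) (use B that in \<open>auto simp: Ascale\<close>)
    fix f assume f: "f \<in> V"
    show "B f \<in> V" using B f by simp
    have "c * (nrm (B f) * nrm (B f)) \<le> ip' (B f) (B f)"
      using le1[of "B f"] B f nrm_sq[of "B f"] by (simp add: power2_eq_square)
    also have "\<dots> \<le> \<bar>ip f (B f)\<bar>" using s B f by (auto simp: ip'_def)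
    also have "\<dots> \<le> nrm f * nrm (B f)" using B f by (intro Cauchy_Schwarz) auto
    finally have *: "(c * nrm (B f)) * nrm (B f) \<le> nrm f * nrm (B f)" by (simp add: mult.assoc)
    have "c * nrm (B f) \<le> nrm f"
    proof (cases "nrm (B f) = 0")
      case False
      then have "0 < nrm (B f)" using nrm_nonneg[OF B(1)[OF f]] by linarith
      then show ?thesis using * by simp
    qed (use f in auto)
    then show "sqrt (ip (B f) (B f)) \<le> 1 / c * sqrt (ip f f)"
      using c by (simp add: nrm_def field_simps)
  qed
  then show ?thesis
    unfolding invertible_op_def using A B BA by blast
qed

end

section \<open>Square integrable functions\<close>

lemma norm_add_sq_le:
  fixes a b :: "'b::real_inner"
  shows "(norm (a + b))\<^sup>2 \<le> 2 * (norm a)\<^sup>2 + 2 * (norm b)\<^sup>2"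
proof -
  have "0 \<le> (norm (a - b))\<^sup>2" by simp
  then show ?thesis by (simp add: power2_norm_eq_inner algebra_simps inner_commute)
qed

lemma abs_inner_le_sq:
  fixes a b :: "'b::real_inner"
  shows "\<bar>a \<bullet> b\<bar> \<le> (norm a)\<^sup>2 + (norm b)\<^sup>2"
proof -
  have "\<bar>a \<bullet> b\<bar> \<le> norm a * norm b" by (rule Cauchy_Schwarz_ineq2)
  also have "norm a * norm b \<le> (norm a)\<^sup>2 + (norm b)\<^sup>2"
  proof -
    have "0 \<le> norm a * norm b" by simp
    then show ?thesis using sum_squares_bound[of "norm a" "norm b"] by argo
  qed
  finally show ?thesis .
qed

lemma integrable_sq_add:
  fixes f g :: "'a \<Rightarrow> 'b::euclidean_space"
  assumes [measurable]: "f \<in> borel_measurable M" "g \<in> borel_measurable M"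
    and "integrable M (\<lambda>x. (norm (f x))\<^sup>2)" "integrable M (\<lambda>x. (norm (g x))\<^sup>2)"
  shows "integrable M (\<lambda>x. (norm (f x + g x))\<^sup>2)"
  by (rule Bochner_Integration.integrable_bound[of _ "\<lambda>x. 2 * (norm (f x))\<^sup>2 + 2 * (norm (g x))\<^sup>2"])
    (use assms norm_add_sq_le in \<open>auto intro!: AE_I2\<close>)

lemma integrable_sq_diff:
  fixes f g :: "'a \<Rightarrow> 'b::euclidean_space"
  assumes "f \<in> borel_measurable M" "g \<in> borel_measurable M"
    and "integrable M (\<lambda>x. (norm (f x))\<^sup>2)" "integrable M (\<lambda>x. (norm (g x))\<^sup>2)"
  shows "integrable M (\<lambda>x. (norm (f x - g x))\<^sup>2)"
  using integrable_sq_add[of f M "\<lambda>x. - g x"] assms by simp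

lemma integrable_inner_of_sq:
  fixes f g :: "'a \<Rightarrow> 'b::euclidean_space"
  assumes [measurable]: "f \<in> borel_measurable M" "g \<in> borel_measurable M"
    and "integrable M (\<lambda>x. (norm (f x))\<^sup>2)" "integrable M (\<lambda>x. (norm (g x))\<^sup>2)"
  shows "integrable M (\<lambda>x. f x \<bullet> g x)"
  by (rule Bochner_Integration.integrable_bound[of _ "\<lambda>x. (norm (f x))\<^sup>2 + (norm (g x))\<^sup>2"])
    (use assms abs_inner_le_sq in \<open>auto intro!: AE_I2\<close>)

text \<open>A subsequence whose steps \<open>d\<^sub>k\<close> satisfy \<open>\<parallel>d\<^sub>k\<parallel>\<^sup>2 < 4\<^sup>-\<^sup>k\<close> converges almost everywhere: the
function \<open>\<Sum>k. 2\<^sup>k \<bar>d\<^sub>k\<bar>\<^sup>2\<close> is integrable, hence finite almost everywhere, and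
\<open>\<bar>d\<^sub>k\<bar> \<le> 2\<^sup>-\<^sup>k + 2\<^sup>k \<bar>d\<^sub>k\<bar>\<^sup>2\<close>. This works over a measure space of any size. Fatou's lemma then
gives convergence in the mean to the pointwise limit. The last conclusion keeps the limit
supported where the sequence is.\<close>

theorem Riesz_Fischer:
  fixes f :: "nat \<Rightarrow> 'a \<Rightarrow> 'b::euclidean_space"
  assumes meas [measurable]: "\<And>n. f n \<in> borel_measurable M"
    and int: "\<And>n. integrable M (\<lambda>x. (norm (f n x))\<^sup>2)"
    and Cauchy: "\<And>e. 0 < e \<Longrightarrow> \<exists>N. \<forall>m\<ge>N. \<forall>n\<ge>N. (\<integral>x. (norm (f m x - f n x))\<^sup>2 \<partial>M) < e"
  obtains F where "F \<in> borel_measurable M" "integrable M (\<lambda>x. (norm (F x))\<^sup>2)"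
    "(\<lambda>n. \<integral>x. (norm (f n x - F x))\<^sup>2 \<partial>M) \<longlonglongrightarrow> 0"
    "\<And>x. (\<And>n. f n x = 0) \<Longrightarrow> F x = 0"
proof -
  have intd: "integrable M (\<lambda>x. (norm (f m x - f n x))\<^sup>2)" for m n
    by (intro integrable_sq_diff meas int)
  have "\<exists>N. \<forall>m\<ge>N. \<forall>n\<ge>N. (\<integral>x. (norm (f m x - f n x))\<^sup>2 \<partial>M) < (1/4)^k" for k :: nat
    by (rule Cauchy) simp
  then obtain N where N: "\<And>k m n. m \<ge> N k \<Longrightarrow> n \<ge> N k \<Longrightarrow>
      (\<integral>x. (norm (f m x - f n x))\<^sup>2 \<partial>M) < (1/4)^k"
    by metis
  define r where "r k = (\<Sum>i\<le>k. N i) + k" for k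
  have rN: "N k \<le> r k" and rS: "r k \<le> r (Suc k)" and rk: "k \<le> r k" for k
    by (auto simp: r_def intro: trans_le_add1 member_le_sum)
  define d where "d k x = f (r (Suc k)) x - f (r k) x" for k x
  have [measurable]: "d k \<in> borel_measurable M" for k by (simp add: d_def[abs_def])
  have d_int: "(\<integral>\<^sup>+x. ennreal (2^k * (norm (d k x))\<^sup>2) \<partial>M) \<le> ennreal ((1/2)^k)" for k
  proof -
    have "(\<integral>\<^sup>+x. ennreal (2^k * (norm (d k x))\<^sup>2) \<partial>M) = ennreal (\<integral>x. 2^k * (norm (d k x))\<^sup>2 \<partial>M)"
      by (rule nn_integral_eq_integral) (use intd in \<open>auto simp: d_def\<close>)
    also have "(\<integral>x. 2^k * (norm (d k x))\<^sup>2 \<partial>M) = 2^k * (\<integral>x. (norm (d k x))\<^sup>2 \<partial>M)"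
      by simp
    also have "\<dots> \<le> 2^k * (1/4)^k"
      using N[of k "r (Suc k)" "r k"] rN[of k] rS[of k] unfolding d_def
      by (intro mult_left_mono) auto
    also have "\<dots> = (1/2)^k" by (simp flip: power_mult_distrib)
    finally show ?thesis by (simp add: ennreal_leI)
  qed
  have "(\<integral>\<^sup>+x. (\<Sum>k. ennreal (2^k * (norm (d k x))\<^sup>2)) \<partial>M) =
      (\<Sum>k. \<integral>\<^sup>+x. ennreal (2^k * (norm (d k x))\<^sup>2) \<partial>M)"
    by (rule nn_integral_suminf) simp
  also have "\<dots> \<le> (\<Sum>k. ennreal ((1/2)^k))"
    by (rule suminf_le) (use d_int in auto)
  also have "\<dots> = ennreal (\<Sum>k. (1/2)^k)"
    by (rule suminf_ennreal2) (auto simp: summable_geometric)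
  also have "\<dots> < \<infinity>" by simp
  finally have "AE x in M. (\<Sum>k. ennreal (2^k * (norm (d k x))\<^sup>2)) \<noteq> \<infinity>"
    by (intro nn_integral_noteq_infinite) auto
  then have conv: "AE x in M. convergent (\<lambda>k. f (r k) x)"
  proof eventually_elim
    fix x assume "(\<Sum>k. ennreal (2^k * (norm (d k x))\<^sup>2)) \<noteq> \<infinity>"
    then have "summable (\<lambda>k. 2^k * (norm (d k x))\<^sup>2)"
      by (intro summable_suminf_not_top) auto
    then have s: "summable (\<lambda>k. (1/2)^k + 2^k * (norm (d k x))\<^sup>2)"
      by (intro summable_add) (auto simp: summable_geometric)
    \<comment> \<open>This is \<open>2 \<bar>d\<bar> \<le> 2\<^sup>-\<^sup>k + 2\<^sup>k \<bar>d\<bar>\<^sup>2\<close>, the inequality between arithmetic and geometric mean.\<close>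
    have "norm (d k x) \<le> (1/2)^k + 2^k * (norm (d k x))\<^sup>2" for k
    proof -
      have "0 \<le> (1 / 2^k) * (1 - 2^k * norm (d k x))\<^sup>2" by simp
      also have "\<dots> = (1/2)^k + 2^k * (norm (d k x))\<^sup>2 - 2 * norm (d k x)"
        by (simp add: power2_eq_square field_simps)
      finally show ?thesis using norm_ge_zero[of "d k x"] by linarith
    qed
    then have "summable (\<lambda>k. d k x)"
      by (intro summable_comparison_test[OF _ s]) auto
    then have "convergent (\<lambda>n. (\<Sum>k<n. d k x) + f (r 0) x)"
      by (intro convergent_add convergent_const) (simp add: summable_iff_convergent)
    then show "convergent (\<lambda>k. f (r k) x)"
      by (simp add: d_def sum_lessThan_telescope[where f = "\<lambda>k. f (r k) x"])
  qed
  define F where "F x = lim (\<lambda>k. f (r k) x)" for x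
  have [measurable]: "F \<in> borel_measurable M"
    unfolding F_def[abs_def] by (rule borel_measurable_lim_metric) simp
  have est: "integrable M (\<lambda>x. (norm (f m x - F x))\<^sup>2) \<and> (\<integral>x. (norm (f m x - F x))\<^sup>2 \<partial>M) \<le> (1/4)^k"
    if m: "m \<ge> N k" for m k
  proof -
    have "(\<integral>\<^sup>+x. ennreal ((norm (f m x - F x))\<^sup>2) \<partial>M) =
        (\<integral>\<^sup>+x. liminf (\<lambda>j. ennreal ((norm (f m x - f (r j) x))\<^sup>2)) \<partial>M)"
    proof (rule nn_integral_cong_AE)
      show "AE x in M. ennreal ((norm (f m x - F x))\<^sup>2) =
          liminf (\<lambda>j. ennreal ((norm (f m x - f (r j) x))\<^sup>2))"
        using conv
      proof eventually_elim
        fix x assume "convergent (\<lambda>k. f (r k) x)"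
        then have "(\<lambda>j. f (r j) x) \<longlonglongrightarrow> F x" by (simp add: F_def convergent_LIMSEQ_iff)
        then have "(\<lambda>j. ennreal ((norm (f m x - f (r j) x))\<^sup>2)) \<longlonglongrightarrow> ennreal ((norm (f m x - F x))\<^sup>2)"
          by (intro tendsto_intros tendsto_ennrealI)
        then show "ennreal ((norm (f m x - F x))\<^sup>2) =
          liminf (\<lambda>j. ennreal ((norm (f m x - f (r j) x))\<^sup>2))"
          by (intro lim_imp_Liminf[symmetric]) auto
      qed
    qed
    also have "\<dots> \<le> liminf (\<lambda>j. \<integral>\<^sup>+x. ennreal ((norm (f m x - f (r j) x))\<^sup>2) \<partial>M)"
      by (rule nn_integral_liminf) simp
    also have "\<dots> \<le> ennreal ((1/4)^k)"
    proof (rule Liminf_le)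
      have "(\<integral>\<^sup>+x. ennreal ((norm (f m x - f (r j) x))\<^sup>2) \<partial>M) \<le> ennreal ((1/4)^k)" if "j \<ge> N k" for j
        using N[of k m "r j"] m that rk[of j] intd[of m "r j"]
        by (subst nn_integral_eq_integral) (auto intro!: ennreal_leI)
      then show "\<forall>\<^sub>F j in sequentially.
          (\<integral>\<^sup>+x. ennreal ((norm (f m x - f (r j) x))\<^sup>2) \<partial>M) \<le> ennreal ((1/4)^k)"
        by (auto simp: eventually_sequentially)
    qed simp
    finally have le: "(\<integral>\<^sup>+x. ennreal ((norm (f m x - F x))\<^sup>2) \<partial>M) \<le> ennreal ((1/4)^k)" .
    then have "integrable M (\<lambda>x. (norm (f m x - F x))\<^sup>2)"
      by (intro integrableI_bounded) (auto intro: le_less_trans)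
    moreover from this have "(\<integral>x. (norm (f m x - F x))\<^sup>2 \<partial>M) \<le> (1/4)^k"
      using le by (subst (asm) nn_integral_eq_integral) auto
    ultimately show ?thesis by blast
  qed
  show thesis
  proof
    show "F \<in> borel_measurable M" by measurable
    have "integrable M (\<lambda>x. (norm (f (N 0) x - (f (N 0) x - F x)))\<^sup>2)"
      by (rule integrable_sq_diff) (use est[of 0 "N 0"] int in auto)
    then show "integrable M (\<lambda>x. (norm (F x))\<^sup>2)" by simp
    show "(\<lambda>n. \<integral>x. (norm (f n x - F x))\<^sup>2 \<partial>M) \<longlonglongrightarrow> 0"
    proof (rule LIMSEQ_I)
      fix e :: real assume "0 < e"
      then obtain k where k: "(1/4::real)^k < e"
        using real_arch_pow_inv[of e "1/4"] by auto
      have "norm ((\<integral>x. (norm (f n x - F x))\<^sup>2 \<partial>M) - 0) < e" if "n \<ge> N k" for n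
        using est[OF that] k by simp
      then show "\<exists>no. \<forall>n\<ge>no. norm ((\<integral>x. (norm (f n x - F x))\<^sup>2 \<partial>M) - 0) < e" by blast
    qed
    show "F x = 0" if "\<And>n. f n x = 0" for x
      using that by (simp add: F_def)
  qed
qed

subsection \<open>Representatives\<close>

abbreviation meas_leb :: "('a::euclidean_space \<Rightarrow> 'b::euclidean_space) \<Rightarrow> bool" where
  "meas_leb f \<equiv> f \<in> borel_measurable lebesgue"

lemma abs_rep_aefun [simp]: "abs_aefun (rep_aefun u) = u"
  by (rule Quotient3_abs_rep[OF Quotient3_aefun])

lemma ae_eq_refl_iff: "ae_eq f f \<longleftrightarrow> meas_leb f"
  by (auto simp: ae_eq_def)

lemma abs_aefun_eq_iff: "meas_leb f \<Longrightarrow> meas_leb g \<Longrightarrow>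
    abs_aefun f = abs_aefun g \<longleftrightarrow> (AE x in lebesgue. f x = g x)"
  using Quotient3_aefun unfolding Quotient3_def by (metis ae_eq_def ae_eq_refl_iff)

lemma rep_aefun_measurable [measurable, simp]: "meas_leb (rep_aefun u)"
  using Quotient3_rep_reflp[OF Quotient3_aefun, of u] by (simp add: ae_eq_refl_iff)

lemma aefun_eq_iff: "u = v \<longleftrightarrow> (AE x in lebesgue. rep_aefun u x = rep_aefun v x)"
  using abs_aefun_eq_iff[of "rep_aefun u" "rep_aefun v"] by simp

lemma rep_abs_aefun: "meas_leb f \<Longrightarrow> AE x in lebesgue. rep_aefun (abs_aefun f) x = f x"
  by (subst abs_aefun_eq_iff[symmetric]) auto

lemma rep_zero: "AE x in lebesgue. rep_aefun 0 x = 0"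
  by (subst abs_aefun_eq_iff[symmetric]) (auto simp: zero_aefun.abs_eq zero_aefun_def)

lemma rep_plus: "AE x in lebesgue. rep_aefun (u + v) x = rep_aefun u x + rep_aefun v x"
proof (subst abs_aefun_eq_iff[symmetric])
  show "abs_aefun (rep_aefun (u + v)) = abs_aefun (\<lambda>x. rep_aefun u x + rep_aefun v x)"
    using plus_aefun.abs_eq[of "rep_aefun u" "rep_aefun v"] by (simp add: ae_eq_refl_iff)
qed auto

lemma rep_minus: "AE x in lebesgue. rep_aefun (u - v) x = rep_aefun u x - rep_aefun v x"
proof (subst abs_aefun_eq_iff[symmetric])
  show "abs_aefun (rep_aefun (u - v)) = abs_aefun (\<lambda>x. rep_aefun u x - rep_aefun v x)"
    using minus_aefun.abs_eq[of "rep_aefun u" "rep_aefun v"] by (simp add: ae_eq_refl_iff)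
qed auto

lemma rep_scale: "AE x in lebesgue. rep_aefun (c *\<^sub>R u) x = c *\<^sub>R rep_aefun u x"
proof (subst abs_aefun_eq_iff[symmetric])
  show "abs_aefun (rep_aefun (c *\<^sub>R u)) = abs_aefun (\<lambda>x. c *\<^sub>R rep_aefun u x)"
    using scaleR_aefun.abs_eq[of "rep_aefun u" c] by (simp add: ae_eq_refl_iff)
qed auto

subsection \<open>The space L2\<close>

lemma L2_iff:
  assumes [measurable]: "\<Omega> \<in> sets lebesgue"
  shows "u \<in> L2 \<Omega> \<longleftrightarrow> (AE x in lebesgue. x \<notin> \<Omega> \<longrightarrow> rep_aefun u x = 0) \<and>
    integrable lebesgue (\<lambda>x. (norm (rep_aefun u x))\<^sup>2)"
proof -
  have "integrable lebesgue (\<lambda>x. indicat_real \<Omega> x *\<^sub>R (norm (rep_aefun u x))\<^sup>2) \<longleftrightarrow>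
      integrable lebesgue (\<lambda>x. (norm (rep_aefun u x))\<^sup>2)"
    if "AE x in lebesgue. x \<notin> \<Omega> \<longrightarrow> rep_aefun u x = 0"
    by (rule integrable_cong_AE) (use that in \<open>auto simp: indicator_def elim!: eventually_mono\<close>)
  then show ?thesis by (auto simp: L2_def set_integrable_def)
qed

lemma L2_abs:
  assumes [measurable]: "\<Omega> \<in> sets lebesgue" "meas_leb f"
    and "\<And>x. x \<notin> \<Omega> \<Longrightarrow> f x = 0" "integrable lebesgue (\<lambda>x. (norm (f x))\<^sup>2)"
  shows "abs_aefun f \<in> L2 \<Omega>"
proof -
  note * = rep_abs_aefun[OF assms(2)]
  have "integrable lebesgue (\<lambda>x. (norm (rep_aefun (abs_aefun f) x))\<^sup>2)"
    by (subst integrable_cong_AE[where g = "\<lambda>x. (norm (f x))\<^sup>2"])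
      (use * assms(4) in \<open>auto elim!: eventually_mono\<close>)
  moreover have "AE x in lebesgue. x \<notin> \<Omega> \<longrightarrow> rep_aefun (abs_aefun f) x = 0"
    using * by eventually_elim (use assms(3) in auto)
  ultimately show ?thesis by (simp add: L2_iff)
qed

definition L2_form :: "'a::euclidean_space set \<Rightarrow> ('a, 'b::euclidean_space) aefun \<Rightarrow> ('a, 'b) aefun \<Rightarrow> real"
  where "L2_form S u v = (LINT x:S|lebesgue. rep_aefun u x \<bullet> rep_aefun v x)"

lemma L2_form_abs:
  assumes [measurable]: "S \<in> sets lebesgue" "meas_leb f" "meas_leb g"
  shows "L2_form S (abs_aefun f) (abs_aefun g) = (LINT x:S|lebesgue. f x \<bullet> g x)"
  unfolding L2_form_def set_lebesgue_integral_def
  by (rule integral_cong_AE)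
    (use rep_abs_aefun[OF assms(2)] rep_abs_aefun[OF assms(3)] in \<open>auto elim: eventually_elim2\<close>)

lemma subspace_L2:
  assumes [measurable]: "\<Omega> \<in> sets lebesgue"
  shows "subspace (L2 \<Omega>)"
proof (rule subspaceI)
  show "(0 :: ('a, 'b) aefun) \<in> L2 \<Omega>"
    using L2_abs[of \<Omega> "\<lambda>_. 0 :: 'b"] by (simp add: zero_aefun_def)
  show "u + v \<in> L2 \<Omega>" if "u \<in> L2 \<Omega>" "v \<in> L2 \<Omega>" for u v :: "('a, 'b) aefun"
  proof -
    have "integrable lebesgue (\<lambda>x. (norm (rep_aefun (u + v) x))\<^sup>2)"
    proof (subst integrable_cong_AE)
      show "AE x in lebesgue. (norm (rep_aefun (u + v) x))\<^sup>2 = (norm (rep_aefun u x + rep_aefun v x))\<^sup>2"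
        using rep_plus[of u v] by eventually_elim simp
      show "integrable lebesgue (\<lambda>x. (norm (rep_aefun u x + rep_aefun v x))\<^sup>2)"
        using that by (intro integrable_sq_add) (auto simp: L2_iff)
    qed auto
    moreover have "AE x in lebesgue. x \<notin> \<Omega> \<longrightarrow> rep_aefun (u + v) x = 0"
      using that[unfolded L2_iff[OF assms]] rep_plus[of u v]
      by (auto elim: AE_mp)
    ultimately show ?thesis by (simp add: L2_iff)
  qed
  show "c *\<^sub>R u \<in> L2 \<Omega>" if "u \<in> L2 \<Omega>" for u :: "('a, 'b) aefun" and c
  proof -
    have "integrable lebesgue (\<lambda>x. (norm (rep_aefun (c *\<^sub>R u) x))\<^sup>2)"
    proof (subst integrable_cong_AE)
      show "AE x in lebesgue. (norm (rep_aefun (c *\<^sub>R u) x))\<^sup>2 = c\<^sup>2 * (norm (rep_aefun u x))\<^sup>2"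
        using rep_scale[of c u] by eventually_elim (simp add: power_mult_distrib)
      show "integrable lebesgue (\<lambda>x. c\<^sup>2 * (norm (rep_aefun u x))\<^sup>2)"
        using that by (auto simp: L2_iff)
    qed auto
    moreover have "AE x in lebesgue. x \<notin> \<Omega> \<longrightarrow> rep_aefun (c *\<^sub>R u) x = 0"
      using that[unfolded L2_iff[OF assms]] rep_scale[of c u]
      by (auto elim: AE_mp)
    ultimately show ?thesis by (simp add: L2_iff)
  qed
qed

lemma L2_form_integrable:
  assumes [measurable]: "\<Omega> \<in> sets lebesgue" "S \<in> sets lebesgue" and "u \<in> L2 \<Omega>" "v \<in> L2 \<Omega>"
  shows "set_integrable lebesgue S (\<lambda>x. rep_aefun u x \<bullet> rep_aefun v x)"
  unfolding set_integrable_def using assms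
  by (intro integrable_mult_indicator integrable_inner_of_sq) (auto simp: L2_iff)

lemma semi_inner_L2:
  assumes [measurable]: "\<Omega> \<in> sets lebesgue" "S \<in> sets lebesgue"
  shows "semi_inner (L2 \<Omega> :: ('a::euclidean_space, 'b::euclidean_space) aefun set) (L2_form S)"
proof
  fix u v w :: "('a, 'b) aefun" and c :: real
  assume u: "u \<in> L2 \<Omega>" and v: "v \<in> L2 \<Omega>"
  show "L2_form S u v = L2_form S v u" by (simp add: L2_form_def inner_commute)
  have "L2_form S (c *\<^sub>R u) v = (LINT x:S|lebesgue. c * (rep_aefun u x \<bullet> rep_aefun v x))"
    unfolding L2_form_def set_lebesgue_integral_def
    by (rule integral_cong_AE) (use rep_scale[of c u] in \<open>auto elim!: eventually_mono\<close>)
  then show "L2_form S (c *\<^sub>R u) v = c * L2_form S u v" by (simp add: L2_form_def)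
  assume w: "w \<in> L2 \<Omega>"
  have "L2_form S (u + v) w =
      (LINT x:S|lebesgue. rep_aefun u x \<bullet> rep_aefun w x + rep_aefun v x \<bullet> rep_aefun w x)"
    unfolding L2_form_def set_lebesgue_integral_def
    by (rule integral_cong_AE)
      (use rep_plus[of u v] in \<open>auto elim!: eventually_mono simp: inner_add_left\<close>)
  also have "\<dots> = L2_form S u w + L2_form S v w"
    unfolding L2_form_def
    by (rule set_integral_add) (rule L2_form_integrable[OF assms]; fact)+
  finally show "L2_form S (u + v) w = L2_form S u w + L2_form S v w" .
next
  show "0 \<le> L2_form S u u" for u :: "('a, 'b) aefun"
    unfolding L2_form_def set_lebesgue_integral_def
    by (rule Bochner_Integration.integral_nonneg) simp
qed (simp add: subspace_L2)

lemma L2_form_full: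
  assumes [measurable]: "\<Omega> \<in> sets lebesgue" and u: "u \<in> L2 \<Omega>"
  shows "L2_form \<Omega> u v = (LINT x|lebesgue. rep_aefun u x \<bullet> rep_aefun v x)"
  unfolding L2_form_def set_lebesgue_integral_def
  by (rule integral_cong_AE) (use u in \<open>auto simp: L2_iff indicator_def elim!: eventually_mono\<close>)

lemma hilbert_L2:
  assumes \<Omega> [measurable]: "\<Omega> \<in> sets lebesgue"
  shows "hilbert_on (L2 \<Omega> :: ('a::euclidean_space, 'b::euclidean_space) aefun set) (L2_form \<Omega>)"
proof -
  interpret semi_inner "L2 \<Omega> :: ('a, 'b) aefun set" "L2_form \<Omega>"
    by (rule semi_inner_L2) auto
  have diff: "L2_form \<Omega> (u - v) (u - v) = (LINT x|lebesgue. (norm (rep_aefun u x - rep_aefun v x))\<^sup>2)"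
    if "u \<in> L2 \<Omega>" "v \<in> L2 \<Omega>" for u v :: "('a, 'b) aefun"
  proof -
    have "L2_form \<Omega> (u - v) (u - v) = (LINT x|lebesgue. rep_aefun (u - v) x \<bullet> rep_aefun (u - v) x)"
      by (rule L2_form_full) (use that in auto)
    also have "\<dots> = (LINT x|lebesgue. (norm (rep_aefun u x - rep_aefun v x))\<^sup>2)"
      by (rule integral_cong_AE)
        (use rep_minus[of u v] in \<open>auto elim!: eventually_mono simp: power2_norm_eq_inner\<close>)
    finally show ?thesis .
  qed
  show ?thesis
  proof
    fix u :: "('a, 'b) aefun" assume u: "u \<in> L2 \<Omega>" "L2_form \<Omega> u u = 0"
    then have "(LINT x|lebesgue. (norm (rep_aefun u x))\<^sup>2) = 0"
      by (simp add: L2_form_full power2_norm_eq_inner)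
    moreover have "integrable lebesgue (\<lambda>x. (norm (rep_aefun u x))\<^sup>2)" using u by (simp add: L2_iff)
    ultimately have "AE x in lebesgue. (norm (rep_aefun u x))\<^sup>2 = 0"
      by (subst (asm) integral_nonneg_eq_0_iff_AE) auto
    then have "AE x in lebesgue. rep_aefun u x = rep_aefun 0 x"
      using rep_zero by eventually_elim simp
    then show "u = 0" by (simp add: aefun_eq_iff)
  next
    fix X :: "nat \<Rightarrow> ('a, 'b) aefun"
    assume X: "\<And>n. X n \<in> L2 \<Omega>"
      and C: "\<And>e. 0 < e \<Longrightarrow> \<exists>N. \<forall>m\<ge>N. \<forall>n\<ge>N. L2_form \<Omega> (X m - X n) (X m - X n) < e"
    define f where "f n x = indicat_real \<Omega> x *\<^sub>R rep_aefun (X n) x" for n x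
    have fX: "AE x in lebesgue. f n x = rep_aefun (X n) x" for n
      using X[of n, unfolded L2_iff[OF \<Omega>]] by (auto simp: f_def indicator_def elim: AE_mp)
    have [measurable]: "meas_leb (f n)" for n by (simp add: f_def[abs_def])
    have sq: "integrable lebesgue (\<lambda>x. (norm (f n x))\<^sup>2)" for n
    proof (subst integrable_cong_AE)
      show "AE x in lebesgue. (norm (f n x))\<^sup>2 = (norm (rep_aefun (X n) x))\<^sup>2"
        using fX[of n] by eventually_elim simp
      show "integrable lebesgue (\<lambda>x. (norm (rep_aefun (X n) x))\<^sup>2)" using X L2_iff[OF \<Omega>] by blast
    qed auto
    have fd: "L2_form \<Omega> (X m - X n) (X m - X n) = (LINT x|lebesgue. (norm (f m x - f n x))\<^sup>2)" for m n
      unfolding diff[OF X X]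
      by (rule integral_cong_AE) (use fX[of m] fX[of n] in \<open>auto elim: eventually_elim2\<close>)
    obtain F where F [measurable]: "meas_leb F" and iF: "integrable lebesgue (\<lambda>x. (norm (F x))\<^sup>2)"
      and lim: "(\<lambda>n. LINT x|lebesgue. (norm (f n x - F x))\<^sup>2) \<longlonglongrightarrow> 0"
      and F0: "\<And>x. (\<And>n. f n x = 0) \<Longrightarrow> F x = 0"
      using Riesz_Fischer[of f lebesgue] sq C[unfolded fd] by auto
    have FL: "abs_aefun F \<in> L2 \<Omega>"
      by (rule L2_abs[OF \<Omega> F _ iF]) (auto intro!: F0 simp: f_def)
    have "L2_form \<Omega> (X n - abs_aefun F) (X n - abs_aefun F) = (LINT x|lebesgue. (norm (f n x - F x))\<^sup>2)" for n
      unfolding diff[OF X FL]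
      by (rule integral_cong_AE) (use fX[of n] rep_abs_aefun[OF F] in \<open>auto elim: eventually_elim2\<close>)
    then show "\<exists>u\<in>L2 \<Omega>. (\<lambda>n. L2_form \<Omega> (X n - u) (X n - u)) \<longlonglongrightarrow> 0"
      using lim FL by (intro bexI[of _ "abs_aefun F"]) simp_all
  qed
qed


section \<open>Calculus of smooth functions\<close>

abbreviation Ck :: "nat \<Rightarrow> 'a::euclidean_space set \<Rightarrow> ('a \<Rightarrow> real) \<Rightarrow> bool" where
  "Ck \<equiv> k_times_cont_diff_on"

lemma Ck_cong:
  assumes "open S" "\<And>x. x \<in> S \<Longrightarrow> f x = g x"
  shows "Ck k S f \<longleftrightarrow> Ck k S g"
  using assms(2)
proof (induction k arbitrary: f g)
  case 0
  then show ?case by (simp cong: continuous_on_cong)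
next
  case (Suc k)
  have step: "Ck (Suc k) S g'" if f: "Ck (Suc k) S f'" and eq: "\<And>x. x \<in> S \<Longrightarrow> f' x = g' x" for f' g'
  proof -
    have d: "frechet_derivative f' (at x) = frechet_derivative g' (at x)" if "x \<in> S" for x
    proof (rule frechet_derivative_transform_within_open[OF _ assms(1) that eq])
      show "f' differentiable at x"
        using f that assms(1) by (auto simp: differentiable_on_eq_differentiable_at)
    qed
    have "g' differentiable_on S"
      unfolding differentiable_on_eq_differentiable_at[OF assms(1)]
    proof
      fix x assume x: "x \<in> S"
      then have "f' differentiable at x"
        using f assms(1) by (simp add: differentiable_on_eq_differentiable_at)
      then obtain D where "(f' has_derivative D) (at x)" by (auto simp: differentiable_def)
      from has_derivative_transform_within_open[OF this assms(1) x eq]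
      show "g' differentiable at x" by (auto simp: differentiable_def)
    qed
    moreover have "Ck k S (\<lambda>x. frechet_derivative g' (at x) b)" if "b \<in> Basis" for b
    proof -
      have "Ck k S (\<lambda>x. frechet_derivative f' (at x) b)" using f that by simp
      moreover have "Ck k S (\<lambda>x. frechet_derivative f' (at x) b) =
          Ck k S (\<lambda>x. frechet_derivative g' (at x) b)"
        by (rule Suc.IH) (simp add: d)
      ultimately show ?thesis by simp
    qed
    ultimately show ?thesis by simp
  qed
  show ?case
  proof
    show "Ck (Suc k) S g" if "Ck (Suc k) S f" using that Suc.prems by (rule step)
    show "Ck (Suc k) S f" if "Ck (Suc k) S g" using that Suc.prems[symmetric] by (rule step)
  qed
qed

text \<open>The definition refers to the derivative selected by \<^const>\<open>frechet_derivative\<close>; on an open set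
the derivative is unique, so smoothness can be checked with whatever formula is at hand.\<close>

lemma Ck_SucI:
  assumes S: "open S" and d: "\<And>x. x \<in> S \<Longrightarrow> (f has_derivative f' x) (at x)"
    and k: "\<And>b. b \<in> Basis \<Longrightarrow> Ck k S (\<lambda>x. f' x b)"
  shows "Ck (Suc k) S f"
proof -
  have "f differentiable_on S"
    using d by (auto simp: differentiable_on_eq_differentiable_at[OF S] differentiable_def)
  moreover have "Ck k S (\<lambda>x. frechet_derivative f (at x) b)" if "b \<in> Basis" for b
  proof -
    have "frechet_derivative f (at x) b = f' x b" if "x \<in> S" for x
      using frechet_derivative_at[OF d[OF that]] by simp
    then show ?thesis
      using Ck_cong[OF S, of "\<lambda>x. frechet_derivative f (at x) b" "\<lambda>x. f' x b" k] k[OF that] by simp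
  qed
  ultimately show ?thesis by simp
qed

lemma Ck_Suc_derivative:
  assumes "open S" "Ck (Suc k) S f" "x \<in> S"
  shows "(f has_derivative frechet_derivative f (at x)) (at x)"
  using assms by (simp add: differentiable_on_eq_differentiable_at flip: frechet_derivative_works)

lemma Ck_Suc_imp: "open S \<Longrightarrow> Ck (Suc k) S f \<Longrightarrow> Ck k S f"
proof (induction k arbitrary: f)
  case 0
  then show ?case by (simp add: differentiable_imp_continuous_on)
next
  case (Suc k)
  have "Ck k S (\<lambda>x. frechet_derivative f (at x) b)" if "b \<in> Basis" for b
    using Suc.prems that by (intro Suc.IH) simp_all
  then show ?case using Suc.prems by simp
qed

lemma Ck_const: "open S \<Longrightarrow> Ck k S (\<lambda>_. c)"
proof (induction k arbitrary: c)
  case (Suc k)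
  show ?case by (rule Ck_SucI[OF Suc.prems has_derivative_const]) (rule Suc.IH[OF Suc.prems])
qed simp

lemma Ck_linear:
  assumes "open S" "bounded_linear f"
  shows "Ck k S f"
proof (cases k)
  case 0
  then show ?thesis using assms by (simp add: linear_continuous_on)
next
  case (Suc k')
  show ?thesis unfolding Suc
    by (rule Ck_SucI[OF assms(1) bounded_linear_imp_has_derivative[OF assms(2)]])
      (rule Ck_const[OF assms(1)])+
qed

lemma Ck_add: "open S \<Longrightarrow> Ck k S f \<Longrightarrow> Ck k S g \<Longrightarrow> Ck k S (\<lambda>x. f x + g x)"
proof (induction k arbitrary: f g)
  case 0
  then show ?case by (simp add: continuous_on_add)
next
  case (Suc k)
  show ?case
    by (rule Ck_SucI[OF Suc.prems(1) has_derivative_add[OF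
          Ck_Suc_derivative[OF Suc.prems(1,2)] Ck_Suc_derivative[OF Suc.prems(1,3)]]])
      (use Suc in auto)
qed

lemma Ck_mult: "open S \<Longrightarrow> Ck k S f \<Longrightarrow> Ck k S g \<Longrightarrow> Ck k S (\<lambda>x. f x * g x)"
proof (induction k arbitrary: f g)
  case 0
  then show ?case by (simp add: continuous_on_mult)
next
  case (Suc k)
  show ?case
    by (rule Ck_SucI[OF Suc.prems(1) has_derivative_mult[OF
          Ck_Suc_derivative[OF Suc.prems(1,2)] Ck_Suc_derivative[OF Suc.prems(1,3)]]])
      (use Suc Ck_Suc_imp[OF Suc.prems(1,2)] Ck_Suc_imp[OF Suc.prems(1,3)] in
        \<open>auto intro!: Ck_add\<close>)
qed

lemma Ck_compose:
  fixes g :: "real \<Rightarrow> real"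
  shows "open S \<Longrightarrow> open T \<Longrightarrow> (\<And>x. x \<in> S \<Longrightarrow> f x \<in> T) \<Longrightarrow> Ck k S f \<Longrightarrow> Ck k T g \<Longrightarrow>
    Ck k S (\<lambda>x. g (f x))"
proof (induction k arbitrary: f g)
  case 0
  then show ?case
    using continuous_on_compose2[of T g S f] by (auto simp: image_subset_iff)
next
  case (Suc k)
  note S = Suc.prems(1) and T = Suc.prems(2)
  let ?g' = "\<lambda>y. frechet_derivative g (at y) 1"
  have g': "(g has_derivative (\<lambda>h. h * ?g' y)) (at y)" if "y \<in> T" for y
  proof -
    have d: "(g has_derivative frechet_derivative g (at y)) (at y)"
      by (rule Ck_Suc_derivative[OF T Suc.prems(5) that])
    then have "frechet_derivative g (at y) h = h * ?g' y" for h
      using linear_scale[OF has_derivative_linear[OF d], of h 1] by simp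
    with d show ?thesis by (metis (no_types, lifting) ext)
  qed
  have "((\<lambda>x. g (f x)) has_derivative (\<lambda>h. frechet_derivative f (at x) h * ?g' (f x))) (at x)"
    if "x \<in> S" for x
    using has_derivative_compose[OF Ck_Suc_derivative[OF S Suc.prems(4) that] g'[OF Suc.prems(3)[OF that]]]
    by simp
  then show ?case
  proof (rule Ck_SucI[OF S])
    fix b :: 'a assume b: "b \<in> Basis"
    have "Ck k S (\<lambda>x. ?g' (f x))"
      by (rule Suc.IH[OF S T Suc.prems(3) Ck_Suc_imp[OF S Suc.prems(4)]])
        (use Suc.prems(5) in auto)
    then show "Ck k S (\<lambda>x. frechet_derivative f (at x) b * ?g' (f x))"
      using Suc.prems(4) b by (intro Ck_mult[OF S]) auto
  qed
qed

lemma Ck_local: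
  assumes "open S" "\<And>x. x \<in> S \<Longrightarrow> \<exists>U. open U \<and> x \<in> U \<and> Ck k U f"
  shows "Ck k S f"
  using assms
proof (induction k arbitrary: f)
  case 0
  then show ?case
    by (auto simp: continuous_on_eq_continuous_at dest!: bspec)
      (metis continuous_on_eq_continuous_at)
next
  case (Suc k)
  have "f differentiable_on S"
    unfolding differentiable_on_eq_differentiable_at[OF Suc.prems(1)]
  proof
    fix x assume "x \<in> S"
    then obtain U where "open U" "x \<in> U" "Ck (Suc k) U f" using Suc.prems(2) by blast
    then show "f differentiable at x" by (simp add: differentiable_on_eq_differentiable_at)
  qed
  moreover have "Ck k S (\<lambda>x. frechet_derivative f (at x) b)" if "b \<in> Basis" for b
  proof (rule Suc.IH[OF Suc.prems(1)])
    fix x assume "x \<in> S"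
    then obtain U where "open U" "x \<in> U" "Ck (Suc k) U f" using Suc.prems(2) by blast
    then show "\<exists>U. open U \<and> x \<in> U \<and> Ck k U (\<lambda>x. frechet_derivative f (at x) b)"
      using that by auto
  qed
  ultimately show ?case by simp
qed

lemma Ck_subset: "T \<subseteq> S \<Longrightarrow> Ck k S f \<Longrightarrow> Ck k T f"
proof (induction k arbitrary: f)
  case 0 then show ?case by (auto intro: continuous_on_subset)
next
  case (Suc k) then show ?case by (auto intro: differentiable_on_subset)
qed

lemma smooth_on_cong: "open S \<Longrightarrow> (\<And>x. x \<in> S \<Longrightarrow> f x = g x) \<Longrightarrow> smooth_on S f \<longleftrightarrow> smooth_on S g"
  unfolding smooth_on_def using Ck_cong[of S f g] by blast

lemma smooth_on_const [simp]: "open S \<Longrightarrow> smooth_on S (\<lambda>_. c)"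
  by (simp add: smooth_on_def Ck_const)

lemma smooth_on_linear: "open S \<Longrightarrow> bounded_linear f \<Longrightarrow> smooth_on S f"
  by (simp add: smooth_on_def Ck_linear)

lemma smooth_on_add: "open S \<Longrightarrow> smooth_on S f \<Longrightarrow> smooth_on S g \<Longrightarrow> smooth_on S (\<lambda>x. f x + g x)"
  by (simp add: smooth_on_def Ck_add)

lemma smooth_on_mult: "open S \<Longrightarrow> smooth_on S f \<Longrightarrow> smooth_on S g \<Longrightarrow> smooth_on S (\<lambda>x. f x * g x)"
  by (simp add: smooth_on_def Ck_mult)

lemma smooth_on_minus: "open S \<Longrightarrow> smooth_on S f \<Longrightarrow> smooth_on S (\<lambda>x. - f x)"
  using smooth_on_mult[of S "\<lambda>_. -1" f] by simp

lemma smooth_on_diff: "open S \<Longrightarrow> smooth_on S f \<Longrightarrow> smooth_on S g \<Longrightarrow> smooth_on S (\<lambda>x. f x - g x)"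
  using smooth_on_add[of S f "\<lambda>x. - g x"] smooth_on_minus[of S g] by simp

lemma smooth_on_sum: "open S \<Longrightarrow> (\<And>i. i \<in> I \<Longrightarrow> smooth_on S (f i)) \<Longrightarrow> smooth_on S (\<lambda>x. \<Sum>i\<in>I. f i x)"
  by (induction I rule: infinite_finite_induct) (auto intro: smooth_on_add)

lemma smooth_on_prod: "open S \<Longrightarrow> (\<And>i. i \<in> I \<Longrightarrow> smooth_on S (f i)) \<Longrightarrow> smooth_on S (\<lambda>x. \<Prod>i\<in>I. f i x)"
  by (induction I rule: infinite_finite_induct) (auto intro: smooth_on_mult)

lemma smooth_on_compose:
  fixes g :: "real \<Rightarrow> real"
  assumes "open S" "open T" "smooth_on S f" "smooth_on T g" "\<And>x. x \<in> S \<Longrightarrow> f x \<in> T"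
  shows "smooth_on S (\<lambda>x. g (f x))"
  unfolding smooth_on_def
proof
  show "Ck k S (\<lambda>x. g (f x))" for k
    by (rule Ck_compose[OF assms(1,2,5)]) (use assms(3,4) in \<open>simp_all add: smooth_on_def\<close>)
qed

text \<open>Functions defined in polar coordinates are seen to be smooth away from \<open>0\<close> by composition,
and near \<open>0\<close> because they vanish there; this patches the two.\<close>

lemma smooth_on_local:
  assumes "open S" "\<And>x. x \<in> S \<Longrightarrow> \<exists>U. open U \<and> x \<in> U \<and> smooth_on U f"
  shows "smooth_on S f"
  unfolding smooth_on_def
proof (intro allI Ck_local[OF assms(1)])
  fix k x assume "x \<in> S"
  then obtain U where "open U" "x \<in> U" "smooth_on U f" using assms(2) by blast
  then show "\<exists>U. open U \<and> x \<in> U \<and> Ck k U f"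
    unfolding smooth_on_def by (intro exI[of _ U]) simp
qed

lemma smooth_on_subset: "T \<subseteq> S \<Longrightarrow> smooth_on S f \<Longrightarrow> smooth_on T f"
  unfolding smooth_on_def by (intro allI Ck_subset[of T S]) auto

lemma smooth_on_partial:
  "smooth_on S f \<Longrightarrow> b \<in> Basis \<Longrightarrow> smooth_on S (\<lambda>x. frechet_derivative f (at x) b)"
  unfolding smooth_on_def by (metis k_times_cont_diff_on.simps(2))

lemma smooth_on_has_derivative:
  assumes "open S" "smooth_on S f" "x \<in> S"
  shows "(f has_derivative frechet_derivative f (at x)) (at x)"
  by (rule Ck_Suc_derivative[of S 0]) (use assms smooth_on_def in blast)+

lemma smooth_on_continuous_on: "smooth_on S f \<Longrightarrow> continuous_on S f"
  unfolding smooth_on_def by (metis k_times_cont_diff_on.simps(1))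

text \<open>Induction on the order needs a hypothesis that its own derivatives satisfy again, and this
is membership in a family closed under differentiation. It applies to polynomials, to powers of
the inverse, to trigonometric functions, and to the flat functions below.\<close>

lemma smooth_on_family:
  fixes F :: "(real \<Rightarrow> real) set"
  assumes S: "open S"
    and F: "\<And>f. f \<in> F \<Longrightarrow> \<exists>f'\<in>F. \<forall>x\<in>S. (f has_real_derivative f' x) (at x)"
    and f: "f \<in> F"
  shows "smooth_on S f"
proof -
  have "Ck k S f" for k
    using f
  proof (induction k arbitrary: f)
    case 0
    then obtain f' where "\<forall>x\<in>S. (f has_real_derivative f' x) (at x)" using F by blast
    then show ?case
      by (auto simp: continuous_on_eq_continuous_at[OF S] intro: DERIV_isCont)
  next
    case (Suc k)
    then obtain f' where f': "f' \<in> F" "\<forall>x\<in>S. (f has_real_derivative f' x) (at x)" using F by blast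
    show ?case
    proof (rule Ck_SucI[OF S])
      show "(f has_derivative (\<lambda>h. h * f' x)) (at x)" if "x \<in> S" for x
        using f'(2) that by (simp add: has_field_derivative_def mult.commute[of _ "f' x"])
      show "Ck k S (\<lambda>x. b * f' x)" if "b \<in> Basis" for b
        using that Suc.IH[OF f'(1)] by simp
    qed
  qed
  then show ?thesis by (simp add: smooth_on_def)
qed

lemma smooth_real_derivative:
  fixes g :: "real \<Rightarrow> real"
  assumes "smooth_on UNIV g"
  obtains g' where "smooth_on UNIV g'" "\<And>x. (g has_real_derivative g' x) (at x)"
proof
  show "smooth_on UNIV (\<lambda>x. frechet_derivative g (at x) 1)"
    by (rule smooth_on_partial[OF assms]) simp
  show "(g has_real_derivative frechet_derivative g (at x) 1) (at x)" for x
  proof -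
    have d: "(g has_derivative frechet_derivative g (at x)) (at x)"
      by (rule smooth_on_has_derivative[OF _ assms]) auto
    then have "frechet_derivative g (at x) h = frechet_derivative g (at x) 1 * h" for h
      using linear_scale[OF has_derivative_linear[OF d], of h 1] by simp
    with d show ?thesis by (metis (no_types, lifting) ext has_field_derivative_def)
  qed
qed

lemma smooth_exp: "smooth_on UNIV (exp :: real \<Rightarrow> real)"
  by (rule smooth_on_family[of _ "{exp}"]) auto

lemma smooth_cos: "smooth_on UNIV (\<lambda>x::real. cos (w * x))"
proof (rule smooth_on_family[of _ "{\<lambda>x. a * sin (w * x) + b * cos (w * x) |a b. True}"])
  fix f assume "f \<in> {\<lambda>x. a * sin (w * x) + b * cos (w * x) |a b::real. True}"
  then obtain a b where f: "f = (\<lambda>x. a * sin (w * x) + b * cos (w * x))" by auto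
  have "(f has_real_derivative (- (b * w)) * sin (w * x) + (a * w) * cos (w * x)) (at x)" for x
    unfolding f by (auto intro!: derivative_eq_intros)
  then show "\<exists>f'\<in>{\<lambda>x. a * sin (w * x) + b * cos (w * x) |a b. True}.
      \<forall>x\<in>UNIV. (f has_real_derivative f' x) (at x)"
    by (intro bexI[of _ "\<lambda>x. (- (b * w)) * sin (w * x) + (a * w) * cos (w * x)"]) blast+
next
  show "(\<lambda>x. cos (w * x)) \<in> {\<lambda>x. a * sin (w * x) + b * cos (w * x) |a b. True}"
    by (intro CollectI exI[of _ 0] exI[of _ 1]) simp
qed auto

lemma smooth_inverse_power: "smooth_on (- {0}) (\<lambda>x::real. c * inverse x ^ n)"
proof (rule smooth_on_family[of _ "{\<lambda>x. c * inverse x ^ n |c n. True}"])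
  fix f assume "f \<in> {\<lambda>x::real. c * inverse x ^ n |c n. True}"
  then obtain c n where f: "f = (\<lambda>x. c * inverse x ^ n)" by auto
  have "(f has_real_derivative (- c * real n) * inverse x ^ Suc n) (at x)" if "x \<noteq> 0" for x
    unfolding f using that
    by (auto intro!: derivative_eq_intros, cases n) (auto simp: field_simps power_eq_if)
  then show "\<exists>f'\<in>{\<lambda>x. c * inverse x ^ n |c n. True}.
      \<forall>x\<in>- {0}. (f has_real_derivative f' x) (at x)"
    by (intro bexI[of _ "\<lambda>x. (- c * real n) * inverse x ^ Suc n"]) blast+
qed auto

lemma smooth_inverse: "smooth_on (- {0}) (inverse :: real \<Rightarrow> real)"
  using smooth_inverse_power[of 1 1] by simp

lemma smooth_ln: "smooth_on {0<..} (ln :: real \<Rightarrow> real)"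
  unfolding smooth_on_def
proof
  show "Ck k {0<..} (ln :: real \<Rightarrow> real)" for k
  proof (cases k)
    case (Suc k')
    show ?thesis unfolding Suc
    proof (rule Ck_SucI)
      show "(ln has_derivative (\<lambda>h. h * inverse x)) (at x)" if "x \<in> {0<..}" for x :: real
        using DERIV_ln[of x] that by (simp add: has_field_derivative_def mult.commute[of _ "inverse x"])
      show "Ck k' {0<..} (\<lambda>x::real. b * inverse x)" if "b \<in> Basis" for b
        using smooth_on_subset[OF _ smooth_inverse, of "{0<..}"] that by (auto simp: smooth_on_def)
    qed simp
  qed (auto intro!: continuous_intros)
qed

text \<open>With a polynomial factor in \<open>1/x\<close> the functions \<open>e\<^sup>-\<^sup>1\<^sup>/\<^sup>x\<close> become closed under
differentiation, also at \<open>0\<close>, so smoothness of all of them follows without computing higher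
derivatives.\<close>

definition flat :: "real poly \<Rightarrow> real \<Rightarrow> real" where
  "flat p x = (if 0 < x then poly p (1/x) * exp (- (1/x)) else 0)"

lemma poly_div_exp_tendsto: "((\<lambda>y. poly p y / exp y) \<longlongrightarrow> (0::real)) at_top"
proof -
  have "((\<lambda>y. \<Sum>i\<le>degree p. coeff p i * (y ^ i / exp y)) \<longlongrightarrow> (\<Sum>i\<le>degree p. coeff p i * 0)) at_top"
    by (intro tendsto_intros tendsto_power_div_exp_0)
  then show ?thesis by (simp add: poly_altdef sum_divide_distrib)
qed

lemma flat_tendsto: "((\<lambda>x. poly p (1/x) * exp (- (1/x))) \<longlongrightarrow> (0::real)) (at_right 0)"
proof -
  have "((\<lambda>x. poly p (inverse x) / exp (inverse x)) \<longlongrightarrow> (0::real)) (at_right 0)"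
    by (rule filterlim_compose[OF poly_div_exp_tendsto filterlim_inverse_at_top_right])
  then show ?thesis by (simp add: exp_minus inverse_eq_divide field_simps)
qed

lemma flat_derivative: "(flat p has_real_derivative flat ([:0,0,1:] * (p - pderiv p)) x) (at x)"
proof -
  consider "x > 0" | "x < 0" | "x = 0" by linarith
  then show ?thesis
  proof cases
    case 1
    have "((\<lambda>x. poly p (1/x) * exp (- (1/x))) has_real_derivative flat ([:0,0,1:] * (p - pderiv p)) x) (at x)"
      using 1 by (auto intro!: derivative_eq_intros DERIV_chain'[OF _ poly_DERIV]
          simp: flat_def power2_eq_square field_simps)
    then show ?thesis
      by (rule has_field_derivative_transform_within_open[of _ _ _ "{0<..}"])
        (use 1 in \<open>auto simp: flat_def\<close>)
  next
    case 2
    have "((\<lambda>x. 0) has_real_derivative flat ([:0,0,1:] * (p - pderiv p)) x) (at x)"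
      using 2 by (simp add: flat_def)
    then show ?thesis
      by (rule has_field_derivative_transform_within_open[of _ _ _ "{..<0}"])
        (use 2 in \<open>auto simp: flat_def\<close>)
  next
    case 3
    have "((\<lambda>h. flat p h / h) \<longlongrightarrow> 0) (at 0)"
      unfolding filterlim_at_split
    proof
      show "((\<lambda>h. flat p h / h) \<longlongrightarrow> 0) (at_left 0)"
        by (rule tendsto_eventually) (auto simp: flat_def eventually_at_filter)
      show "((\<lambda>h. flat p h / h) \<longlongrightarrow> 0) (at_right 0)"
        using flat_tendsto[of "pCons 0 p"]
        by (rule Lim_transform_eventually) (auto simp: flat_def eventually_at_filter)
    qed
    then show ?thesis using 3 by (simp add: has_field_derivative_iff flat_def)
  qed
qed

lemma smooth_flat: "smooth_on UNIV (flat p)"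
  by (rule smooth_on_family[of _ "range flat"]) (auto intro: flat_derivative)

definition smooth_step :: "real \<Rightarrow> real" where
  "smooth_step x = flat 1 x * inverse (flat 1 x + flat 1 (1 - x))"

lemma flat_1: "flat 1 x \<ge> 0" "x > 0 \<Longrightarrow> flat 1 x > 0" "x \<le> 0 \<Longrightarrow> flat 1 x = 0"
  by (auto simp: flat_def)

lemma smooth_step_values [simp]:
  "x \<le> 0 \<Longrightarrow> smooth_step x = 0" "1 \<le> x \<Longrightarrow> smooth_step x = 1"
  using flat_1(2)[of x] by (auto simp: smooth_step_def flat_1(3))

lemma flat_denominator_pos: "flat 1 x + flat 1 (1 - x) > 0"
proof (cases "x > 0")
  case True
  then show ?thesis using flat_1(2)[of x] flat_1(1)[of "1 - x"] by linarith
next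
  case False
  then show ?thesis using flat_1(1)[of x] flat_1(2)[of "1 - x"] by linarith
qed

lemma smooth_step_bounds: "0 \<le> smooth_step x" "smooth_step x \<le> 1"
  using flat_1(1)[of x] flat_1(1)[of "1 - x"] flat_denominator_pos[of x]
  by (auto simp: smooth_step_def field_simps)

lemma smooth_step_smooth: "smooth_on UNIV smooth_step"
proof -
  have "smooth_on UNIV (\<lambda>x::real. 1 - x)"
    by (rule smooth_on_diff) (auto intro: smooth_on_linear bounded_linear_ident)
  then have "smooth_on UNIV (\<lambda>x. flat 1 (1 - x))"
    by (intro smooth_on_compose[of UNIV UNIV "\<lambda>x. 1 - x" "flat 1"])
      (auto intro: smooth_flat)
  then have "smooth_on UNIV (\<lambda>x. flat 1 x + flat 1 (1 - x))"
    by (intro smooth_on_add smooth_flat) auto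
  then have "smooth_on UNIV (\<lambda>x. inverse (flat 1 x + flat 1 (1 - x)))"
    using smooth_on_compose[OF open_UNIV _ _ smooth_inverse, of "\<lambda>x. flat 1 x + flat 1 (1 - x)"]
      flat_denominator_pos
    by (simp add: less_le open_Compl)
  then show ?thesis
    unfolding smooth_step_def[abs_def] by (intro smooth_on_mult smooth_flat) auto
qed


section \<open>Test functions\<close>

lemma Ck_translate: "Ck k UNIV f \<Longrightarrow> Ck k UNIV (\<lambda>x. f (x + h))"
proof (induction k arbitrary: f)
  case 0
  then show ?case using continuous_on_compose2[of UNIV f UNIV "\<lambda>x. x + h"]
    by (simp add: continuous_on_add)
next
  case (Suc k)
  have d: "(f has_derivative frechet_derivative f (at x)) (at x)" for x
    by (rule Ck_Suc_derivative[OF _ Suc.prems]) auto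
  have "((\<lambda>x. f (x + h)) has_derivative frechet_derivative f (at (x + h))) (at x)" for x
    by (rule has_derivative_compose[where g = f and f = "\<lambda>x. x + h" and f' = "\<lambda>x. x"])
      (auto intro!: derivative_eq_intros d)
  then show ?case
  proof (rule Ck_SucI[OF open_UNIV])
    show "Ck k UNIV (\<lambda>x. frechet_derivative f (at (x + h)) b)" if "b \<in> Basis" for b
      using Suc.IH[of "\<lambda>x. frechet_derivative f (at x) b"] Suc.prems that by simp
  qed
qed

lemma smooth_translate: "smooth_on UNIV f \<Longrightarrow> smooth_on UNIV (\<lambda>x. f (x + h))"
  by (simp add: smooth_on_def Ck_translate)

abbreviation partial :: "('a::euclidean_space \<Rightarrow> real) \<Rightarrow> 'a \<Rightarrow> 'a \<Rightarrow> real" where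
  "partial f b x \<equiv> frechet_derivative f (at x) b"

definition grad :: "('a::euclidean_space \<Rightarrow> real) \<Rightarrow> 'a \<Rightarrow> 'a" where
  "grad f x = (\<Sum>b\<in>Basis. partial f b x *\<^sub>R b)"

lemma grad_inner: "b \<in> Basis \<Longrightarrow> grad f x \<bullet> b = partial f b x"
  by (simp add: grad_def inner_sum_left inner_Basis if_distrib sum.delta cong: if_cong)

lemma test_smooth: "test_function \<Omega> \<phi> \<Longrightarrow> smooth_on UNIV \<phi>"
  by (simp add: test_function_def)

lemma test_mono: "test_function \<Omega> \<phi> \<Longrightarrow> \<Omega> \<subseteq> \<Omega>' \<Longrightarrow> test_function \<Omega>' \<phi>"
  by (auto simp: test_function_def)

lemma test_UNIV: "test_function \<Omega> \<phi> \<Longrightarrow> test_function UNIV \<phi>"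
  by (erule test_mono) simp

lemma test_outside: "test_function \<Omega> \<phi> \<Longrightarrow> x \<notin> \<Omega> \<Longrightarrow> \<phi> x = 0"
  by (auto simp: test_function_def)

lemma test_has_derivative:
  "test_function \<Omega> \<phi> \<Longrightarrow> (\<phi> has_derivative frechet_derivative \<phi> (at x)) (at x)"
  by (rule smooth_on_has_derivative[OF open_UNIV test_smooth]) auto

lemma test_continuous: "test_function \<Omega> \<phi> \<Longrightarrow> continuous_on UNIV \<phi>"
  by (rule smooth_on_continuous_on[OF test_smooth])

lemma test_mult_left: "smooth_on UNIV f \<Longrightarrow> test_function \<Omega> \<phi> \<Longrightarrow> test_function \<Omega> (\<lambda>x. f x * \<phi> x)"
  unfolding test_function_def by (metis smooth_on_mult open_UNIV mult_zero_right)

lemma test_scale: "test_function \<Omega> \<phi> \<Longrightarrow> test_function \<Omega> (\<lambda>x. c * \<phi> x)"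
  by (rule test_mult_left) auto

lemma test_add:
  assumes "test_function \<Omega> \<phi>" "test_function \<Omega> \<psi>"
  shows "test_function \<Omega> (\<lambda>x. \<phi> x + \<psi> x)"
proof -
  obtain K L where "compact K" "K \<subseteq> \<Omega>" "\<forall>x. x \<notin> K \<longrightarrow> \<phi> x = 0"
    "compact L" "L \<subseteq> \<Omega>" "\<forall>x. x \<notin> L \<longrightarrow> \<psi> x = 0"
    using assms by (auto simp: test_function_def)
  then have "compact (K \<union> L) \<and> K \<union> L \<subseteq> \<Omega> \<and> (\<forall>x. x \<notin> K \<union> L \<longrightarrow> \<phi> x + \<psi> x = 0)"
    by (auto intro: compact_Un)
  then show ?thesis
    using assms unfolding test_function_def by (blast intro: smooth_on_add[OF open_UNIV])
qed

lemma test_minus: "test_function \<Omega> \<phi> \<Longrightarrow> test_function \<Omega> (\<lambda>x. - \<phi> x)"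
  using test_scale[of \<Omega> \<phi> "-1"] by simp

lemma test_diff: "test_function \<Omega> \<phi> \<Longrightarrow> test_function \<Omega> \<psi> \<Longrightarrow> test_function \<Omega> (\<lambda>x. \<phi> x - \<psi> x)"
  using test_add[of \<Omega> \<phi> "\<lambda>x. - \<psi> x"] test_minus[of \<Omega> \<psi>] by simp

lemma test_translate: "test_function UNIV \<phi> \<Longrightarrow> test_function UNIV (\<lambda>x. \<phi> (x + h))"
proof -
  assume \<phi>: "test_function UNIV \<phi>"
  then obtain K where K: "compact K" "\<forall>x. x \<notin> K \<longrightarrow> \<phi> x = 0"
    by (auto simp: test_function_def)
  have "compact ((\<lambda>x. x - h) ` K)"
    by (intro compact_continuous_image continuous_intros K)
  moreover have "\<phi> (x + h) = 0" if "x \<notin> (\<lambda>x. x - h) ` K" for x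
    using K(2) that by (metis add_diff_cancel imageI)
  ultimately show ?thesis
    using smooth_translate[OF test_smooth[OF \<phi>]] unfolding test_function_def by blast
qed

lemma test_partial:
  assumes "test_function \<Omega> \<phi>" "b \<in> Basis"
  shows "test_function \<Omega> (partial \<phi> b)"
proof -
  obtain K where K: "compact K" "K \<subseteq> \<Omega>" "\<And>x. x \<notin> K \<Longrightarrow> \<phi> x = 0"
    using assms by (auto simp: test_function_def)
  have "partial \<phi> b x = 0" if "x \<notin> K" for x
  proof -
    have "((\<lambda>x. 0) has_derivative (\<lambda>h. 0)) (at x)" by simp
    then have "(\<phi> has_derivative (\<lambda>h. 0)) (at x)"
      by (rule has_derivative_transform_within_open[of _ _ _ _ "- K"])
        (use K that in \<open>auto simp: open_Compl compact_imp_closed\<close>)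
    from frechet_derivative_at[OF this, symmetric] show ?thesis by simp
  qed
  then show ?thesis
    using K smooth_on_partial[OF test_smooth[OF assms(1)] assms(2)] unfolding test_function_def by blast
qed

lemma continuous_imp_meas_leb: "continuous_on UNIV f \<Longrightarrow> meas_leb f"
  by (intro measurable_completion) (simp add: borel_measurable_continuous_onI)

lemma integrable_compact_support:
  fixes f :: "'a::euclidean_space \<Rightarrow> 'b::euclidean_space"
  assumes "continuous_on UNIV f" "compact K" "\<And>x. x \<notin> K \<Longrightarrow> f x = 0"
  shows "integrable lebesgue f"
proof -
  have "integrable lborel (\<lambda>x. indicator K x *\<^sub>R f x)"
    by (rule borel_integrable_compact) (use assms continuous_on_subset in blast)+
  also have "(\<lambda>x. indicator K x *\<^sub>R f x) = f"
    using assms(3) by (auto simp: indicator_def)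
  finally show ?thesis
    using assms(1) by (subst integrable_completion) (auto intro: borel_measurable_continuous_onI)
qed

lemma integrable_test_mult:
  assumes "test_function \<Omega> \<phi>" "continuous_on UNIV f"
  shows "integrable lebesgue (\<lambda>x. \<phi> x * f x)"
proof -
  obtain K where "compact K" "\<And>x. x \<notin> K \<Longrightarrow> \<phi> x = 0"
    using assms by (auto simp: test_function_def)
  then show ?thesis
    using test_continuous[OF assms(1)] assms(2)
    by (intro integrable_compact_support[of _ K]) (auto intro: continuous_intros)
qed

lemma integrable_test: "test_function \<Omega> \<phi> \<Longrightarrow> integrable lebesgue \<phi>"
  using integrable_test_mult[of \<Omega> \<phi> "\<lambda>_. 1"] by simp

lemma test_bounded:
  assumes "test_function \<Omega> \<phi>"
  obtains B where "0 < B" "\<And>x. \<bar>\<phi> x\<bar> \<le> B"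
proof -
  obtain K where K: "compact K" "\<And>x. x \<notin> K \<Longrightarrow> \<phi> x = 0"
    using assms by (auto simp: test_function_def)
  have "compact (\<phi> ` K)"
    using K(1) test_continuous[OF assms] by (blast intro: compact_continuous_image continuous_on_subset)
  then obtain B where B: "B > 0" "\<forall>y\<in>\<phi> ` K. norm y \<le> B"
    using compact_imp_bounded bounded_pos by metis
  have "\<bar>\<phi> x\<bar> \<le> B" for x
    using B K(2)[of x] by (cases "x \<in> K") auto
  then show ?thesis using that B by blast
qed

section \<open>Integration by parts\<close>

lemma integral_translate:
  fixes f :: "'a::euclidean_space \<Rightarrow> real"
  assumes "continuous_on UNIV f"
  shows "(LINT x|lebesgue. f (x + h)) = (LINT x|lebesgue. f x)"
proof -
  have [measurable]: "f \<in> borel_measurable borel"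
    using assms by (rule borel_measurable_continuous_onI)
  have "(LINT x|lebesgue. f x) = (LINT x|lborel. f x)"
    by (rule integral_completion) simp
  also have "\<dots> = (LINT x|distr lborel borel ((+) h). f x)" by (simp only: lborel_distr_plus)
  also have "\<dots> = (LINT x|lborel. f (h + x))" by (rule integral_distr) auto
  also have "\<dots> = (LINT x|lebesgue. f (x + h))"
    by (subst integral_completion) (auto simp: add.commute)
  finally show ?thesis by simp
qed

definition diffquot :: "('a::euclidean_space \<Rightarrow> real) \<Rightarrow> 'a \<Rightarrow> nat \<Rightarrow> 'a \<Rightarrow> real" where
  "diffquot f b n x = real (Suc n) * (f (x + (1 / real (Suc n)) *\<^sub>R b) - f x)"

text \<open>Derivatives are replaced by difference quotients so that translation invariance of the
integral becomes applicable. The mean value theorem bounds the quotients, and they vanish outside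
a fixed ball, so convergence is dominated.\<close>

lemma diffquot_integral_tendsto:
  fixes f w :: "'a::euclidean_space \<Rightarrow> real"
  assumes f: "test_function UNIV f" and b: "b \<in> Basis" and w: "continuous_on UNIV w"
  shows "(\<lambda>n. LINT x|lebesgue. diffquot f b n x * w x) \<longlonglongrightarrow> (LINT x|lebesgue. partial f b x * w x)"
proof -
  have line: "((\<lambda>t. f (x + t *\<^sub>R b)) has_real_derivative partial f b (x + t *\<^sub>R b)) (at t)" for x t
  proof -
    have "((\<lambda>t. f (x + t *\<^sub>R b)) has_derivative (\<lambda>h. frechet_derivative f (at (x + t *\<^sub>R b)) (h *\<^sub>R b))) (at t)"
      by (rule has_derivative_compose[OF _ test_has_derivative[OF f]])
        (auto intro!: derivative_eq_intros)
    then show ?thesis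
      by (simp add: has_field_derivative_def linear_scale[OF has_derivative_linear[OF test_has_derivative[OF f]]]
          mult.commute[of _ "partial f b _"])
  qed
  obtain B where B: "0 < B" "\<And>x. \<bar>partial f b x\<bar> \<le> B"
    using test_bounded[OF test_partial[OF f b]] by blast
  obtain K where K: "compact K" "\<And>x. x \<notin> K \<Longrightarrow> f x = 0"
    using f by (auto simp: test_function_def)
  obtain R where R: "\<And>x. x \<in> K \<Longrightarrow> norm x \<le> R"
    using compact_imp_bounded[OF K(1)] by (auto simp: bounded_iff)
  let ?C = "cball 0 (R + 1) :: 'a set"
  have bound: "\<bar>diffquot f b n x\<bar> \<le> B * indicator ?C x" for n x
  proof -
    let ?h = "1 / real (Suc n)"
    obtain z where z: "f (x + ?h *\<^sub>R b) - f (x + 0 *\<^sub>R b) = (?h - 0) * partial f b (x + z *\<^sub>R b)"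
      using MVT2[of 0 ?h "\<lambda>t. f (x + t *\<^sub>R b)" "\<lambda>t. partial f b (x + t *\<^sub>R b)"] line by auto
    then have eq: "diffquot f b n x = partial f b (x + z *\<^sub>R b)"
      by (simp add: diffquot_def field_simps)
    show ?thesis
    proof (cases "x \<in> ?C")
      case True then show ?thesis using B eq by simp
    next
      case False
      have "x \<notin> K" using R[of x] False by auto
      moreover have "x + ?h *\<^sub>R b \<notin> K"
      proof
        assume "x + ?h *\<^sub>R b \<in> K"
        then have "norm (x + ?h *\<^sub>R b) \<le> R" by (rule R)
        moreover have "norm (?h *\<^sub>R b) \<le> 1" using b by (simp add: norm_Basis)
        moreover have "norm x \<le> norm (x + ?h *\<^sub>R b) + norm (?h *\<^sub>R b)"
          using norm_triangle_ineq4[of "x + ?h *\<^sub>R b" "?h *\<^sub>R b"] by simp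
        moreover have "\<not> norm x \<le> R + 1" using False by simp
        ultimately show False by linarith
      qed
      ultimately show ?thesis using K(2) False by (simp add: diffquot_def)
    qed
  qed
  have cd: "continuous_on UNIV (diffquot f b n)" for n
    unfolding diffquot_def[abs_def]
    by (intro continuous_intros test_continuous[OF f] continuous_on_compose2[OF test_continuous[OF f]]) auto
  show ?thesis
  proof (rule integral_dominated_convergence[where w = "\<lambda>x. B * (indicator ?C x * \<bar>w x\<bar>)"])
    show "meas_leb (\<lambda>x. partial f b x * w x)"
      by (intro continuous_imp_meas_leb continuous_intros w test_continuous[OF test_partial[OF f b]])
    show "meas_leb (\<lambda>x. diffquot f b n x * w x)" for n
      by (intro continuous_imp_meas_leb continuous_intros w cd)
    have "integrable lborel (\<lambda>x. indicator ?C x *\<^sub>R \<bar>w x\<bar>)"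
      by (rule borel_integrable_compact) (auto intro!: continuous_intros continuous_on_subset[OF w])
    moreover have "(\<lambda>x. indicator ?C x *\<^sub>R \<bar>w x\<bar>) \<in> borel_measurable lborel"
      using calculation by (rule borel_measurable_integrable)
    ultimately have "integrable lebesgue (\<lambda>x. indicator ?C x *\<^sub>R \<bar>w x\<bar>)"
      by (subst integrable_completion) auto
    then show "integrable lebesgue (\<lambda>x. B * (indicator ?C x * \<bar>w x\<bar>))" by simp
    show "AE x in lebesgue. (\<lambda>n. diffquot f b n x * w x) \<longlonglongrightarrow> partial f b x * w x"
    proof (intro AE_I2 tendsto_intros)
      fix x
      have "((\<lambda>h. (f (x + (0 + h) *\<^sub>R b) - f (x + 0 *\<^sub>R b)) / h) \<longlongrightarrow> partial f b (x + 0 *\<^sub>R b)) (at 0)"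
        using line[of x 0] by (simp add: has_field_derivative_iff)
      moreover have "filterlim (\<lambda>n. 1 / real (Suc n)) (at 0) sequentially"
        unfolding filterlim_at using LIMSEQ_Suc[OF lim_const_over_n[of 1]] by simp
      ultimately have "(\<lambda>n. (f (x + (0 + 1 / real (Suc n)) *\<^sub>R b) - f (x + 0 *\<^sub>R b)) / (1 / real (Suc n)))
          \<longlonglongrightarrow> partial f b (x + 0 *\<^sub>R b)"
        by (rule filterlim_compose)
      then show "(\<lambda>n. diffquot f b n x) \<longlonglongrightarrow> partial f b x"
        by (simp add: diffquot_def[abs_def] mult.commute)
    qed
    show "AE x in lebesgue. norm (diffquot f b n x * w x) \<le> B * (indicator ?C x * \<bar>w x\<bar>)" for n
    proof (rule AE_I2)
      fix x
      show "norm (diffquot f b n x * w x) \<le> B * (indicator ?C x * \<bar>w x\<bar>)"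
        using mult_right_mono[OF bound[of n x], of "\<bar>w x\<bar>"] by (simp add: abs_mult mult.assoc)
    qed
  qed
qed

text \<open>All difference quotients have integral \<open>0\<close>, by translation invariance; no iterated
integration is involved.\<close>

lemma integral_partial_eq_0:
  assumes f: "test_function UNIV f" and b: "b \<in> Basis"
  shows "(LINT x|lebesgue. partial f b x) = 0"
proof -
  have "(LINT x|lebesgue. diffquot f b n x * 1) = 0" for n
  proof -
    have i: "integrable lebesgue (\<lambda>x. f (x + h))" for h
      by (rule integrable_test[OF test_translate[OF f]])
    show ?thesis
      using i integrable_test[OF f] integral_translate[OF test_continuous[OF f]]
      by (simp add: diffquot_def)
  qed
  then show ?thesis
    using diffquot_integral_tendsto[OF f b, of "\<lambda>_. 1"] by (simp add: LIMSEQ_const_iff)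
qed

lemma partial_mult:
  assumes "(f has_derivative f') (at x)" "(g has_derivative g') (at x)"
  shows "partial (\<lambda>x. f x * g x) b x = f x * g' b + f' b * g x"
  by (simp add: frechet_derivative_at[OF has_derivative_mult[OF assms], symmetric])

lemma integration_by_parts:
  assumes f: "test_function UNIV f" and g: "smooth_on UNIV g" and b: "b \<in> Basis"
  shows "(LINT x|lebesgue. f x * partial g b x) = - (LINT x|lebesgue. partial f b x * g x)"
proof -
  have t: "test_function UNIV (\<lambda>x. g x * f x)" by (rule test_mult_left[OF g f])
  have "partial (\<lambda>x. g x * f x) b x = partial f b x * g x + f x * partial g b x" for x
    using partial_mult[OF smooth_on_has_derivative[OF open_UNIV g] test_has_derivative[OF f], of x b]
    by (simp add: mult.commute)
  moreover have "integrable lebesgue (\<lambda>x. partial f b x * g x)"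
    by (rule integrable_test_mult[OF test_partial[OF f b] smooth_on_continuous_on[OF g]])
  moreover have "integrable lebesgue (\<lambda>x. f x * partial g b x)"
    by (rule integrable_test_mult[OF f smooth_on_continuous_on[OF smooth_on_partial[OF g b]]])
  ultimately show ?thesis
    using integral_partial_eq_0[OF t b] by simp
qed

text \<open>Difference quotients in direction \<open>b\<close> commute with \<open>\<partial>\<^sub>c\<close> for trivial reasons. Moving them
across the integral therefore exchanges \<open>b\<close> and \<open>c\<close> without the symmetry of second derivatives.\<close>

lemma integral_partial_swap:
  assumes f: "test_function UNIV f" and g: "test_function UNIV g" and b: "b \<in> Basis" and c: "c \<in> Basis"
  shows "(LINT x|lebesgue. partial f b x * partial g c x) = (LINT x|lebesgue. partial f c x * partial g b x)"
proof -
  have "(LINT x|lebesgue. diffquot f b n x * partial g c x) =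
      - (LINT x|lebesgue. diffquot (partial f c) b n x * g x)" for n
  proof -
    let ?h = "(1 / real (Suc n)) *\<^sub>R b"
    have t: "test_function UNIV (diffquot f b n)"
      unfolding diffquot_def[abs_def] by (intro test_scale test_diff test_translate f)
    have "((diffquot f b n) has_derivative (\<lambda>y. real (Suc n) * (frechet_derivative f (at (x + ?h)) y - frechet_derivative f (at x) y))) (at x)" for x
    proof -
      have "((\<lambda>x. f (x + ?h)) has_derivative frechet_derivative f (at (x + ?h))) (at x)"
        by (rule has_derivative_compose[OF _ test_has_derivative[OF f], of "\<lambda>x. x + ?h" "\<lambda>x. x"])
          (auto intro!: derivative_eq_intros)
      then show ?thesis
        unfolding diffquot_def[abs_def]
        by (intro has_derivative_mult_right has_derivative_diff test_has_derivative[OF f])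
    qed
    from frechet_derivative_at[OF this, symmetric]
    have "partial (diffquot f b n) c x = diffquot (partial f c) b n x" for x
      by (simp add: diffquot_def)
    then show ?thesis
      using integration_by_parts[OF t test_smooth[OF g] c] by simp
  qed
  moreover have "(\<lambda>n. - (LINT x|lebesgue. diffquot (partial f c) b n x * g x)) \<longlonglongrightarrow>
      - (LINT x|lebesgue. partial (partial f c) b x * g x)"
    by (intro tendsto_minus diffquot_integral_tendsto test_partial f b c test_continuous[OF g])
  moreover have "- (LINT x|lebesgue. partial (partial f c) b x * g x) =
      (LINT x|lebesgue. partial f c x * partial g b x)"
    using integration_by_parts[OF test_partial[OF f c] test_smooth[OF g] b] by simp
  ultimately show ?thesis
    using diffquot_integral_tendsto[OF f b test_continuous[OF test_partial[OF g c]]]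
    by (simp add: LIMSEQ_unique)
qed

section \<open>The fundamental lemma of the calculus of variations\<close>

text \<open>Test functions between \<open>0\<close> and \<open>1\<close> that converge to the indicator of a box and vanish
outside it, so that integrals over boxes are limits of integrals against test functions.\<close>

definition box_bump :: "'a::euclidean_space \<Rightarrow> 'a \<Rightarrow> nat \<Rightarrow> 'a \<Rightarrow> real" where
  "box_bump a b n x = (\<Prod>i\<in>Basis. smooth_step (real n * (x \<bullet> i - a \<bullet> i)) * smooth_step (real n * (b \<bullet> i - x \<bullet> i)))"

lemma box_bump_bounds: "0 \<le> box_bump a b n x" "box_bump a b n x \<le> 1"
  unfolding box_bump_def
  by (auto intro!: prod_nonneg prod_le_1 mult_nonneg_nonneg mult_le_one smooth_step_bounds)

lemma box_bump_outside: "x \<notin> box a b \<Longrightarrow> box_bump a b n x = 0"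
proof -
  assume "x \<notin> box a b"
  then obtain i where i: "i \<in> Basis" "x \<bullet> i \<le> a \<bullet> i \<or> b \<bullet> i \<le> x \<bullet> i"
    by (auto simp: mem_box not_less)
  then have "smooth_step (real n * (x \<bullet> i - a \<bullet> i)) * smooth_step (real n * (b \<bullet> i - x \<bullet> i)) = 0"
    by (auto simp: mult_nonneg_nonpos)
  then show ?thesis using i by (auto simp: box_bump_def prod_zero_iff)
qed

lemma box_bump_tendsto: "(\<lambda>n. box_bump a b n x) \<longlonglongrightarrow> indicator (box a b) x"
proof (cases "x \<in> box a b")
  case True
  have step: "(\<lambda>n. smooth_step (real n * t)) \<longlonglongrightarrow> 1" if "t > 0" for t :: real
  proof -
    obtain N where N: "1 / t < real N" using reals_Archimedean2 by blast
    have "smooth_step (real n * t) = 1" if "n \<ge> N" for n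
    proof -
      have "1 / t < real n" using N that by linarith
      then show ?thesis using \<open>t > 0\<close> by (intro smooth_step_values) (simp add: field_simps)
    qed
    then show ?thesis
      by (intro tendsto_eventually) (auto simp: eventually_sequentially)
  qed
  have "(\<lambda>n. box_bump a b n x) \<longlonglongrightarrow> (\<Prod>i\<in>(Basis::'a set). 1 * 1)"
    unfolding box_bump_def using True
    by (intro tendsto_prod tendsto_mult step) (auto simp: mem_box)
  then show ?thesis using True by simp
qed (simp add: box_bump_outside)

lemma smooth_on_affine_inner: "smooth_on UNIV (\<lambda>x. c * (x \<bullet> i) + d)"
  by (rule smooth_on_add)
    (auto intro!: smooth_on_linear bounded_linear_const_mult bounded_linear_inner_left)

lemma test_box_bump:
  assumes "cbox a b \<subseteq> \<Omega>"
  shows "test_function \<Omega> (box_bump a b n)"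
  unfolding test_function_def
proof (intro conjI exI[of _ "cbox a b"])
  have aff: "smooth_on UNIV (\<lambda>x::'a. smooth_step (c * (x \<bullet> i) + d))" for c d i
    by (rule smooth_on_compose[OF open_UNIV open_UNIV smooth_on_affine_inner smooth_step_smooth]) simp
  have 1: "smooth_on UNIV (\<lambda>x. smooth_step (real n * (x \<bullet> i - a \<bullet> i)))" for i :: 'a
    using aff[of "real n" i "- (real n * (a \<bullet> i))"] by (simp add: right_diff_distrib)
  have 2: "smooth_on UNIV (\<lambda>x. smooth_step (real n * (b \<bullet> i - x \<bullet> i)))" for i :: 'a
    using aff[of "- real n" i "real n * (b \<bullet> i)"] by (simp add: right_diff_distrib)
  show "smooth_on UNIV (box_bump a b n)"
    unfolding box_bump_def[abs_def] by (intro smooth_on_prod smooth_on_mult 1 2) auto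
  show "\<forall>x. x \<notin> cbox a b \<longrightarrow> box_bump a b n x = 0"
    using box_bump_outside box_subset_cbox by (metis subsetD)
qed (use assms in auto)

text \<open>The sets over which \<open>f\<close> integrates to \<open>0\<close> are closed under countable disjoint unions and,
since the total integral is \<open>0\<close>, under complements. Boxes form an intersection-stable generator,
so every Borel set has this property.\<close>

lemma AE_zero_of_box_integrals:
  fixes f :: "'a::euclidean_space \<Rightarrow> real"
  assumes f: "integrable lebesgue f"
    and box: "\<And>a b. (LINT x:box a b|lebesgue. f x) = 0" and tot: "(LINT x|lebesgue. f x) = 0"
  shows "AE x in lebesgue. f x = 0"
proof -
  have mf: "meas_leb f" using f by (rule borel_measurable_integrable)
  obtain g where g [measurable]: "g \<in> borel_measurable lborel" and fg: "AE x in lborel. f x = g x"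
    using completion_ex_borel_measurable_real[OF mf] by blast
  have fg': "AE x in lebesgue. f x = g x" using fg by (rule AE_completion)
  have gl: "meas_leb g" using g by (rule measurable_completion)
  have ig: "integrable lborel g"
    using integrable_cong_AE[OF mf gl fg'] f integrable_completion[OF g] by simp
  have gf: "(LINT x:A|lborel. g x) = (LINT x:A|lebesgue. f x)" if A: "A \<in> sets lborel" for A
  proof -
    have [measurable]: "A \<in> sets lebesgue" using A by simp
    note [measurable] = mf gl
    have "(LINT x:A|lborel. g x) = (LINT x:A|lebesgue. g x)"
      unfolding set_lebesgue_integral_def using A by (intro integral_completion[symmetric]) simp
    also have "\<dots> = (LINT x:A|lebesgue. f x)"
      unfolding set_lebesgue_integral_def
      by (rule integral_cong_AE) (use fg' in \<open>auto elim!: eventually_mono\<close>)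
    finally show ?thesis .
  qed
  have si: "set_integrable lborel A g" if "A \<in> sets lborel" for A
    unfolding set_integrable_def using ig that by (rule integrable_mult_indicator[rotated])
  have "(LINT x:A|lborel. g x) = 0" if "A \<in> sets lborel" for A
  proof -
    let ?G = "range (\<lambda>(a, b). box a b :: 'a set)"
    have sets: "sigma_sets UNIV ?G = sets lborel"
      by (simp add: borel_eq_box)
    have "Int_stable ?G" by (auto simp: Int_stable_def box_Int_box)
    moreover have "?G \<subseteq> Pow UNIV" by simp
    moreover have "A \<in> sigma_sets UNIV ?G" using that sets by simp
    ultimately show ?thesis
    proof (induction rule: sigma_sets_induct_disjoint)
      case (basic A)
      then obtain a b where "A = box a b" by auto
      then show ?case using gf[of A] box by simp
    next
      case empty
      show ?case by (simp add: set_lebesgue_integral_def)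
    next
      case (compl A)
      then have A: "A \<in> sets lborel" using sets by simp
      have "(LINT x:UNIV|lborel. g x) = (LINT x:A \<union> (UNIV - A)|lborel. g x)" by simp
      also have "\<dots> = (LINT x:A|lborel. g x) + (LINT x:UNIV - A|lborel. g x)"
        by (intro set_integral_Un si) (use A in auto)
      finally show ?case using compl gf[of UNIV] tot by (simp add: set_lebesgue_integral_def)
    next
      case (union A)
      then have A: "\<And>i. A i \<in> sets lborel" using sets by auto
      have "(LINT x:(\<Union>i. A i)|lborel. g x) = (\<Sum>i. LINT x:A i|lborel. g x)"
        by (rule lebesgue_integral_countable_add)
          (use A union(1) si in \<open>auto simp: disjoint_family_on_def\<close>)
      then show ?case using union by simp
    qed
  qed
  then have "AE x in lborel. g x = 0"
    by (intro density_unique_real ig) (simp_all add: set_lebesgue_integral_def)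
  then have "AE x in lborel. f x = 0" using fg by eventually_elim simp
  then show ?thesis by (rule AE_completion)
qed

text \<open>Testing with bumps that converge to the indicator of a box gives zero integrals over all
boxes with closure in \<open>\<Omega>\<close>. Inside one such box \<open>f\<close> vanishes almost everywhere, and countably many
of them cover \<open>\<Omega>\<close>.\<close>

theorem fundamental_lemma:
  fixes f :: "'a::euclidean_space \<Rightarrow> real"
  assumes "open \<Omega>" and loc: "\<And>a b. cbox a b \<subseteq> \<Omega> \<Longrightarrow> set_integrable lebesgue (cbox a b) f"
    and zero: "\<And>\<phi>. test_function \<Omega> \<phi> \<Longrightarrow> (LINT x|lebesgue. f x * \<phi> x) = 0"
  shows "AE x in lebesgue. x \<in> \<Omega> \<longrightarrow> f x = 0"
proof -
  have sub: "cbox c d \<subseteq> \<Omega> \<Longrightarrow> (LINT x:box c d|lebesgue. f x) = 0" for c d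
  proof -
    assume cd: "cbox c d \<subseteq> \<Omega>"
    have i: "integrable lebesgue (\<lambda>x. indicator (cbox c d) x * f x)"
      using loc[OF cd] by (simp add: set_integrable_def)
    note m = borel_measurable_integrable[OF i]
    have eq: "f x * box_bump c d n x = (indicator (cbox c d) x * f x) * box_bump c d n x" for x n
      using box_bump_outside[of x c d n] box_subset_cbox[of c d] by (auto simp: indicator_def)
    have eq': "indicator (box c d) x * f x = (indicator (cbox c d) x * f x) * indicator (box c d) x" for x
      using box_subset_cbox[of c d] by (auto simp: indicator_def)
    have "(\<lambda>n. LINT x|lebesgue. f x * box_bump c d n x) \<longlonglongrightarrow> (LINT x|lebesgue. indicator (box c d) x * f x)"
    proof (rule integral_dominated_convergence[where w = "\<lambda>x. \<bar>indicator (cbox c d) x * f x\<bar>"])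
      show "meas_leb (\<lambda>x. indicator (box c d) x * f x)"
        unfolding eq' by (rule borel_measurable_times[OF m]) (rule borel_measurable_indicator, simp)
      show "meas_leb (\<lambda>x. f x * box_bump c d n x)" for n
        unfolding eq
        by (rule borel_measurable_times[OF m
              continuous_imp_meas_leb[OF test_continuous[OF test_box_bump[OF cd]]]])
      show "integrable lebesgue (\<lambda>x. \<bar>indicator (cbox c d) x * f x\<bar>)" using i by simp
      show "AE x in lebesgue. (\<lambda>n. f x * box_bump c d n x) \<longlonglongrightarrow> indicator (box c d) x * f x"
        by (intro AE_I2) (subst mult.commute, intro tendsto_intros box_bump_tendsto)
      show "AE x in lebesgue. norm (f x * box_bump c d n x) \<le> \<bar>indicator (cbox c d) x * f x\<bar>" for n
        unfolding eq using box_bump_bounds[of c d n]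
        by (intro AE_I2) (simp add: abs_mult mult_left_le)
    qed
    moreover have "(LINT x|lebesgue. f x * box_bump c d n x) = 0" for n
      by (rule zero[OF test_box_bump[OF cd]])
    ultimately show ?thesis
      by (simp add: set_lebesgue_integral_def LIMSEQ_const_iff)
  qed
  have inbox: "AE x in lebesgue. x \<in> cbox a b \<longrightarrow> f x = 0" if ab: "cbox a b \<subseteq> \<Omega>" for a b
  proof -
    have i: "integrable lebesgue (\<lambda>x. indicator (cbox a b) x * f x)"
      using loc[OF ab] by (simp add: set_integrable_def)
    have i': "integrable lebesgue (\<lambda>x. indicator (box a b) x * f x)"
    proof -
      have "(\<lambda>x. indicator (box a b) x * f x) = (\<lambda>x. indicator (box a b) x *\<^sub>R (indicator (cbox a b) x * f x))"
        using box_subset_cbox[of a b] by (auto simp: indicator_def fun_eq_iff)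
      then show ?thesis using integrable_mult_indicator[OF _ i, of "box a b"] by simp
    qed
    have "AE x in lebesgue. indicator (box a b) x * f x = 0"
    proof (rule AE_zero_of_box_integrals[OF i'])
      show "(LINT x|lebesgue. indicator (box a b) x * f x) = 0"
        using sub[OF ab] by (simp add: set_lebesgue_integral_def)
      fix c d
      obtain p q where pq: "box a b \<inter> box c d = box p q"
        using box_Int_box[of a b c d] by blast
      show "(LINT x:box c d|lebesgue. indicator (box a b) x * f x) = 0"
      proof (cases "box p q = {}")
        case True
        then have "(\<lambda>x. indicator (box c d) x * (indicator (box a b) x * f x)) = (\<lambda>x. 0)"
          using pq by (auto simp: indicator_def fun_eq_iff)
        then show ?thesis by (simp add: set_lebesgue_integral_def)
      next
        case False
        then have "cbox p q = closure (box p q)" by (simp add: closure_box)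
        also have "\<dots> \<subseteq> closure (box a b)" using pq by (intro closure_mono) auto
        also have "\<dots> \<subseteq> cbox a b" by (intro closure_minimal) (auto simp: box_subset_cbox)
        finally have "cbox p q \<subseteq> \<Omega>" using ab by blast
        then have "(LINT x:box p q|lebesgue. f x) = 0" by (rule sub)
        moreover have "(\<lambda>x. indicator (box c d) x * (indicator (box a b) x * f x)) =
            (\<lambda>x. indicator (box p q) x * f x)"
          unfolding pq[symmetric] by (simp add: indicator_inter_arith mult.left_commute fun_eq_iff)
        ultimately show ?thesis by (simp add: set_lebesgue_integral_def)
      qed
    qed
    moreover have "AE x in lebesgue. x \<notin> cbox a b - box a b"
      by (intro AE_completion AE_not_in null_sets_cbox_Diff_box)
    ultimately show ?thesis by eventually_elim (auto simp: indicator_def)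
  qed
  obtain \<D> where D: "countable \<D>" "\<D> \<subseteq> Pow \<Omega>" "\<And>X. X \<in> \<D> \<Longrightarrow> \<exists>a b. X = cbox a b" "\<Union>\<D> = \<Omega>"
    using open_countable_Union_open_cbox[OF \<open>open \<Omega>\<close>] by blast
  have "AE x in lebesgue. \<forall>X\<in>\<D>. x \<in> X \<longrightarrow> f x = 0"
  proof (subst AE_ball_countable[OF D(1)], intro ballI)
    fix X assume "X \<in> \<D>"
    then obtain a b where "X = cbox a b" "cbox a b \<subseteq> \<Omega>" using D by blast
    then show "AE x in lebesgue. x \<in> X \<longrightarrow> f x = 0" using inbox by simp
  qed
  then show ?thesis by eventually_elim (use D in auto)
qed


section \<open>Sobolev spaces on a bounded open set\<close>

lemma abs_aefun_add:
  "meas_leb f \<Longrightarrow> meas_leb g \<Longrightarrow> abs_aefun f + abs_aefun g = abs_aefun (\<lambda>x. f x + g x)"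
  by (simp add: plus_aefun.abs_eq ae_eq_refl_iff)

lemma abs_aefun_scale: "meas_leb f \<Longrightarrow> c *\<^sub>R abs_aefun f = abs_aefun (\<lambda>x. c *\<^sub>R f x)"
  by (simp add: scaleR_aefun.abs_eq ae_eq_refl_iff)

lemma continuous_on_grad:
  assumes "test_function \<Omega> \<phi>" shows "continuous_on UNIV (grad \<phi>)"
  unfolding grad_def[abs_def]
  by (intro continuous_intros test_continuous[OF test_partial[OF assms]])

lemma test_meas: "test_function \<Omega> \<phi> \<Longrightarrow> meas_leb \<phi>"
  by (intro continuous_imp_meas_leb test_continuous)

lemma grad_meas: "test_function \<Omega> \<phi> \<Longrightarrow> meas_leb (grad \<phi>)"
  by (intro continuous_imp_meas_leb continuous_on_grad)

lemma grad_outside: "test_function \<Omega> \<phi> \<Longrightarrow> x \<notin> \<Omega> \<Longrightarrow> grad \<phi> x = 0"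
  by (simp add: grad_def test_outside[OF test_partial])

lemma integrable_norm_grad_sq:
  assumes "test_function \<Omega> \<phi>"
  shows "integrable lebesgue (\<lambda>x. (norm (grad \<phi> x))\<^sup>2)"
proof -
  have "(norm (grad \<phi> x))\<^sup>2 = (\<Sum>b\<in>Basis. partial \<phi> b x * partial \<phi> b x)" for x
    by (subst power2_norm_eq_inner, subst euclidean_inner) (simp add: grad_inner)
  then show ?thesis
    using assms by (auto intro!: Bochner_Integration.integrable_sum integrable_test_mult test_partial
      test_continuous[OF test_partial])
qed

lemma set_integral_eq_integral:
  fixes f :: "'a::euclidean_space \<Rightarrow> real"
  assumes "\<And>x. x \<notin> S \<Longrightarrow> f x = 0"
  shows "(LINT x:S|lebesgue. f x) = (LINT x|lebesgue. f x)"
  unfolding set_lebesgue_integral_def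
  by (rule Bochner_Integration.integral_cong) (use assms in \<open>auto simp: indicator_def\<close>)

locale bounded_domain =
  fixes \<Omega> :: "'a::euclidean_space set"
  assumes open_domain: "open \<Omega>" and bounded_domain: "bounded \<Omega>"
begin

lemma sets_domain [measurable, simp]: "\<Omega> \<in> sets lebesgue"
  using open_domain by simp

sublocale l2: hilbert_on "L2 \<Omega> :: ('a, real) aefun set" "L2_form \<Omega>"
  by (rule hilbert_L2) simp

sublocale l2v: hilbert_on "L2 \<Omega> :: ('a, 'a) aefun set" "L2_form \<Omega>"
  by (rule hilbert_L2) simp

lemma continuous_in_L2:
  fixes f :: "'a \<Rightarrow> 'b::euclidean_space"
  assumes "continuous_on UNIV f" "compact K" "K \<subseteq> \<Omega>" "\<And>x. x \<notin> K \<Longrightarrow> f x = 0"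
  shows "abs_aefun f \<in> L2 \<Omega>"
proof (rule L2_abs)
  show "integrable lebesgue (\<lambda>x. (norm (f x))\<^sup>2)"
    by (rule integrable_compact_support[of _ K])
      (use assms in \<open>auto intro!: continuous_intros\<close>)
qed (use assms in \<open>auto intro: continuous_imp_meas_leb\<close>)

lemma test_in_L2: "test_function \<Omega> \<phi> \<Longrightarrow> abs_aefun \<phi> \<in> L2 \<Omega>"
  using test_continuous[of \<Omega> \<phi>] continuous_in_L2[of \<phi>] by (auto simp: test_function_def)

lemma test_vector_in_L2:
  assumes "test_function \<Omega> \<phi>"
  shows "abs_aefun (\<lambda>x. \<phi> x *\<^sub>R b) \<in> L2 \<Omega>"
proof -
  obtain K where "compact K" "K \<subseteq> \<Omega>" "\<And>x. x \<notin> K \<Longrightarrow> \<phi> x = 0"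
    using assms by (auto simp: test_function_def)
  then show ?thesis
    by (intro continuous_in_L2[of _ K] continuous_intros test_continuous[OF assms]) auto
qed

lemma grad_in_L2: "test_function \<Omega> \<phi> \<Longrightarrow> abs_aefun (grad \<phi>) \<in> L2 \<Omega>"
  by (intro L2_abs integrable_norm_grad_sq) (auto intro: grad_meas grad_outside)

text \<open>As an identity between L2 pairings, the defining condition is visibly linear in \<open>(u, g)\<close>
and stable under L2 limits of both.\<close>

lemma is_weak_gradient_iff:
  "is_weak_gradient \<Omega> u g \<longleftrightarrow> (\<forall>\<phi>. test_function \<Omega> \<phi> \<longrightarrow> (\<forall>b\<in>Basis.
    L2_form \<Omega> u (abs_aefun (partial \<phi> b)) = - L2_form \<Omega> g (abs_aefun (\<lambda>x. \<phi> x *\<^sub>R b))))"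
proof -
  have 1: "L2_form \<Omega> u (abs_aefun (partial \<phi> b)) = (LINT x:\<Omega>|lebesgue. rep_aefun u x * partial \<phi> b x)"
    if "test_function \<Omega> \<phi>" "b \<in> Basis" for \<phi> b
    using L2_form_abs[of \<Omega> "rep_aefun u" "partial \<phi> b"] test_meas[OF test_partial[OF that]] by simp
  have 2: "L2_form \<Omega> g (abs_aefun (\<lambda>x. \<phi> x *\<^sub>R b)) = (LINT x:\<Omega>|lebesgue. (rep_aefun g x \<bullet> b) * \<phi> x)"
    if "test_function \<Omega> \<phi>" for \<phi> b
  proof -
    note [measurable] = test_meas[OF that]
    have "L2_form \<Omega> (abs_aefun (rep_aefun g)) (abs_aefun (\<lambda>x. \<phi> x *\<^sub>R b)) =
        (LINT x:\<Omega>|lebesgue. rep_aefun g x \<bullet> (\<phi> x *\<^sub>R b))"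
      by (rule L2_form_abs) auto
    then show ?thesis by (simp add: mult.commute)
  qed
  show ?thesis
    unfolding is_weak_gradient_def using 1 2 by (auto simp: eq_commute)
qed

text \<open>The difference of two weak gradients is orthogonal to all test functions, so the
fundamental lemma applies to each of its components. This is what gives the definite description
in \<^const>\<open>weak_gradient\<close> a meaning.\<close>

lemma weak_gradient_unique:
  assumes g: "g \<in> L2 \<Omega>" "is_weak_gradient \<Omega> u g" and h: "h \<in> L2 \<Omega>" "is_weak_gradient \<Omega> u h"
  shows "g = h"
proof -
  define d where "d = g - h"
  have d: "d \<in> L2 \<Omega>" using g h by (simp add: d_def)
  have b0: "AE x in lebesgue. x \<in> \<Omega> \<longrightarrow> rep_aefun d x \<bullet> b = 0" if b: "b \<in> Basis" for b
  proof (rule fundamental_lemma[OF open_domain])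
    fix p q :: 'a
    have "integrable lebesgue (\<lambda>x. indicat_real (cbox p q) x + (norm (rep_aefun d x))\<^sup>2)"
      using d by (intro Bochner_Integration.integrable_add)
        (use emeasure_lborel_cbox_finite[of p q] in \<open>auto simp: L2_iff integrable_indicator_iff\<close>)
    then show "set_integrable lebesgue (cbox p q) (\<lambda>x. rep_aefun d x \<bullet> b)"
      unfolding set_integrable_def
    proof (rule Bochner_Integration.integrable_bound)
      have "\<bar>rep_aefun d x \<bullet> b\<bar> \<le> 1 + (norm (rep_aefun d x))\<^sup>2" for x
        using abs_inner_le_sq[of "rep_aefun d x" b] b by simp
      then show "AE x in lebesgue. norm (indicat_real (cbox p q) x *\<^sub>R (rep_aefun d x \<bullet> b))
          \<le> norm (indicat_real (cbox p q) x + (norm (rep_aefun d x))\<^sup>2)"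
        by (intro AE_I2) (auto simp: indicator_def)
      show "meas_leb (\<lambda>x. indicat_real (cbox p q) x *\<^sub>R (rep_aefun d x \<bullet> b))"
        by (intro borel_measurable_scaleR borel_measurable_indicator borel_measurable_inner) auto
    qed
  next
    fix \<phi> assume \<phi>: "test_function \<Omega> \<phi>"
    note [measurable] = test_meas[OF \<phi>]
    have "L2_form \<Omega> d (abs_aefun (\<lambda>x. \<phi> x *\<^sub>R b)) = 0"
      using g h \<phi> b test_vector_in_L2[OF \<phi>, of b] unfolding d_def is_weak_gradient_iff
      by (simp add: l2v.diff_left)
    also have "L2_form \<Omega> d (abs_aefun (\<lambda>x. \<phi> x *\<^sub>R b)) =
        (LINT x:\<Omega>|lebesgue. rep_aefun d x \<bullet> (\<phi> x *\<^sub>R b))"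
      using L2_form_abs[of \<Omega> "rep_aefun d" "\<lambda>x. \<phi> x *\<^sub>R b"] by simp
    also have "\<dots> = (LINT x|lebesgue. (rep_aefun d x \<bullet> b) * \<phi> x)"
      by (subst set_integral_eq_integral) (simp_all add: test_outside[OF \<phi>] mult.commute)
    finally show "(LINT x|lebesgue. (rep_aefun d x \<bullet> b) * \<phi> x) = 0" .
  qed
  have "AE x in lebesgue. \<forall>b\<in>Basis. x \<in> \<Omega> \<longrightarrow> rep_aefun d x \<bullet> b = 0"
    using b0 by (subst AE_ball_countable) (auto simp: countable_finite)
  moreover have "AE x in lebesgue. x \<notin> \<Omega> \<longrightarrow> rep_aefun d x = 0" using d by (simp add: L2_iff)
  ultimately have "AE x in lebesgue. rep_aefun d x = rep_aefun 0 x"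
    using rep_zero[where 'a = 'a and 'b = 'a]
  proof eventually_elim
    case (elim x)
    have "rep_aefun d x = 0" if "x \<in> \<Omega>"
      by (rule euclidean_eqI) (use elim(1) that in simp)
    then show ?case using elim by (cases "x \<in> \<Omega>") simp_all
  qed
  then have "d = 0" by (simp add: aefun_eq_iff)
  then show ?thesis by (simp add: d_def)
qed

lemma weak_gradient_eqI: "g \<in> L2 \<Omega> \<Longrightarrow> is_weak_gradient \<Omega> u g \<Longrightarrow> weak_gradient \<Omega> u = g"
  unfolding weak_gradient_def by (rule the_equality) (auto intro: weak_gradient_unique)

lemma H1_gradient:
  assumes "u \<in> H1 \<Omega>"
  shows "weak_gradient \<Omega> u \<in> L2 \<Omega>" "is_weak_gradient \<Omega> u (weak_gradient \<Omega> u)"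
  using assms weak_gradient_eqI[of _ u] by (auto simp: H1_def)

lemma H1_L2: "u \<in> H1 \<Omega> \<Longrightarrow> u \<in> L2 \<Omega>"
  by (simp add: H1_def)

lemma H1I: "u \<in> L2 \<Omega> \<Longrightarrow> g \<in> L2 \<Omega> \<Longrightarrow> is_weak_gradient \<Omega> u g \<Longrightarrow> u \<in> H1 \<Omega>"
  by (auto simp: H1_def)

lemma is_weak_gradient_add:
  assumes "u \<in> L2 \<Omega>" "v \<in> L2 \<Omega>" "g \<in> L2 \<Omega>" "h \<in> L2 \<Omega>" "is_weak_gradient \<Omega> u g" "is_weak_gradient \<Omega> v h"
  shows "is_weak_gradient \<Omega> (u + v) (g + h)"
  using assms unfolding is_weak_gradient_iff
  by (simp add: l2.add_left l2v.add_left test_in_L2 test_partial test_vector_in_L2)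

lemma is_weak_gradient_scale:
  assumes "u \<in> L2 \<Omega>" "g \<in> L2 \<Omega>" "is_weak_gradient \<Omega> u g"
  shows "is_weak_gradient \<Omega> (c *\<^sub>R u) (c *\<^sub>R g)"
  using assms unfolding is_weak_gradient_iff
  by (simp add: l2.scale_left l2v.scale_left test_in_L2 test_partial test_vector_in_L2)

lemma weak_gradient_add:
  "u \<in> H1 \<Omega> \<Longrightarrow> v \<in> H1 \<Omega> \<Longrightarrow> weak_gradient \<Omega> (u + v) = weak_gradient \<Omega> u + weak_gradient \<Omega> v"
  by (intro weak_gradient_eqI is_weak_gradient_add l2v.mem H1_gradient H1_L2)

lemma weak_gradient_scale:
  "u \<in> H1 \<Omega> \<Longrightarrow> weak_gradient \<Omega> (c *\<^sub>R u) = c *\<^sub>R weak_gradient \<Omega> u"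
  by (intro weak_gradient_eqI is_weak_gradient_scale l2v.mem H1_gradient H1_L2)

lemma subspace_H1: "subspace (H1 \<Omega>)"
proof (rule subspaceI)
  show add: "u + v \<in> H1 \<Omega>" if "u \<in> H1 \<Omega>" "v \<in> H1 \<Omega>" for u v
  proof -
    note u = H1_L2[OF that(1)] H1_gradient[OF that(1)] and v = H1_L2[OF that(2)] H1_gradient[OF that(2)]
    show ?thesis
      by (rule H1I[OF l2.mem(2)[OF u(1) v(1)] l2v.mem(2)[OF u(2) v(2)]
            is_weak_gradient_add[OF u(1) v(1) u(2) v(2) u(3) v(3)]])
  qed
  show "c *\<^sub>R u \<in> H1 \<Omega>" if "u \<in> H1 \<Omega>" for c u
  proof -
    note u = H1_L2[OF that] H1_gradient[OF that]
    show ?thesis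
      by (rule H1I[OF l2.mem(4)[OF u(1)] l2v.mem(4)[OF u(2)] is_weak_gradient_scale[OF u]])
  qed
  have "is_weak_gradient \<Omega> (0::('a, real) aefun) (0::('a, 'a) aefun)"
    unfolding is_weak_gradient_iff
    by (auto simp: l2.zero_left l2v.zero_left test_in_L2 test_partial test_vector_in_L2)
  then show "0 \<in> H1 \<Omega>" by (intro H1I[of _ 0]) auto
qed

lemma gradient_form_L2: "gradient_form \<Omega> S u v = L2_form S (weak_gradient \<Omega> u) (weak_gradient \<Omega> v)"
  by (simp add: gradient_form_def L2_form_def)

lemma semi_inner_gradient:
  assumes "S \<in> sets lebesgue"
  shows "semi_inner (H1 \<Omega>) (gradient_form \<Omega> S)"
proof -
  interpret s: semi_inner "L2 \<Omega> :: ('a, 'a) aefun set" "L2_form S"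
    by (rule semi_inner_L2) (use assms in auto)
  show ?thesis
  proof
    show "gradient_form \<Omega> S u v = gradient_form \<Omega> S v u" if "u \<in> H1 \<Omega>" "v \<in> H1 \<Omega>" for u v
      unfolding gradient_form_L2 by (rule s.sym) (use that H1_gradient in auto)
  qed (auto simp: subspace_H1 gradient_form_L2 weak_gradient_add weak_gradient_scale
         H1_gradient s.add_left s.scale_left s.nonneg)
qed

sublocale g: semi_inner "H1 \<Omega>" "gradient_form \<Omega> \<Omega>"
  by (rule semi_inner_gradient) simp

text \<open>The H1 norm comes from this form, so the triangle inequality for it needs no separate
proof.\<close>

definition h1_form :: "('a, real) aefun \<Rightarrow> ('a, real) aefun \<Rightarrow> real" where
  "h1_form u v = L2_form \<Omega> u v + gradient_form \<Omega> \<Omega> u v"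

sublocale h1: semi_inner "H1 \<Omega>" h1_form
proof
  show "h1_form u v = h1_form v u" if "u \<in> H1 \<Omega>" "v \<in> H1 \<Omega>" for u v
    using that unfolding h1_form_def by (intro arg_cong2[where f = "(+)"] l2.sym g.sym H1_L2)
qed (auto simp: h1_form_def subspace_H1 H1_L2 l2.add_left l2.scale_left g.add_left g.scale_left
      l2.nonneg g.nonneg algebra_simps)

lemma H1_norm_eq: "H1_norm \<Omega> u = h1.nrm u"
  by (simp add: H1_norm_def h1.nrm_def h1_form_def L2_form_def power2_eq_square)

lemma l2_le_h1: "u \<in> H1 \<Omega> \<Longrightarrow> l2.nrm u \<le> h1.nrm u"
  by (simp add: l2.nrm_def h1.nrm_def h1_form_def g.nonneg)

lemma g_le_h1: "u \<in> H1 \<Omega> \<Longrightarrow> g.nrm u \<le> h1.nrm u"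
  by (simp add: g.nrm_def h1.nrm_def h1_form_def l2.nonneg H1_L2)

lemma test_weak_gradient:
  assumes \<phi>: "test_function \<Omega> \<phi>"
  shows "is_weak_gradient \<Omega> (abs_aefun \<phi>) (abs_aefun (grad \<phi>))"
  unfolding is_weak_gradient_iff
proof (intro allI impI ballI)
  fix \<eta> and b :: 'a assume \<eta>: "test_function \<Omega> \<eta>" and b: "b \<in> Basis"
  note [measurable] = test_meas[OF \<phi>] test_meas[OF \<eta>] grad_meas[OF \<phi>] test_meas[OF test_partial[OF \<eta> b]]
  have "L2_form \<Omega> (abs_aefun \<phi>) (abs_aefun (partial \<eta> b)) = (LINT x:\<Omega>|lebesgue. \<phi> x \<bullet> partial \<eta> b x)"
    by (rule L2_form_abs) auto
  also have "\<dots> = (LINT x|lebesgue. \<phi> x * partial \<eta> b x)"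
    by (subst set_integral_eq_integral) (simp_all add: test_outside[OF \<phi>] mult.commute)
  also have "\<dots> = - (LINT x|lebesgue. partial \<phi> b x * \<eta> x)"
    by (rule integration_by_parts[OF test_UNIV[OF \<phi>] test_smooth[OF \<eta>] b])
  also have "(LINT x|lebesgue. partial \<phi> b x * \<eta> x) = (LINT x:\<Omega>|lebesgue. grad \<phi> x \<bullet> (\<eta> x *\<^sub>R b))"
    unfolding set_lebesgue_integral_def
    by (rule Bochner_Integration.integral_cong)
      (use test_outside[OF \<eta>] b in \<open>auto simp: indicator_def grad_inner mult.commute\<close>)
  also have "\<dots> = L2_form \<Omega> (abs_aefun (grad \<phi>)) (abs_aefun (\<lambda>x. \<eta> x *\<^sub>R b))"
    by (rule L2_form_abs[symmetric]) auto
  finally show "L2_form \<Omega> (abs_aefun \<phi>) (abs_aefun (partial \<eta> b)) =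
      - L2_form \<Omega> (abs_aefun (grad \<phi>)) (abs_aefun (\<lambda>x. \<eta> x *\<^sub>R b))" .
qed

lemma weak_gradient_test: "test_function \<Omega> \<phi> \<Longrightarrow> weak_gradient \<Omega> (abs_aefun \<phi>) = abs_aefun (grad \<phi>)"
  by (intro weak_gradient_eqI grad_in_L2 test_weak_gradient)

lemma test_in_H1: "test_function \<Omega> \<phi> \<Longrightarrow> abs_aefun \<phi> \<in> H1 \<Omega>"
  by (rule H1I[OF test_in_L2 grad_in_L2 test_weak_gradient])

lemma H10_iff: "u \<in> H10 \<Omega> \<longleftrightarrow> u \<in> H1 \<Omega> \<and>
    (\<forall>\<epsilon>>0. \<exists>\<phi>. test_function \<Omega> \<phi> \<and> h1.nrm (u - abs_aefun \<phi>) < \<epsilon>)"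
  by (simp add: H10_def H1_norm_eq)

lemma H10_H1: "u \<in> H10 \<Omega> \<Longrightarrow> u \<in> H1 \<Omega>"
  by (simp add: H10_iff)

lemma test_in_H10: "test_function \<Omega> \<phi> \<Longrightarrow> abs_aefun \<phi> \<in> H10 \<Omega>"
  unfolding H10_iff
proof (intro conjI allI impI exI[of _ \<phi>])
  have "h1.nrm 0 = 0" using h1.nrm_scale[of 0 0] by simp
  then show "h1.nrm (abs_aefun \<phi> - abs_aefun \<phi>) < \<epsilon>" if "0 < \<epsilon>" for \<epsilon> using that by simp
qed (auto intro: test_in_H1)

lemma zero_test: "test_function \<Omega> (\<lambda>_. 0)"
  by (auto simp: test_function_def intro!: exI[of _ "{}"])

text \<open>\<^const>\<open>H10\<close> is a closure, and closures are closed. Linearity of the space and its completeness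
are both read off from this.\<close>

lemma H10_closed:
  assumes u: "u \<in> H1 \<Omega>" and "\<And>\<epsilon>. 0 < \<epsilon> \<Longrightarrow> \<exists>v\<in>H10 \<Omega>. h1.nrm (u - v) < \<epsilon>"
  shows "u \<in> H10 \<Omega>"
  unfolding H10_iff
proof (intro conjI allI impI u)
  fix \<epsilon> :: real assume "0 < \<epsilon>"
  then obtain v where v: "v \<in> H10 \<Omega>" "h1.nrm (u - v) < \<epsilon> / 2" using assms(2)[of "\<epsilon> / 2"] by auto
  then obtain \<phi> where \<phi>: "test_function \<Omega> \<phi>" "h1.nrm (v - abs_aefun \<phi>) < \<epsilon> / 2"
    using \<open>0 < \<epsilon>\<close> unfolding H10_iff by (meson half_gt_zero)
  have "h1.nrm (u - abs_aefun \<phi>) < \<epsilon>"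
    using h1.nrm_triangle_diff[OF u H10_H1[OF v(1)] test_in_H1[OF \<phi>(1)]] v \<phi> by linarith
  then show "\<exists>\<phi>. test_function \<Omega> \<phi> \<and> h1.nrm (u - abs_aefun \<phi>) < \<epsilon>" using \<phi> by blast
qed

lemma subspace_H10: "subspace (H10 \<Omega>)"
proof (rule subspaceI)
  show "0 \<in> H10 \<Omega>"
    using test_in_H10[OF zero_test] by (simp add: zero_aefun_def)
  fix u assume u: "u \<in> H10 \<Omega>"
  show "u + v \<in> H10 \<Omega>" if v: "v \<in> H10 \<Omega>" for v
  proof (rule H10_closed)
    show "u + v \<in> H1 \<Omega>" using u v by (simp add: H10_H1)
    fix \<epsilon> :: real assume "0 < \<epsilon>"
    then obtain \<phi> \<psi> where \<phi>: "test_function \<Omega> \<phi>" "h1.nrm (u - abs_aefun \<phi>) < \<epsilon> / 2"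
      and \<psi>: "test_function \<Omega> \<psi>" "h1.nrm (v - abs_aefun \<psi>) < \<epsilon> / 2"
      using u v unfolding H10_iff by (meson half_gt_zero)
    have "h1.nrm ((u - abs_aefun \<phi>) + (v - abs_aefun \<psi>)) < \<epsilon>"
      using h1.nrm_triangle[of "u - abs_aefun \<phi>" "v - abs_aefun \<psi>"] \<phi> \<psi> H10_H1[OF u] H10_H1[OF v]
      by (simp add: test_in_H1)
    also have "(u - abs_aefun \<phi>) + (v - abs_aefun \<psi>) = (u + v) - abs_aefun (\<lambda>x. \<phi> x + \<psi> x)"
      using abs_aefun_add[OF test_meas[OF \<phi>(1)] test_meas[OF \<psi>(1)]] by (simp add: algebra_simps)
    finally show "\<exists>w\<in>H10 \<Omega>. h1.nrm (u + v - w) < \<epsilon>"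
      using test_in_H10[OF test_add[OF \<phi>(1) \<psi>(1)]] by blast
  qed
  show "c *\<^sub>R u \<in> H10 \<Omega>" for c
  proof (rule H10_closed)
    show "c *\<^sub>R u \<in> H1 \<Omega>" using u by (simp add: H10_H1)
    fix \<epsilon> :: real assume "0 < \<epsilon>"
    then have "0 < \<epsilon> / (\<bar>c\<bar> + 1)" by (simp add: add_nonneg_pos)
    then obtain \<phi> where \<phi>: "test_function \<Omega> \<phi>" "h1.nrm (u - abs_aefun \<phi>) < \<epsilon> / (\<bar>c\<bar> + 1)"
      using u unfolding H10_iff by meson
    have V: "u - abs_aefun \<phi> \<in> H1 \<Omega>" using \<phi>(1) H10_H1[OF u] by (simp add: test_in_H1)
    have "h1.nrm (c *\<^sub>R (u - abs_aefun \<phi>)) \<le> (\<bar>c\<bar> + 1) * h1.nrm (u - abs_aefun \<phi>)"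
      unfolding h1.nrm_scale[OF V] by (rule mult_right_mono) (use V in auto)
    also have "\<dots> < \<epsilon>"
      using \<phi>(2) by (simp add: pos_less_divide_eq add_nonneg_pos mult.commute)
    finally have "h1.nrm (c *\<^sub>R u - abs_aefun (\<lambda>x. c * \<phi> x)) < \<epsilon>"
      using abs_aefun_scale[OF test_meas[OF \<phi>(1)], of c] by (simp add: scaleR_diff_right)
    then show "\<exists>w\<in>H10 \<Omega>. h1.nrm (c *\<^sub>R u - w) < \<epsilon>"
      using test_in_H10[OF test_scale[OF \<phi>(1)]] by blast
  qed
qed

text \<open>The coordinate function \<open>x \<bullet> b\<close> has derivative \<open>1\<close> along \<open>b\<close> and is bounded on \<open>\<Omega>\<close>.
Integrating by parts, \<open>\<integral>\<phi>\<^sup>2 = - 2 \<integral>(x \<bullet> b) \<phi> \<partial>\<^sub>b\<phi>\<close>, and half of \<open>\<integral>\<phi>\<^sup>2\<close> can be absorbed from the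
right-hand side.\<close>

lemma Poincare_test:
  obtains C where "0 < C" "\<And>\<phi>. test_function \<Omega> \<phi> \<Longrightarrow> l2.nrm (abs_aefun \<phi>) \<le> C * g.nrm (abs_aefun \<phi>)"
proof -
  obtain R where R: "0 < R" "\<And>x. x \<in> \<Omega> \<Longrightarrow> norm x \<le> R"
    using bounded_domain by (auto simp: bounded_pos)
  obtain b :: 'a where b: "b \<in> Basis" using nonempty_Basis by blast
  have "l2.nrm (abs_aefun \<phi>) \<le> (2 * R) * g.nrm (abs_aefun \<phi>)" if \<phi>: "test_function \<Omega> \<phi>" for \<phi>
  proof -
    note [measurable] = test_meas[OF \<phi>] grad_meas[OF \<phi>]
    have t: "test_function UNIV (\<lambda>x. \<phi> x * \<phi> x)" by (rule test_mult_left[OF test_smooth[OF \<phi>] test_UNIV[OF \<phi>]])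
    have lin: "smooth_on UNIV (\<lambda>x::'a. x \<bullet> b)" by (intro smooth_on_linear bounded_linear_inner_left) auto
    have dlin: "partial (\<lambda>x. x \<bullet> b) b x = 1" for x :: 'a
    proof -
      have "((\<lambda>x. x \<bullet> b) has_derivative (\<lambda>h. h \<bullet> b)) (at x)" by (auto intro!: derivative_eq_intros)
      from frechet_derivative_at[OF this, symmetric] show ?thesis using b by simp
    qed
    have dsq: "partial (\<lambda>x. \<phi> x * \<phi> x) b x = 2 * (\<phi> x * partial \<phi> b x)" for x
      using partial_mult[OF test_has_derivative[OF \<phi>] test_has_derivative[OF \<phi>], of x b] by simp
    have i1: "integrable lebesgue (\<lambda>x. \<phi> x * \<phi> x)"
      by (rule integrable_test_mult[OF \<phi> test_continuous[OF \<phi>]])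
    have i2: "integrable lebesgue (\<lambda>x. partial \<phi> b x * partial \<phi> b x)"
      by (rule integrable_test_mult[OF test_partial[OF \<phi> b] test_continuous[OF test_partial[OF \<phi> b]]])
    note i3 = integrable_norm_grad_sq[OF \<phi>]
    have "(LINT x|lebesgue. \<phi> x * \<phi> x) = (LINT x|lebesgue. (\<phi> x * \<phi> x) * partial (\<lambda>x. x \<bullet> b) b x)"
      by (simp add: dlin)
    also have "\<dots> = - (LINT x|lebesgue. partial (\<lambda>x. \<phi> x * \<phi> x) b x * (x \<bullet> b))"
      by (rule integration_by_parts[OF t lin b])
    also have "\<dots> = (LINT x|lebesgue. - (2 * (\<phi> x * partial \<phi> b x) * (x \<bullet> b)))" by (simp add: dsq)
    also have "\<dots> \<le> (LINT x|lebesgue. (1/2) * (\<phi> x * \<phi> x) + 2 * R\<^sup>2 * (partial \<phi> b x * partial \<phi> b x))"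
    proof (rule integral_mono)
      have "integrable lebesgue (\<lambda>x. partial (\<lambda>x. \<phi> x * \<phi> x) b x * (x \<bullet> b))"
        by (rule integrable_test_mult[OF test_partial[OF t b] smooth_on_continuous_on[OF lin]])
      then show "integrable lebesgue (\<lambda>x. - (2 * (\<phi> x * partial \<phi> b x) * (x \<bullet> b)))" by (simp add: dsq)
      show "integrable lebesgue (\<lambda>x. (1/2) * (\<phi> x * \<phi> x) + 2 * R\<^sup>2 * (partial \<phi> b x * partial \<phi> b x))"
        using i1 i2 by simp
      fix x
      let ?p = "partial \<phi> b x"
      show "- (2 * (\<phi> x * ?p) * (x \<bullet> b)) \<le> (1/2) * (\<phi> x * \<phi> x) + 2 * R\<^sup>2 * (?p * ?p)"
      proof (cases "x \<in> \<Omega>")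
        case True
        have "\<bar>x \<bullet> b\<bar> \<le> R" using R(2)[OF True] Basis_le_norm[OF b, of x] by linarith
        then have "(x \<bullet> b)\<^sup>2 \<le> R\<^sup>2" using power_mono[of "\<bar>x \<bullet> b\<bar>" R 2] by simp
        then have "(x \<bullet> b)\<^sup>2 * (?p * ?p) \<le> R\<^sup>2 * (?p * ?p)" by (intro mult_right_mono) auto
        moreover have "0 \<le> (1/2) * (\<phi> x + 2 * ((x \<bullet> b) * ?p))\<^sup>2" by simp
        moreover have "(1/2) * (\<phi> x + 2 * ((x \<bullet> b) * ?p))\<^sup>2 =
            (1/2) * (\<phi> x * \<phi> x) + 2 * (\<phi> x * ?p) * (x \<bullet> b) + 2 * ((x \<bullet> b)\<^sup>2 * (?p * ?p))"
          by (simp add: power2_eq_square algebra_simps)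
        ultimately show ?thesis by linarith
      qed (use test_outside[OF \<phi>] in simp)
    qed
    also have "\<dots> = (1/2) * (LINT x|lebesgue. \<phi> x * \<phi> x) + 2 * R\<^sup>2 * (LINT x|lebesgue. partial \<phi> b x * partial \<phi> b x)"
      using i1 i2 by simp
    finally have "(LINT x|lebesgue. \<phi> x * \<phi> x) \<le> 4 * R\<^sup>2 * (LINT x|lebesgue. partial \<phi> b x * partial \<phi> b x)"
      by simp
    also have "\<dots> \<le> 4 * R\<^sup>2 * (LINT x|lebesgue. (norm (grad \<phi> x))\<^sup>2)"
    proof (intro mult_left_mono integral_mono i2 i3)
      fix x
      have "\<bar>partial \<phi> b x\<bar> \<le> norm (grad \<phi> x)"
        using Basis_le_norm[OF b, of "grad \<phi> x"] grad_inner[OF b] by metis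
      then have "\<bar>partial \<phi> b x\<bar>\<^sup>2 \<le> (norm (grad \<phi> x))\<^sup>2" by (intro power_mono) auto
      then show "partial \<phi> b x * partial \<phi> b x \<le> (norm (grad \<phi> x))\<^sup>2" by (simp add: power2_eq_square)
    qed simp
    also have "(LINT x|lebesgue. (norm (grad \<phi> x))\<^sup>2) = gradient_form \<Omega> \<Omega> (abs_aefun \<phi>) (abs_aefun \<phi>)"
    proof -
      have "gradient_form \<Omega> \<Omega> (abs_aefun \<phi>) (abs_aefun \<phi>) = (LINT x:\<Omega>|lebesgue. grad \<phi> x \<bullet> grad \<phi> x)"
        unfolding gradient_form_L2 weak_gradient_test[OF \<phi>] by (rule L2_form_abs) auto
      also have "\<dots> = (LINT x|lebesgue. (norm (grad \<phi> x))\<^sup>2)"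
        unfolding set_lebesgue_integral_def power2_norm_eq_inner
        by (rule Bochner_Integration.integral_cong) (use grad_outside[OF \<phi>] in \<open>auto simp: indicator_def\<close>)
      finally show ?thesis by simp
    qed
    also have "(LINT x|lebesgue. \<phi> x * \<phi> x) = L2_form \<Omega> (abs_aefun \<phi>) (abs_aefun \<phi>)"
    proof -
      have "L2_form \<Omega> (abs_aefun \<phi>) (abs_aefun \<phi>) = (LINT x:\<Omega>|lebesgue. \<phi> x \<bullet> \<phi> x)"
        by (rule L2_form_abs) auto
      also have "\<dots> = (LINT x|lebesgue. \<phi> x * \<phi> x)"
        by (subst set_integral_eq_integral) (simp_all add: test_outside[OF \<phi>] mult.commute)
      finally show ?thesis by simp
    qed
    finally have "sqrt (L2_form \<Omega> (abs_aefun \<phi>) (abs_aefun \<phi>)) \<le>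
        sqrt ((2 * R)\<^sup>2 * gradient_form \<Omega> \<Omega> (abs_aefun \<phi>) (abs_aefun \<phi>))"
      by (simp add: power_mult_distrib)
    then show ?thesis using R(1) by (simp add: l2.nrm_def g.nrm_def real_sqrt_mult)
  qed
  then show thesis using that[of "2 * R"] R(1) by simp
qed

text \<open>Both sides are continuous in the H1 norm, in which test functions are dense.\<close>

lemma Poincare_inequality:
  obtains C where "0 < C" "\<And>u. u \<in> H10 \<Omega> \<Longrightarrow> l2.nrm u \<le> C * g.nrm u"
proof -
  obtain C where C: "0 < C"
    "\<And>\<phi>. test_function \<Omega> \<phi> \<Longrightarrow> l2.nrm (abs_aefun \<phi>) \<le> C * g.nrm (abs_aefun \<phi>)"
    by (rule Poincare_test) blast
  have "l2.nrm u \<le> C * g.nrm u" if u: "u \<in> H10 \<Omega>" for u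
  proof (rule field_le_epsilon)
    fix e :: real assume "0 < e"
    then have "0 < e / (1 + C)" using C by simp
    then obtain \<phi> where \<phi>: "test_function \<Omega> \<phi>" and n: "h1.nrm (u - abs_aefun \<phi>) < e / (1 + C)"
      using u unfolding H10_iff by meson
    let ?\<phi> = "abs_aefun \<phi>"
    have V: "u \<in> H1 \<Omega>" "?\<phi> \<in> H1 \<Omega>" "u - ?\<phi> \<in> H1 \<Omega>" "?\<phi> - u \<in> H1 \<Omega>"
      using H10_H1[OF u] test_in_H1[OF \<phi>] by auto
    have "l2.nrm u \<le> l2.nrm (u - ?\<phi>) + l2.nrm ?\<phi>"
      using l2.nrm_triangle[of "u - ?\<phi>" ?\<phi>] V H1_L2 by simp
    moreover have "l2.nrm (u - ?\<phi>) \<le> h1.nrm (u - ?\<phi>)" by (rule l2_le_h1[OF V(3)])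
    moreover have "g.nrm ?\<phi> \<le> g.nrm u + h1.nrm (u - ?\<phi>)"
      using g.nrm_triangle[of "?\<phi> - u" u] g.nrm_minus[OF V(1,2)] g_le_h1[OF V(3)] V by simp
    then have "C * g.nrm ?\<phi> \<le> C * (g.nrm u + h1.nrm (u - ?\<phi>))" using C by simp
    moreover have "(1 + C) * h1.nrm (u - ?\<phi>) \<le> e" using n C by (simp add: field_simps)
    ultimately show "l2.nrm u \<le> C * g.nrm u + e"
      using C(2)[OF \<phi>] by (simp add: algebra_simps)
  qed
  then show thesis using that C by blast
qed

text \<open>By the Poincare inequality a sequence that is Cauchy for the gradient form is also Cauchy
in L2. The functions and their gradients then converge in L2, the limits still satisfy the weak
gradient identity, and the limit belongs to the closure.\<close>

theorem hilbert_H10: "hilbert_on (H10 \<Omega>) (gradient_form \<Omega> \<Omega>)"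
proof -
  obtain C where C: "0 < C" "\<And>u. u \<in> H10 \<Omega> \<Longrightarrow> l2.nrm u \<le> C * g.nrm u"
    by (rule Poincare_inequality) blast
  have sq: "L2_form \<Omega> u u \<le> C\<^sup>2 * gradient_form \<Omega> \<Omega> u u" if u: "u \<in> H10 \<Omega>" for u
  proof -
    have "(l2.nrm u)\<^sup>2 \<le> (C * g.nrm u)\<^sup>2" using C(2)[OF u] H10_H1[OF u] H1_L2 by (intro power_mono) auto
    then show ?thesis using l2.nrm_sq g.nrm_sq H10_H1[OF u] H1_L2 by (simp add: power_mult_distrib)
  qed
  interpret s: semi_inner "H10 \<Omega>" "gradient_form \<Omega> \<Omega>"
    by unfold_locales
      (use H10_H1 in \<open>auto simp: subspace_H10 g.add_left g.scale_left g.nonneg intro: g.sym\<close>)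
  show ?thesis
  proof
    fix u assume u: "u \<in> H10 \<Omega>" "gradient_form \<Omega> \<Omega> u u = 0"
    then have "L2_form \<Omega> u u = 0"
      using sq[OF u(1)] l2.nonneg[OF H1_L2[OF H10_H1[OF u(1)]]] by simp
    then show "u = 0" using l2.definite[of u] H1_L2[OF H10_H1[OF u(1)]] by simp
  next
    fix X :: "nat \<Rightarrow> ('a, real) aefun"
    assume X: "\<And>n. X n \<in> H10 \<Omega>"
      and Cauchy: "\<And>e. 0 < e \<Longrightarrow> \<exists>N. \<forall>m\<ge>N. \<forall>n\<ge>N. gradient_form \<Omega> \<Omega> (X m - X n) (X m - X n) < e"
    have XH: "\<And>n. X n \<in> H1 \<Omega>" using X H10_H1 by blast
    let ?G = "\<lambda>n. weak_gradient \<Omega> (X n)"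
    have wdiff: "weak_gradient \<Omega> (u - v) = weak_gradient \<Omega> u - weak_gradient \<Omega> v"
      if "u \<in> H1 \<Omega>" "v \<in> H1 \<Omega>" for u v
      using weak_gradient_add[of "u - v" v] that by simp
    have "\<exists>G\<in>L2 \<Omega>. (\<lambda>n. L2_form \<Omega> (?G n - G) (?G n - G)) \<longlonglongrightarrow> 0"
    proof (rule l2v.complete)
      show "weak_gradient \<Omega> (X n) \<in> L2 \<Omega>" for n by (rule H1_gradient[OF XH])
    qed (use Cauchy in \<open>simp add: gradient_form_L2 wdiff XH\<close>)
    then obtain G where G: "G \<in> L2 \<Omega>" and limG: "(\<lambda>n. L2_form \<Omega> (?G n - G) (?G n - G)) \<longlonglongrightarrow> 0"
      by blast
    have "\<exists>u\<in>L2 \<Omega>. (\<lambda>n. L2_form \<Omega> (X n - u) (X n - u)) \<longlonglongrightarrow> 0"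
    proof (rule l2.complete)
      fix e :: real assume "0 < e"
      then obtain N where N: "\<forall>m\<ge>N. \<forall>n\<ge>N. gradient_form \<Omega> \<Omega> (X m - X n) (X m - X n) < e / C\<^sup>2"
        using Cauchy[of "e / C\<^sup>2"] C by auto
      have "L2_form \<Omega> (X m - X n) (X m - X n) < e" if "m \<ge> N" "n \<ge> N" for m n
      proof -
        have "gradient_form \<Omega> \<Omega> (X m - X n) (X m - X n) < e / C\<^sup>2" using N that by blast
        then have "C\<^sup>2 * gradient_form \<Omega> \<Omega> (X m - X n) (X m - X n) < e"
          using C(1) by (simp add: pos_less_divide_eq mult.commute)
        then show ?thesis using sq[of "X m - X n"] X by simp
      qed
      then show "\<exists>N. \<forall>m\<ge>N. \<forall>n\<ge>N. L2_form \<Omega> (X m - X n) (X m - X n) < e" by blast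
    qed (rule H1_L2[OF XH])
    then obtain u where u: "u \<in> L2 \<Omega>" and limu: "(\<lambda>n. L2_form \<Omega> (X n - u) (X n - u)) \<longlonglongrightarrow> 0"
      by blast
    have wg: "is_weak_gradient \<Omega> u G"
      unfolding is_weak_gradient_iff
    proof (intro allI impI ballI)
      fix \<phi> and b :: 'a assume \<phi>: "test_function \<Omega> \<phi>" and b: "b \<in> Basis"
      have "(\<lambda>n. L2_form \<Omega> (X n) (abs_aefun (partial \<phi> b))) \<longlonglongrightarrow> L2_form \<Omega> u (abs_aefun (partial \<phi> b))"
        by (rule l2.tendsto_left[OF H1_L2[OF XH] u test_in_L2[OF test_partial[OF \<phi> b]] limu])
      moreover have "(\<lambda>n. - L2_form \<Omega> (?G n) (abs_aefun (\<lambda>x. \<phi> x *\<^sub>R b))) \<longlonglongrightarrow>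
          - L2_form \<Omega> G (abs_aefun (\<lambda>x. \<phi> x *\<^sub>R b))"
        by (rule tendsto_minus[OF l2v.tendsto_left[OF H1_gradient(1)[OF XH] G test_vector_in_L2[OF \<phi>] limG]])
      moreover have "L2_form \<Omega> (X n) (abs_aefun (partial \<phi> b)) = - L2_form \<Omega> (?G n) (abs_aefun (\<lambda>x. \<phi> x *\<^sub>R b))" for n
        using H1_gradient(2)[OF XH] \<phi> b unfolding is_weak_gradient_iff by blast
      ultimately show "L2_form \<Omega> u (abs_aefun (partial \<phi> b)) = - L2_form \<Omega> G (abs_aefun (\<lambda>x. \<phi> x *\<^sub>R b))"
        by (simp add: LIMSEQ_unique)
    qed
    have uH: "u \<in> H1 \<Omega>" by (rule H1I[OF u G wg])
    have "gradient_form \<Omega> \<Omega> (X n - u) (X n - u) = L2_form \<Omega> (?G n - G) (?G n - G)" for n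
      by (simp add: gradient_form_L2 wdiff XH uH weak_gradient_eqI[OF G wg])
    then have limg: "(\<lambda>n. gradient_form \<Omega> \<Omega> (X n - u) (X n - u)) \<longlonglongrightarrow> 0" using limG by simp
    have "u \<in> H10 \<Omega>"
    proof (rule H10_closed[OF uH])
      fix \<epsilon> :: real assume "0 < \<epsilon>"
      have "(\<lambda>n. h1.nrm (X n - u)) \<longlonglongrightarrow> sqrt (0 + 0)"
        unfolding h1.nrm_def h1_form_def by (intro tendsto_intros limu limg)
      then have "\<forall>\<^sub>F n in sequentially. h1.nrm (X n - u) < \<epsilon>"
        using \<open>0 < \<epsilon>\<close> by (intro order_tendstoD(2)) auto
      then obtain n where "h1.nrm (X n - u) < \<epsilon>" by (auto simp: eventually_sequentially)
      then show "\<exists>v\<in>H10 \<Omega>. h1.nrm (u - v) < \<epsilon>"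
        using X h1.nrm_minus[OF XH uH] by (intro bexI[of _ "X n"]) auto
    qed
    then show "\<exists>u\<in>H10 \<Omega>. (\<lambda>n. gradient_form \<Omega> \<Omega> (X n - u) (X n - u)) \<longlonglongrightarrow> 0" using limg by blast
  qed
qed

end


section \<open>The Poincare variational operator\<close>

text \<open>For \<open>\<mu> < 0\<close> the operator \<open>T - \<mu>\<close> is bounded below by \<open>- \<mu>\<close>, and for \<open>\<mu> > 1\<close> its negative is
bounded below by \<open>\<mu> - 1\<close>; definite operators are invertible.\<close>

lemma (in hilbert_on) spectrum_in_unit_interval:
  assumes T: "bounded_op V ip T"
    and selfadj: "\<And>x y. x \<in> V \<Longrightarrow> y \<in> V \<Longrightarrow> ip (T x) y = ip x (T y)"
    and lower: "\<And>x. x \<in> V \<Longrightarrow> 0 \<le> ip (T x) x" and upper: "\<And>x. x \<in> V \<Longrightarrow> ip (T x) x \<le> ip x x"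
  shows "op_spectrum V ip T \<subseteq> {0..1}"
proof
  fix \<mu> assume \<mu>: "\<mu> \<in> op_spectrum V ip T"
  have TV: "\<And>x. x \<in> V \<Longrightarrow> T x \<in> V"
    and Tadd: "\<And>x y. x \<in> V \<Longrightarrow> y \<in> V \<Longrightarrow> T (x + y) = T x + T y"
    and Tscale: "\<And>r x. x \<in> V \<Longrightarrow> T (r *\<^sub>R x) = r *\<^sub>R T x"
    using T by (auto simp: bounded_op_def)
  obtain C where "\<forall>x\<in>V. nrm (T x) \<le> C * nrm x"
    using T unfolding bounded_op_def nrm_def by blast
  then have C: "nrm (T x) \<le> C * nrm x" if "x \<in> V" for x using that by blast
  have A: "bounded_op V ip (\<lambda>x. T x - \<mu> *\<^sub>R x)"
    unfolding bounded_op_def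
  proof (intro conjI ballI allI exI[of _ "C + \<bar>\<mu>\<bar>"])
    fix x assume x: "x \<in> V"
    show "T x - \<mu> *\<^sub>R x \<in> V" using x TV by simp
    show "T (x + y) - \<mu> *\<^sub>R (x + y) = T x - \<mu> *\<^sub>R x + (T y - \<mu> *\<^sub>R y)" if "y \<in> V" for y
      using x that by (simp add: Tadd algebra_simps)
    show "T (c *\<^sub>R x) - \<mu> *\<^sub>R c *\<^sub>R x = c *\<^sub>R (T x - \<mu> *\<^sub>R x)" for c
      using x by (simp add: Tscale algebra_simps)
    have "nrm (T x - \<mu> *\<^sub>R x) \<le> nrm (T x) + nrm ((- \<mu>) *\<^sub>R x)"
      using nrm_triangle[OF TV[OF x] mem(4)[OF x, of "- \<mu>"]] by simp
    also have "\<dots> \<le> C * nrm x + \<bar>\<mu>\<bar> * nrm x" using C[OF x] nrm_scale[OF x, of "- \<mu>"] by simp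
    finally show "sqrt (ip (T x - \<mu> *\<^sub>R x) (T x - \<mu> *\<^sub>R x)) \<le> (C + \<bar>\<mu>\<bar>) * sqrt (ip x x)"
      by (simp add: nrm_def algebra_simps)
  qed
  have sa: "ip (T x - \<mu> *\<^sub>R x) y = ip x (T y - \<mu> *\<^sub>R y)" if "x \<in> V" "y \<in> V" for x y
    using that selfadj[OF that] TV by (simp add: bilin)
  have form: "ip (T x - \<mu> *\<^sub>R x) x = ip (T x) x - \<mu> * ip x x" if "x \<in> V" for x
    using that TV by (simp add: bilin)
  have "\<not> \<mu> < 0"
  proof
    assume "\<mu> < 0"
    have "- \<mu> * ip x x \<le> 1 * ip (T x - \<mu> *\<^sub>R x) x" if "x \<in> V" for x
      using lower[OF that] by (simp add: form that)
    then have "invertible_op V ip (\<lambda>x. T x - \<mu> *\<^sub>R x)"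
      by (intro definite_imp_invertible[OF A sa, of "- \<mu>" 1]) (use \<open>\<mu> < 0\<close> in auto)
    then show False using \<mu> by (simp add: op_spectrum_def)
  qed
  moreover have "\<not> 1 < \<mu>"
  proof
    assume "1 < \<mu>"
    have "(\<mu> - 1) * ip x x \<le> - 1 * ip (T x - \<mu> *\<^sub>R x) x" if "x \<in> V" for x
      using upper[OF that] by (simp add: form that left_diff_distrib)
    then have "invertible_op V ip (\<lambda>x. T x - \<mu> *\<^sub>R x)"
      by (intro definite_imp_invertible[OF A sa, of "\<mu> - 1" "- 1"]) (use \<open>1 < \<mu>\<close> in auto)
    then show False using \<mu> by (simp add: op_spectrum_def)
  qed
  ultimately show "\<mu> \<in> {0..1}" by auto
qed

context bounded_domain begin

sublocale h10: hilbert_on "H10 \<Omega>" "gradient_form \<Omega> \<Omega>"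
  by (rule hilbert_H10)

lemma H10_inner_eq: "H10_inner \<Omega> = gradient_form \<Omega> \<Omega>"
  by (simp add: H10_inner_def fun_eq_iff)

lemma gradient_form_mono:
  assumes [measurable]: "D \<in> sets lebesgue" and D: "D \<subseteq> \<Omega>" and u: "u \<in> H1 \<Omega>"
  shows "gradient_form \<Omega> D u u \<le> gradient_form \<Omega> \<Omega> u u"
proof -
  have g: "weak_gradient \<Omega> u \<in> L2 \<Omega>" by (rule H1_gradient[OF u])
  show ?thesis
    unfolding gradient_form_L2 L2_form_def set_lebesgue_integral_def
  proof (rule integral_mono)
    show "integrable lebesgue (\<lambda>x. indicat_real D x *\<^sub>R (rep_aefun (weak_gradient \<Omega> u) x \<bullet> rep_aefun (weak_gradient \<Omega> u) x))"
      "integrable lebesgue (\<lambda>x. indicat_real \<Omega> x *\<^sub>R (rep_aefun (weak_gradient \<Omega> u) x \<bullet> rep_aefun (weak_gradient \<Omega> u) x))"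
      using L2_form_integrable[OF sets_domain _ g g] by (simp_all add: set_integrable_def assms)
  qed (use D in \<open>auto simp: indicator_def\<close>)
qed

lemma semi_inner_H10:
  assumes "S \<in> sets lebesgue"
  shows "semi_inner (H10 \<Omega>) (gradient_form \<Omega> S)"
proof -
  interpret s: semi_inner "H1 \<Omega>" "gradient_form \<Omega> S" by (rule semi_inner_gradient[OF assms])
  show ?thesis
    by unfold_locales
      (use H10_H1 in \<open>auto simp: subspace_H10 s.add_left s.scale_left s.nonneg intro: s.sym\<close>)
qed

text \<open>Existence in the definite description is the Riesz theorem for \<open>v \<mapsto> \<integral>\<^sub>D \<nabla>u \<cdot> \<nabla>v\<close>;
uniqueness is definiteness of the gradient form on \<^const>\<open>H10\<close>.\<close>

lemma poincare_op_properties: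
  assumes D: "D \<in> sets lebesgue" "D \<subseteq> \<Omega>" and u: "u \<in> H10 \<Omega>"
  shows "poincare_op \<Omega> D u \<in> H10 \<Omega>"
    and "v \<in> H10 \<Omega> \<Longrightarrow> gradient_form \<Omega> \<Omega> (poincare_op \<Omega> D u) v = gradient_form \<Omega> D u v"
proof -
  interpret s: semi_inner "H10 \<Omega>" "gradient_form \<Omega> D" by (rule semi_inner_H10[OF D(1)])
  have "\<exists>w\<in>H10 \<Omega>. \<forall>v\<in>H10 \<Omega>. gradient_form \<Omega> \<Omega> w v = gradient_form \<Omega> D u v"
  proof (rule h10.Riesz_representation[where C = "s.nrm u"])
    fix v assume v: "v \<in> H10 \<Omega>"
    have "\<bar>gradient_form \<Omega> D u v\<bar> \<le> s.nrm u * s.nrm v" by (rule s.Cauchy_Schwarz[OF u v])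
    also have "\<dots> \<le> s.nrm u * h10.nrm v"
      using gradient_form_mono[OF D H10_H1[OF v]] u
      by (intro mult_left_mono) (auto simp: s.nrm_def h10.nrm_def s.nonneg)
    finally show "\<bar>gradient_form \<Omega> D u v\<bar> \<le> s.nrm u * h10.nrm v" .
  qed (use u in \<open>auto simp: s.add_right s.scale_right\<close>)
  then obtain w where w: "w \<in> H10 \<Omega>" "\<forall>v\<in>H10 \<Omega>. gradient_form \<Omega> \<Omega> w v = gradient_form \<Omega> D u v"
    by blast
  have "poincare_op \<Omega> D u = w"
    unfolding poincare_op_def H10_inner_eq
  proof (rule the_equality)
    fix w' assume w': "w' \<in> H10 \<Omega> \<and> (\<forall>v\<in>H10 \<Omega>. gradient_form \<Omega> \<Omega> w' v = gradient_form \<Omega> D u v)"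
    show "w' = w" by (rule h10.nondegenerate) (use w w' in auto)
  qed (use w in blast)
  then show "poincare_op \<Omega> D u \<in> H10 \<Omega>"
    and "v \<in> H10 \<Omega> \<Longrightarrow> gradient_form \<Omega> \<Omega> (poincare_op \<Omega> D u) v = gradient_form \<Omega> D u v"
    using w by auto
qed

theorem poincare_spectrum_subset:
  assumes D: "D \<in> sets lebesgue" "D \<subseteq> \<Omega>"
  shows "op_spectrum (H10 \<Omega>) (H10_inner \<Omega>) (poincare_op \<Omega> D) \<subseteq> {0..1}"
  unfolding H10_inner_eq
proof (rule h10.spectrum_in_unit_interval)
  interpret s: semi_inner "H10 \<Omega>" "gradient_form \<Omega> D" by (rule semi_inner_H10[OF D(1)])
  let ?T = "poincare_op \<Omega> D"
  note TV = poincare_op_properties(1)[OF D] and T = poincare_op_properties(2)[OF D]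
  show "gradient_form \<Omega> \<Omega> (?T u) v = gradient_form \<Omega> \<Omega> u (?T v)" if "u \<in> H10 \<Omega>" "v \<in> H10 \<Omega>" for u v
    using T[OF that] T[OF that(2,1)] h10.sym[OF that(1) TV[OF that(2)]] s.sym[OF that] by simp
  show "0 \<le> gradient_form \<Omega> \<Omega> (?T u) u" if "u \<in> H10 \<Omega>" for u
    using that by (simp add: T s.nonneg)
  show "gradient_form \<Omega> \<Omega> (?T u) u \<le> gradient_form \<Omega> \<Omega> u u" if "u \<in> H10 \<Omega>" for u
    using that by (simp add: T gradient_form_mono[OF D] H10_H1)
  show "bounded_op (H10 \<Omega>) (gradient_form \<Omega> \<Omega>) ?T"
    unfolding bounded_op_def
  proof (intro conjI ballI allI exI[of _ 1])
    fix u assume u: "u \<in> H10 \<Omega>"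
    show "?T u \<in> H10 \<Omega>" by (rule TV[OF u])
    show "?T (u + v) = ?T u + ?T v" if v: "v \<in> H10 \<Omega>" for v
      by (rule h10.nondegenerate) (use u v TV in \<open>simp_all add: T h10.add_left s.add_left\<close>)
    show "?T (c *\<^sub>R u) = c *\<^sub>R ?T u" for c
      by (rule h10.nondegenerate) (use u TV in \<open>simp_all add: T h10.scale_left s.scale_left\<close>)
    have "h10.nrm (?T u) * h10.nrm (?T u) = gradient_form \<Omega> D u (?T u)"
      using T[OF u TV[OF u]] h10.nrm_sq[OF TV[OF u]] by (simp add: power2_eq_square)
    also have "\<dots> \<le> s.nrm u * s.nrm (?T u)"
      using s.Cauchy_Schwarz[OF u TV[OF u]] by simp
    also have "\<dots> \<le> h10.nrm u * h10.nrm (?T u)"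
      using gradient_form_mono[OF D H10_H1[OF u]] gradient_form_mono[OF D H10_H1[OF TV[OF u]]] u TV[OF u]
      by (intro mult_mono) (auto simp: s.nrm_def h10.nrm_def s.nonneg h10.nonneg)
    finally have "h10.nrm (?T u) * h10.nrm (?T u) \<le> h10.nrm u * h10.nrm (?T u)" .
    then have "h10.nrm (?T u) \<le> h10.nrm u"
      using h10.nrm_nonneg[OF TV[OF u]] h10.nrm_nonneg[OF u]
      by (cases "h10.nrm (?T u) = 0") auto
    then show "sqrt (gradient_form \<Omega> \<Omega> (?T u) (?T u)) \<le> 1 * sqrt (gradient_form \<Omega> \<Omega> u u)"
      by (simp add: h10.nrm_def)
  qed
qed

end

section \<open>A Weyl criterion in the plane\<close>

text \<open>The rotation by a quarter turn, which carries gradients to divergence-free fields.\<close>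

definition rot :: "real^2 \<Rightarrow> real^2" where
  "rot v = vector [- (v $ 2), v $ 1]"

lemma rot_nth [simp]: "rot v $ 1 = - (v $ 2)" "rot v $ 2 = v $ 1"
  by (simp_all add: rot_def)

lemma bounded_linear_rot: "bounded_linear rot"
  by (intro linear_conv_bounded_linear[THEN iffD1] linearI)
    (simp_all add: vec_eq_iff forall_2)

lemma norm_rot [simp]: "norm (rot v) = norm v"
  by (simp add: norm_vec_def L2_set_def sum_2 add.commute)

lemma rot_rot [simp]: "rot (rot v) = - v"
  by (simp add: vec_eq_iff forall_2)

lemma rot_diff: "rot (v - w) = rot v - rot w"
  by (rule linear_diff[OF bounded_linear.linear[OF bounded_linear_rot]])

lemma rot_scale: "rot (c *\<^sub>R v) = c *\<^sub>R rot v"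
  by (rule linear_scale[OF bounded_linear.linear[OF bounded_linear_rot]])

lemma inner_real2: "(x::real^2) \<bullet> y = x $ 1 * y $ 1 + x $ 2 * y $ 2"
  by (simp add: inner_vec_def sum_2)

lemma grad_nth: "grad f x $ i = partial f (axis i 1) (x::real^2)"
  using grad_inner[of "axis i 1" f x] by (simp add: axis_in_Basis_iff inner_axis)

text \<open>The field \<open>rot \<nabla>S\<close> is divergence free, which in weak form is the symmetry of mixed partial
derivatives.\<close>

lemma integral_grad_rot_grad:
  fixes S v :: "real^2 \<Rightarrow> real"
  assumes S: "test_function UNIV S" and v: "test_function UNIV v"
  shows "(LINT x|lebesgue. rot (grad S x) \<bullet> grad v x) = 0"
proof -
  have B: "axis 1 1 \<in> (Basis :: (real^2) set)" "axis 2 1 \<in> (Basis :: (real^2) set)"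
    by (simp_all add: axis_in_Basis_iff)
  have i: "integrable lebesgue (\<lambda>x. partial S b x * partial v c x)" if "b \<in> Basis" "c \<in> Basis" for b c
    by (rule integrable_test_mult[OF test_partial[OF S that(1)] test_continuous[OF test_partial[OF v that(2)]]])
  have "(LINT x|lebesgue. rot (grad S x) \<bullet> grad v x) =
      (LINT x|lebesgue. partial S (axis 1 1) x * partial v (axis 2 1) x
        - partial S (axis 2 1) x * partial v (axis 1 1) x)"
    by (simp add: inner_real2 grad_nth)
  also have "\<dots> = 0"
    using i B integral_partial_swap[OF S v B] by simp
  finally show ?thesis .
qed

definition energy :: "(real^2 \<Rightarrow> real) \<Rightarrow> real" where
  "energy u = (LINT x|lebesgue. (norm (grad u x))\<^sup>2)"

text \<open>The form of \<open>T - \<mu>\<close> at \<open>u\<close> is \<open>v \<mapsto> \<integral>(1\<^sub>D - \<mu>) \<nabla>u \<cdot> \<nabla>v\<close>. It vanishes when \<open>(1\<^sub>D - \<mu>) \<nabla>u\<close> is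
the divergence-free field with stream function \<open>S\<close>; the defect is the squared L2 distance from
that situation. Having a stream function as a second unknown avoids second derivatives of \<open>u\<close> and
boundary terms on the interface.\<close>

definition defect :: "(real^2) set \<Rightarrow> real \<Rightarrow> (real^2 \<Rightarrow> real) \<Rightarrow> (real^2 \<Rightarrow> real) \<Rightarrow> real" where
  "defect D \<mu> u S = (LINT x|lebesgue. (norm ((indicator D x - \<mu>) *\<^sub>R grad u x - rot (grad S x)))\<^sup>2)"

lemma residual_measurable:
  assumes [measurable]: "D \<in> sets lebesgue" and u: "test_function \<Omega> u" and S: "test_function \<Omega> S"
  shows "meas_leb (\<lambda>x. (indicator D x - \<mu>) *\<^sub>R grad u x - rot (grad S x))"
proof -
  have [measurable]: "meas_leb (\<lambda>x. rot (grad S x))"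
    by (intro continuous_imp_meas_leb bounded_linear.continuous_on[OF bounded_linear_rot]
        continuous_on_grad[OF S])
  note [measurable] = grad_meas[OF u]
  show ?thesis by measurable
qed

lemma residual_integrable:
  assumes D: "D \<in> sets lebesgue" and u: "test_function \<Omega> u" and S: "test_function \<Omega> S"
  shows "integrable lebesgue (\<lambda>x. (norm ((indicator D x - \<mu>) *\<^sub>R grad u x - rot (grad S x)))\<^sup>2)"
proof (rule Bochner_Integration.integrable_bound)
  show "integrable lebesgue (\<lambda>x. 2 * ((1 + \<bar>\<mu>\<bar>)\<^sup>2 * (norm (grad u x))\<^sup>2) + 2 * (norm (grad S x))\<^sup>2)"
    using integrable_norm_grad_sq[OF u] integrable_norm_grad_sq[OF S] by simp
  show "meas_leb (\<lambda>x. (norm ((indicator D x - \<mu>) *\<^sub>R grad u x - rot (grad S x)))\<^sup>2)"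
    using residual_measurable[OF D u S, of \<mu>] by measurable
  show "AE x in lebesgue. norm ((norm ((indicator D x - \<mu>) *\<^sub>R grad u x - rot (grad S x)))\<^sup>2)
      \<le> norm (2 * ((1 + \<bar>\<mu>\<bar>)\<^sup>2 * (norm (grad u x))\<^sup>2) + 2 * (norm (grad S x))\<^sup>2)"
  proof (rule AE_I2)
    fix x
    have "\<bar>indicator D x - \<mu>\<bar> \<le> 1 + \<bar>\<mu>\<bar>" by (auto simp: indicator_def)
    then have "\<bar>indicator D x - \<mu>\<bar>\<^sup>2 \<le> (1 + \<bar>\<mu>\<bar>)\<^sup>2" by (intro power_mono) auto
    then have "(norm ((indicator D x - \<mu>) *\<^sub>R grad u x))\<^sup>2 \<le> (1 + \<bar>\<mu>\<bar>)\<^sup>2 * (norm (grad u x))\<^sup>2"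
      by (simp add: power_mult_distrib mult_right_mono)
    moreover have "(norm ((indicator D x - \<mu>) *\<^sub>R grad u x + - rot (grad S x)))\<^sup>2 \<le>
        2 * (norm ((indicator D x - \<mu>) *\<^sub>R grad u x))\<^sup>2 + 2 * (norm (- rot (grad S x)))\<^sup>2"
      by (rule norm_add_sq_le)
    ultimately have "(norm ((indicator D x - \<mu>) *\<^sub>R grad u x - rot (grad S x)))\<^sup>2 \<le>
        2 * ((1 + \<bar>\<mu>\<bar>)\<^sup>2 * (norm (grad u x))\<^sup>2) + 2 * (norm (grad S x))\<^sup>2" by simp
    then show "norm ((norm ((indicator D x - \<mu>) *\<^sub>R grad u x - rot (grad S x)))\<^sup>2)
      \<le> norm (2 * ((1 + \<bar>\<mu>\<bar>)\<^sup>2 * (norm (grad u x))\<^sup>2) + 2 * (norm (grad S x))\<^sup>2)" by simp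
  qed
qed

locale planar_domain = bounded_domain \<Omega> for \<Omega> :: "(real^2) set"
begin

lemma rot_grad_in_L2:
  assumes "test_function \<Omega> S"
  shows "abs_aefun (\<lambda>x. rot (grad S x)) \<in> L2 \<Omega>"
proof (rule L2_abs)
  show "meas_leb (\<lambda>x. rot (grad S x))"
    by (intro continuous_imp_meas_leb bounded_linear.continuous_on[OF bounded_linear_rot]
        continuous_on_grad[OF assms])
  show "rot (grad S x) = 0" if "x \<notin> \<Omega>" for x
    using grad_outside[OF assms that] linear_0[OF bounded_linear.linear[OF bounded_linear_rot]] by simp
  show "integrable lebesgue (\<lambda>x. (norm (rot (grad S x)))\<^sup>2)"
    using integrable_norm_grad_sq[OF assms] by simp
qed simp

text \<open>For test functions this is \<open>integral_grad_rot_grad\<close>; both sides are continuous in \<open>w\<close>, and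
test functions are dense in \<^const>\<open>H10\<close>.\<close>

lemma rot_grad_orthogonal:
  assumes S: "test_function \<Omega> S" and w: "w \<in> H10 \<Omega>"
  shows "L2_form \<Omega> (abs_aefun (\<lambda>x. rot (grad S x))) (weak_gradient \<Omega> w) = 0" (is "L2_form \<Omega> ?J _ = 0")
proof -
  have J: "?J \<in> L2 \<Omega>" by (rule rot_grad_in_L2[OF S])
  have t: "L2_form \<Omega> ?J (weak_gradient \<Omega> (abs_aefun \<phi>)) = 0" if \<phi>: "test_function \<Omega> \<phi>" for \<phi>
  proof -
    have m: "meas_leb (\<lambda>x. rot (grad S x))"
      by (intro continuous_imp_meas_leb bounded_linear.continuous_on[OF bounded_linear_rot]
          continuous_on_grad[OF S])
    have "L2_form \<Omega> ?J (abs_aefun (grad \<phi>)) = (LINT x:\<Omega>|lebesgue. rot (grad S x) \<bullet> grad \<phi> x)"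
      by (rule L2_form_abs[OF sets_domain m grad_meas[OF \<phi>]])
    also have "\<dots> = (LINT x|lebesgue. rot (grad S x) \<bullet> grad \<phi> x)"
      by (subst set_integral_eq_integral) (simp_all add: grad_outside[OF \<phi>] mult.commute)
    also have "\<dots> = 0" by (rule integral_grad_rot_grad[OF test_UNIV[OF S] test_UNIV[OF \<phi>]])
    finally show ?thesis by (simp add: weak_gradient_test[OF \<phi>])
  qed
  have "\<bar>L2_form \<Omega> ?J (weak_gradient \<Omega> w)\<bar> \<le> e" if "0 < e" for e
  proof -
    have "0 < e / (l2v.nrm ?J + 1)" using that J by (simp add: add_nonneg_pos)
    then obtain \<phi> where \<phi>: "test_function \<Omega> \<phi>" and n: "h1.nrm (w - abs_aefun \<phi>) < e / (l2v.nrm ?J + 1)"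
      using w unfolding H10_iff by meson
    have V: "w \<in> H1 \<Omega>" "abs_aefun \<phi> \<in> H1 \<Omega>" "w - abs_aefun \<phi> \<in> H1 \<Omega>"
      using H10_H1[OF w] test_in_H1[OF \<phi>] by auto
    have "weak_gradient \<Omega> w = weak_gradient \<Omega> (w - abs_aefun \<phi>) + weak_gradient \<Omega> (abs_aefun \<phi>)"
      using weak_gradient_add[OF V(3,2)] by simp
    then have "L2_form \<Omega> ?J (weak_gradient \<Omega> w) = L2_form \<Omega> ?J (weak_gradient \<Omega> (w - abs_aefun \<phi>))"
      using t[OF \<phi>] J H1_gradient(1)[OF V(2)] H1_gradient(1)[OF V(3)] by (simp add: l2v.add_right)
    also have "\<bar>\<dots>\<bar> \<le> l2v.nrm ?J * l2v.nrm (weak_gradient \<Omega> (w - abs_aefun \<phi>))"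
      by (rule l2v.Cauchy_Schwarz[OF J H1_gradient(1)[OF V(3)]])
    also have "l2v.nrm (weak_gradient \<Omega> (w - abs_aefun \<phi>)) = g.nrm (w - abs_aefun \<phi>)"
      by (simp add: l2v.nrm_def g.nrm_def gradient_form_L2)
    also have "l2v.nrm ?J * g.nrm (w - abs_aefun \<phi>) \<le> (l2v.nrm ?J + 1) * (e / (l2v.nrm ?J + 1))"
      using g_le_h1[OF V(3)] n J V by (intro mult_mono) auto
    also have "\<dots> = e"
    proof -
      have "l2v.nrm ?J + 1 \<noteq> 0" using l2v.nrm_nonneg[OF J] by linarith
      then show ?thesis by simp
    qed
    finally show ?thesis .
  qed
  then have "\<bar>L2_form \<Omega> ?J (weak_gradient \<Omega> w)\<bar> \<le> 0" by (rule field_le_epsilon[of _ 0, simplified])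
  then show ?thesis by simp
qed

lemma gradient_form_test:
  assumes \<phi>: "test_function \<Omega> \<phi>"
  shows "gradient_form \<Omega> \<Omega> (abs_aefun \<phi>) (abs_aefun \<phi>) = energy \<phi>"
proof -
  have "gradient_form \<Omega> \<Omega> (abs_aefun \<phi>) (abs_aefun \<phi>) = (LINT x:\<Omega>|lebesgue. grad \<phi> x \<bullet> grad \<phi> x)"
    unfolding gradient_form_L2 weak_gradient_test[OF \<phi>] by (rule L2_form_abs) (use grad_meas[OF \<phi>] in auto)
  also have "\<dots> = energy \<phi>"
    unfolding set_lebesgue_integral_def power2_norm_eq_inner energy_def
    by (rule Bochner_Integration.integral_cong) (use grad_outside[OF \<phi>] in \<open>auto simp: indicator_def\<close>)
  finally show ?thesis .
qed

text \<open>Pair \<open>w = T u - \<mu> u\<close> with itself: \<open>\<langle>w, w\<rangle> = \<integral>(1\<^sub>D - \<mu>) \<nabla>u \<cdot> \<nabla>w\<close>. Subtracting \<open>rot \<nabla>S\<close> does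
not change this integral, and the Cauchy-Schwarz inequality finishes.\<close>

lemma residual_bound:
  fixes \<mu> :: real
  assumes D: "D \<in> sets lebesgue" "D \<subseteq> \<Omega>" and u: "test_function \<Omega> u" and S: "test_function \<Omega> S"
  defines "w \<equiv> poincare_op \<Omega> D (abs_aefun u) - \<mu> *\<^sub>R abs_aefun u"
  shows "w \<in> H10 \<Omega>" and "h10.nrm w \<le> sqrt (defect D \<mu> u S)"
proof -
  note [measurable] = D(1) grad_meas[OF u]
  have mS [measurable]: "meas_leb (\<lambda>x. rot (grad S x))"
    by (intro continuous_imp_meas_leb bounded_linear.continuous_on[OF bounded_linear_rot]
        continuous_on_grad[OF S])
  let ?u = "abs_aefun u"
  have uH: "?u \<in> H10 \<Omega>" by (rule test_in_H10[OF u])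
  show w: "w \<in> H10 \<Omega>"
    unfolding w_def using poincare_op_properties(1)[OF D uH] uH by simp
  define R where "R x = (indicat_real D x - \<mu>) *\<^sub>R grad u x - rot (grad S x)" for x
  have R_meas [measurable]: "meas_leb R" unfolding R_def by (rule residual_measurable[OF D(1) u S])
  have R0: "R x = 0" if "x \<notin> \<Omega>" for x
    using that grad_outside[OF u that] grad_outside[OF S that]
      linear_0[OF bounded_linear.linear[OF bounded_linear_rot]] by (simp add: R_def)
  have R_int: "integrable lebesgue (\<lambda>x. (norm (R x))\<^sup>2)"
    unfolding R_def by (rule residual_integrable[OF D(1) u S])
  have RL: "abs_aefun R \<in> L2 \<Omega>" by (rule L2_abs[OF sets_domain R_meas R0 R_int])
  have R_norm: "l2v.nrm (abs_aefun R) = sqrt (defect D \<mu> u S)"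
  proof -
    have "L2_form \<Omega> (abs_aefun R) (abs_aefun R) = (LINT x:\<Omega>|lebesgue. R x \<bullet> R x)"
      by (rule L2_form_abs) auto
    also have "\<dots> = defect D \<mu> u S"
      unfolding set_lebesgue_integral_def defect_def power2_norm_eq_inner R_def[symmetric]
      by (rule Bochner_Integration.integral_cong) (use R0 in \<open>auto simp: indicator_def\<close>)
    finally show ?thesis by (simp add: l2v.nrm_def)
  qed
  let ?g = "weak_gradient \<Omega> w"
  have gL: "?g \<in> L2 \<Omega>" by (rule H1_gradient[OF H10_H1[OF w]])
  have J: "L2_form \<Omega> (abs_aefun (\<lambda>x. rot (grad S x))) ?g = 0" by (rule rot_grad_orthogonal[OF S w])
  have "gradient_form \<Omega> \<Omega> w w = gradient_form \<Omega> D ?u w - \<mu> * gradient_form \<Omega> \<Omega> ?u w"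
  proof -
    have "gradient_form \<Omega> \<Omega> w w = gradient_form \<Omega> \<Omega> (poincare_op \<Omega> D ?u) w - \<mu> * gradient_form \<Omega> \<Omega> ?u w"
      using w uH poincare_op_properties(1)[OF D uH] unfolding w_def
      by (simp add: h10.diff_left h10.scale_left)
    then show ?thesis using poincare_op_properties(2)[OF D uH w] by simp
  qed
  also have "\<dots> = L2_form \<Omega> (abs_aefun R) ?g"
  proof -
    have iu: "integrable lebesgue (\<lambda>x. grad u x \<bullet> rep_aefun ?g x)"
      and iS: "integrable lebesgue (\<lambda>x. rot (grad S x) \<bullet> rep_aefun ?g x)"
      by (rule integrable_inner_of_sq;
          use integrable_norm_grad_sq[OF u] integrable_norm_grad_sq[OF S] gL in \<open>auto simp: L2_iff\<close>)+
    have sD: "integrable lebesgue (\<lambda>x. indicat_real D x *\<^sub>R (grad u x \<bullet> rep_aefun ?g x))"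
      using iu D(1) by (rule integrable_mult_indicator[rotated])
    have sO: "integrable lebesgue (\<lambda>x. indicat_real \<Omega> x *\<^sub>R (grad u x \<bullet> rep_aefun ?g x))"
      by (rule integrable_mult_indicator[OF sets_domain iu])
    have sS: "integrable lebesgue (\<lambda>x. indicat_real \<Omega> x *\<^sub>R (rot (grad S x) \<bullet> rep_aefun ?g x))"
      by (rule integrable_mult_indicator[OF sets_domain iS])
    have f1: "gradient_form \<Omega> D ?u w = (LINT x|lebesgue. indicat_real D x *\<^sub>R (grad u x \<bullet> rep_aefun ?g x))"
      using L2_form_abs[OF D(1) grad_meas[OF u], of "rep_aefun ?g"]
      by (simp add: gradient_form_L2 weak_gradient_test[OF u] set_lebesgue_integral_def)
    have f2: "gradient_form \<Omega> \<Omega> ?u w = (LINT x|lebesgue. indicat_real \<Omega> x *\<^sub>R (grad u x \<bullet> rep_aefun ?g x))"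
      using L2_form_abs[OF sets_domain grad_meas[OF u], of "rep_aefun ?g"]
      by (simp add: gradient_form_L2 weak_gradient_test[OF u] set_lebesgue_integral_def)
    have f3: "0 = (LINT x|lebesgue. indicat_real \<Omega> x *\<^sub>R (rot (grad S x) \<bullet> rep_aefun ?g x))"
      using L2_form_abs[OF sets_domain mS, of "rep_aefun ?g"] J
      by (simp add: set_lebesgue_integral_def)
    have "L2_form \<Omega> (abs_aefun R) ?g = (LINT x|lebesgue. indicat_real \<Omega> x *\<^sub>R (R x \<bullet> rep_aefun ?g x))"
      using L2_form_abs[OF sets_domain R_meas, of "rep_aefun ?g"] by (simp add: set_lebesgue_integral_def)
    also have "\<dots> = (LINT x|lebesgue. (indicat_real D x *\<^sub>R (grad u x \<bullet> rep_aefun ?g x)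
        - \<mu> * (indicat_real \<Omega> x *\<^sub>R (grad u x \<bullet> rep_aefun ?g x)))
        - indicat_real \<Omega> x *\<^sub>R (rot (grad S x) \<bullet> rep_aefun ?g x))"
      by (rule Bochner_Integration.integral_cong)
        (use D(2) in \<open>auto simp: R_def indicator_def inner_diff_left left_diff_distrib\<close>)
    also have "\<dots> = gradient_form \<Omega> D ?u w - \<mu> * gradient_form \<Omega> \<Omega> ?u w - 0"
      using sD sO sS unfolding f1 f2 f3 by simp
    finally show ?thesis by simp
  qed
  also have "\<dots> \<le> l2v.nrm (abs_aefun R) * l2v.nrm ?g"
    using l2v.Cauchy_Schwarz[OF RL gL] by simp
  also have "l2v.nrm ?g = h10.nrm w" by (simp add: l2v.nrm_def h10.nrm_def gradient_form_L2)
  finally have "h10.nrm w * h10.nrm w \<le> sqrt (defect D \<mu> u S) * h10.nrm w"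
    using h10.nrm_sq[OF w] by (simp add: R_norm power2_eq_square)
  moreover have "0 \<le> sqrt (defect D \<mu> u S)" unfolding R_norm[symmetric] using RL by simp
  ultimately show "h10.nrm w \<le> sqrt (defect D \<mu> u S)"
    using h10.nrm_nonneg[OF w] by (cases "h10.nrm w = 0") auto
qed

theorem poincare_spectrum_Weyl:
  assumes D: "D \<in> sets lebesgue" "D \<subseteq> \<Omega>"
    and weyl: "\<And>\<epsilon>. 0 < \<epsilon> \<Longrightarrow> \<exists>u S. test_function \<Omega> u \<and> test_function \<Omega> S \<and> 0 < energy u \<and>
      defect D \<mu> u S \<le> \<epsilon> * energy u"
  shows "\<mu> \<in> op_spectrum (H10 \<Omega>) (H10_inner \<Omega>) (poincare_op \<Omega> D)"
  unfolding H10_inner_eq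
proof (rule h10.Weyl_criterion)
  show "poincare_op \<Omega> D x \<in> H10 \<Omega>" if "x \<in> H10 \<Omega>" for x
    by (rule poincare_op_properties(1)[OF D that])
  fix \<epsilon> :: real assume "0 < \<epsilon>"
  then obtain u S where u: "test_function \<Omega> u" and S: "test_function \<Omega> S" and e: "0 < energy u"
    "defect D \<mu> u S \<le> \<epsilon>\<^sup>2 * energy u"
    using weyl[of "\<epsilon>\<^sup>2"] by auto
  have n: "h10.nrm (abs_aefun u) = sqrt (energy u)"
    by (simp add: h10.nrm_def gradient_form_test[OF u])
  have "h10.nrm (poincare_op \<Omega> D (abs_aefun u) - \<mu> *\<^sub>R abs_aefun u) \<le> sqrt (defect D \<mu> u S)"
    by (rule residual_bound[OF D u S])
  also have "\<dots> \<le> sqrt (\<epsilon>\<^sup>2 * energy u)" using e by simp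
  also have "\<dots> = \<epsilon> * h10.nrm (abs_aefun u)" using \<open>0 < \<epsilon>\<close> by (simp add: n real_sqrt_mult)
  finally show "\<exists>x\<in>H10 \<Omega>. 0 < h10.nrm x \<and> h10.nrm (poincare_op \<Omega> D x - \<mu> *\<^sub>R x) \<le> \<epsilon> * h10.nrm x"
    using test_in_H10[OF u] e n by (intro bexI[of _ "abs_aefun u"]) auto
qed

end


section \<open>Polynomial approximation of a function and its derivative\<close>

lemma isCont_transform_open:
  assumes "isCont f x" "open S" "x \<in> S" "\<And>y. y \<in> S \<Longrightarrow> f y = g y"
  shows "isCont g x"
proof -
  have "\<forall>\<^sub>F y in nhds x. f y = g y"
    unfolding eventually_nhds using assms(2-4) by blast
  then show ?thesis using isCont_cong[of f g x] assms(1) by blast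
qed

lemma pderiv_sum: "pderiv (\<Sum>i\<in>I. p i) = (\<Sum>i\<in>I. pderiv (p i))"
  by (induction I rule: infinite_finite_induct) (auto simp: pderiv_add)

lemma poly_antiderivative: "\<exists>p. pderiv p = (q :: real poly) \<and> poly p a = c"
proof -
  have "\<exists>p. pderiv p = q"
  proof
    show "pderiv (\<Sum>i\<le>degree q. monom (coeff q i / real (Suc i)) (Suc i)) = q"
      by (simp add: pderiv_sum pderiv_monom poly_as_sum_of_monoms)
  qed
  then obtain p where "pderiv p = q" by blast
  then have "pderiv (p + [:c - poly p a:]) = q \<and> poly (p + [:c - poly p a:]) a = c"
    by (simp add: pderiv_add pderiv_pCons)
  then show ?thesis by blast
qed

lemma Weierstrass_poly:
  fixes f :: "real \<Rightarrow> real"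
  assumes "continuous_on {a..b} f" "0 < e"
  shows "\<exists>q. \<forall>x\<in>{a..b}. \<bar>f x - poly q x\<bar> < e"
proof -
  obtain g where g: "real_polynomial_function g" "\<And>x. x \<in> {a..b} \<Longrightarrow> \<bar>f x - g x\<bar> < e"
    using Stone_Weierstrass_real_polynomial_function[OF compact_Icc assms] by blast
  then obtain c n where "g = (\<lambda>x. \<Sum>i\<le>n. c i * x ^ i)"
    by (auto simp: real_polynomial_function_iff_sum)
  then have "g x = poly (\<Sum>i\<le>n. monom (c i) i) x" for x by (simp add: poly_sum poly_monom)
  with g(2) have "\<bar>f x - poly (\<Sum>i\<le>n. monom (c i) i) x\<bar> < e" if "x \<in> {a..b}" for x
    using that by simp
  then show ?thesis by blast
qed

text \<open>The function \<open>F\<close> is Lipschitz and its derivative may jump at the points of \<open>Z\<close>. Multiplying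
\<open>dF\<close> by \<open>min 1 (n dist(c, Z))\<close> makes it continuous without enlarging it; a Weierstrass
approximation of the product is then integrated from \<open>- 1\<close>. The outcome, pointwise convergence
with uniform bounds, is what dominated convergence needs. The endpoints belong to \<open>Z\<close> because
derivatives there would be two-sided.\<close>

proposition bounded_polynomial_approximation:
  fixes F dF :: "real \<Rightarrow> real"
  assumes F: "continuous_on {-1..1} F" and Z: "finite Z" "-1 \<in> Z" "1 \<in> Z"
    and dF: "\<And>c. c \<in> {-1..1} - Z \<Longrightarrow> (F has_real_derivative dF c) (at c)"
    and dF_cont: "\<And>c. c \<in> {-1..1} - Z \<Longrightarrow> isCont dF c"
    and M: "\<And>c. c \<in> {-1..1} - Z \<Longrightarrow> \<bar>dF c\<bar> \<le> M"
  obtains p :: "nat \<Rightarrow> real poly" and K where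
    "\<And>n c. c \<in> {-1..1} \<Longrightarrow> \<bar>poly (p n) c\<bar> \<le> K" "\<And>n c. c \<in> {-1..1} \<Longrightarrow> \<bar>poly (pderiv (p n)) c\<bar> \<le> K"
    "\<And>c. c \<in> {-1..1} \<Longrightarrow> (\<lambda>n. poly (p n) c) \<longlonglongrightarrow> F c"
    "\<And>c. c \<in> {-1..1} - Z \<Longrightarrow> (\<lambda>n. poly (pderiv (p n)) c) \<longlonglongrightarrow> dF c"
proof -
  define G where "G c = (if c \<in> Z then 0 else dF c)" for c
  have M0: "0 \<le> \<bar>M\<bar>" by simp
  have G_bound: "\<bar>G c\<bar> \<le> \<bar>M\<bar>" if "c \<in> {-1..1}" for c
    using M[of c] that by (auto simp: G_def)
  have infdist_0: "infdist c Z = 0 \<longleftrightarrow> c \<in> Z" for c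
    using in_closed_iff_infdist_zero[of Z c] Z by (auto simp: finite_imp_closed)
  define w where "w n c = min 1 (real n * infdist c Z)" for n c
  have w_bounds: "0 \<le> w n c" "w n c \<le> 1" "w n c \<le> real n * infdist c Z" for n c
    by (auto simp: w_def infdist_nonneg)
  have w_cont: "isCont (w n) c" for n c
    unfolding w_def by (intro continuous_intros)
  define f where "f n c = G c * w n c" for n c
  have f_bound: "\<bar>f n c\<bar> \<le> \<bar>M\<bar>" if "c \<in> {-1..1}" for n c
    using mult_mono[OF G_bound[OF that] w_bounds(2), of n c] w_bounds(1)[of n c]
    by (simp add: f_def abs_mult)
  have f_cont: "continuous_on {-1..1} (f n)" for n
    unfolding continuous_on_eq_continuous_within
  proof
    fix c :: real assume c: "c \<in> {-1..1}"
    show "continuous (at c within {-1..1}) (f n)"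
    proof (cases "c \<in> Z")
      case False
      have "isCont G c"
      proof (rule isCont_transform_open)
        show "isCont dF c" using dF_cont c False by blast
        show "open (- Z)" using Z(1) by (simp add: finite_imp_closed open_Compl)
        show "c \<in> - Z" using False by simp
      qed (auto simp: G_def)
      then have "isCont (f n) c" unfolding f_def by (intro continuous_intros w_cont)
      then show ?thesis by (rule continuous_at_imp_continuous_within)
    next
      case True
      have "((\<lambda>x. \<bar>M\<bar> * (real n * infdist x Z)) \<longlongrightarrow> \<bar>M\<bar> * (real n * infdist c Z)) (at c within {-1..1})"
        by (intro tendsto_intros)
      then have lim: "((\<lambda>x. \<bar>M\<bar> * (real n * infdist x Z)) \<longlongrightarrow> 0) (at c within {-1..1})"
        using infdist_0 True by simp
      have "\<forall>\<^sub>F x in at c within {-1..1}. norm (f n x) \<le> \<bar>M\<bar> * (real n * infdist x Z)"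
        unfolding eventually_at_filter
      proof (intro always_eventually allI impI)
        fix x :: real assume "x \<in> {-1..1}"
        then show "norm (f n x) \<le> \<bar>M\<bar> * (real n * infdist x Z)"
          using mult_mono[OF G_bound w_bounds(3), of x n x] w_bounds(1)[of n x]
          by (simp add: f_def abs_mult)
      qed
      then have "((f n) \<longlongrightarrow> 0) (at c within {-1..1})" using lim by (rule Lim_null_comparison)
      moreover have "f n c = 0" using True by (simp add: f_def G_def)
      ultimately show ?thesis by (simp add: continuous_within)
    qed
  qed
  have f_lim: "(\<lambda>n. f n c) \<longlonglongrightarrow> G c" for c
  proof (cases "c \<in> Z")
    case True then show ?thesis by (simp add: f_def G_def)
  next
    case False
    then have pos: "0 < infdist c Z" using infdist_0[of c] infdist_nonneg[of c Z] by linarith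
    obtain N where N: "1 / infdist c Z < real N" using reals_Archimedean2 by blast
    have "f n c = G c" if "n \<ge> N" for n
    proof -
      have "1 / infdist c Z < real n" using N that by linarith
      then have "1 \<le> real n * infdist c Z" using pos by (simp add: field_simps)
      then show ?thesis by (simp add: f_def w_def)
    qed
    then show ?thesis by (intro tendsto_eventually) (auto simp: eventually_sequentially)
  qed
  have "\<exists>q. \<forall>x\<in>{-1..1}. \<bar>f n x - poly q x\<bar> < 1 / real (Suc n)" for n
    by (rule Weierstrass_poly[OF f_cont]) simp
  then obtain q where q: "\<And>n x. x \<in> {-1..1} \<Longrightarrow> \<bar>f n x - poly (q n) x\<bar> < 1 / real (Suc n)"
    by metis
  have q_lim: "(\<lambda>n. poly (q n) c) \<longlonglongrightarrow> G c" if c: "c \<in> {-1..1}" for c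
  proof -
    have "(\<lambda>n. f n c - (f n c - poly (q n) c)) \<longlonglongrightarrow> G c - 0"
    proof (intro tendsto_diff f_lim)
      show "(\<lambda>n. f n c - poly (q n) c) \<longlonglongrightarrow> 0"
        by (rule Lim_null_comparison[OF _ LIMSEQ_Suc[OF lim_const_over_n[of 1]]])
          (use q[OF c] in \<open>auto intro!: always_eventually less_imp_le\<close>)
    qed
    then show ?thesis by simp
  qed
  have q_bound: "\<bar>poly (q n) c\<bar> \<le> \<bar>M\<bar> + 1" if "c \<in> {-1..1}" for n c
  proof -
    have "1 / real (Suc n) \<le> 1" by simp
    then show ?thesis using q[OF that, of n] f_bound[OF that, of n] by linarith
  qed
  define p where "p n = (SOME p. pderiv p = q n \<and> poly p (-1) = F (-1))" for n
  have p: "pderiv (p n) = q n" "poly (p n) (-1) = F (-1)" for n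
    using someI_ex[OF poly_antiderivative, of "q n" "-1" "F (-1)"] by (simp_all add: p_def)
  have p_int: "(poly (q n) has_integral (poly (p n) c - F (-1))) {-1..c}" if "-1 \<le> c" for n c
  proof -
    have "(poly (q n) has_integral (poly (p n) c - poly (p n) (-1))) {-1..c}"
      by (rule fundamental_theorem_of_calculus[OF that])
        (use poly_DERIV[of "p n"] in \<open>auto simp: p(1) has_real_derivative_iff_has_vector_derivative
           intro: has_vector_derivative_at_within\<close>)
    then show ?thesis by (simp add: p)
  qed
  have p_lim: "(\<lambda>n. poly (p n) c) \<longlonglongrightarrow> F c" if c: "c \<in> {-1..1}" for c
  proof -
    have FI: "(G has_integral (F c - F (-1))) {-1..c}"
    proof (rule fundamental_theorem_of_calculus_interior_strong[OF Z(1)])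
      fix x assume x: "x \<in> {-1<..<c} - Z"
      then have "(F has_real_derivative dF x) (at x)" using dF c by auto
      then show "(F has_vector_derivative G x) (at x)"
        using x by (simp add: G_def has_real_derivative_iff_has_vector_derivative)
    qed (use c continuous_on_subset[OF F] in auto)
    have "(\<lambda>n. integral {-1..c} (poly (q n))) \<longlonglongrightarrow> integral {-1..c} G"
    proof (rule dominated_convergence(2)[where h = "\<lambda>_. \<bar>M\<bar> + 1"])
      show "poly (q n) integrable_on {-1..c}" for n using p_int[of c n] c by (auto simp: integrable_on_def)
      show "norm (poly (q n) x) \<le> \<bar>M\<bar> + 1" if "x \<in> {-1..c}" for n x
        using q_bound[of x n] that c by auto
      show "(\<lambda>n. poly (q n) x) \<longlonglongrightarrow> G x" if "x \<in> {-1..c}" for x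
        using q_lim[of x] that c by auto
    qed (auto intro: integrable_const_ivl)
    moreover have "integral {-1..c} (poly (q n)) = poly (p n) c - F (-1)" for n
      using p_int c by (intro integral_unique) auto
    ultimately have "(\<lambda>n. poly (p n) c - F (-1)) \<longlonglongrightarrow> F c - F (-1)"
      using integral_unique[OF FI] by simp
    then have "(\<lambda>n. poly (p n) c - F (-1) + F (-1)) \<longlonglongrightarrow> F c - F (-1) + F (-1)"
      by (intro tendsto_add tendsto_const)
    then show ?thesis by simp
  qed
  have p_bound: "\<bar>poly (p n) c\<bar> \<le> \<bar>F (-1)\<bar> + 2 * (\<bar>M\<bar> + 1)" if c: "c \<in> {-1..1}" for n c
  proof -
    have "\<bar>poly (p n) c - poly (p n) (-1)\<bar> \<le> 2 * (\<bar>M\<bar> + 1)"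
    proof (cases "c = -1")
      case False
      then have "-1 < c" using c by simp
      then obtain z where z: "-1 < z" "z < c" "poly (p n) c - poly (p n) (-1) = (c - (-1)) * poly (q n) z"
        using poly_MVT[of "-1" c "p n"] p(1)[of n] by auto
      have "\<bar>(c - (-1)) * poly (q n) z\<bar> = \<bar>c + 1\<bar> * \<bar>poly (q n) z\<bar>" by (simp add: abs_mult)
      also have "\<dots> \<le> 2 * (\<bar>M\<bar> + 1)"
        using c z q_bound[of z n] by (intro mult_mono) auto
      finally show ?thesis using z(3) by simp
    qed simp
    then show ?thesis using p(2)[of n] by linarith
  qed
  show thesis
  proof (rule that[of p "max (\<bar>F (-1)\<bar> + 2 * (\<bar>M\<bar> + 1)) (\<bar>M\<bar> + 1)"])
    show "\<bar>poly (p n) c\<bar> \<le> max (\<bar>F (-1)\<bar> + 2 * (\<bar>M\<bar> + 1)) (\<bar>M\<bar> + 1)" if "c \<in> {-1..1}" for n c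
      using p_bound[OF that, of n] by linarith
    show "\<bar>poly (pderiv (p n)) c\<bar> \<le> max (\<bar>F (-1)\<bar> + 2 * (\<bar>M\<bar> + 1)) (\<bar>M\<bar> + 1)" if "c \<in> {-1..1}" for n c
      using q_bound[OF that, of n] p(1) by (simp add: le_max_iff_disj)
    show "(\<lambda>n. poly (p n) c) \<longlonglongrightarrow> F c" if "c \<in> {-1..1}" for c by (rule p_lim[OF that])
    show "(\<lambda>n. poly (pderiv (p n)) c) \<longlonglongrightarrow> dF c" if "c \<in> {-1..1} - Z" for c
      using q_lim[of c] that p(1) by (simp add: G_def)
  qed
qed

section \<open>The angular profile\<close>

text \<open>Written with \<open>min\<close> and \<open>max\<close> the function is continuous for all \<open>A\<close> and \<open>B\<close>. When the two
branches match at \<open>\<theta>\<^sub>0\<close> it is the odd function that equals \<open>A sinh(\<xi>\<theta>)\<close> up to \<open>\<theta>\<^sub>0\<close> and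
\<open>B cosh(\<xi>(\<pi>/2 - \<theta>))\<close> beyond: the solution of \<open>f'' = \<xi>\<^sup>2 f\<close> on both sides of \<open>\<theta>\<^sub>0\<close> whose derivative
vanishes at \<open>\<plusminus>\<pi>/2\<close>.\<close>

definition profile :: "real \<Rightarrow> real \<Rightarrow> real \<Rightarrow> real \<Rightarrow> real \<Rightarrow> real" where
  "profile \<xi> \<theta>\<^sub>0 A B \<theta> = A * sinh (\<xi> * max (- \<theta>\<^sub>0) (min \<theta> \<theta>\<^sub>0)) +
     B * (cosh (\<xi> * (pi / 2 - max \<theta> \<theta>\<^sub>0)) - cosh (\<xi> * (pi / 2 + min \<theta> (- \<theta>\<^sub>0))))"

definition profile' :: "real \<Rightarrow> real \<Rightarrow> real \<Rightarrow> real \<Rightarrow> real \<Rightarrow> real" where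
  "profile' \<xi> \<theta>\<^sub>0 A B \<theta> = (if \<bar>\<theta>\<bar> < \<theta>\<^sub>0 then A * \<xi> * cosh (\<xi> * \<theta>)
     else - (B * \<xi> * sinh (\<xi> * (pi / 2 - \<bar>\<theta>\<bar>))))"

lemma profile_values:
  assumes "0 < \<theta>\<^sub>0" "A * sinh (\<xi> * \<theta>\<^sub>0) = B * cosh (\<xi> * (pi / 2 - \<theta>\<^sub>0))"
  shows "\<bar>\<theta>\<bar> \<le> \<theta>\<^sub>0 \<Longrightarrow> profile \<xi> \<theta>\<^sub>0 A B \<theta> = A * sinh (\<xi> * \<theta>)"
    and "\<theta>\<^sub>0 \<le> \<theta> \<Longrightarrow> profile \<xi> \<theta>\<^sub>0 A B \<theta> = B * cosh (\<xi> * (pi / 2 - \<theta>))"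
    and "\<theta> \<le> - \<theta>\<^sub>0 \<Longrightarrow> profile \<xi> \<theta>\<^sub>0 A B \<theta> = - (B * cosh (\<xi> * (pi / 2 + \<theta>)))"
proof -
  show "profile \<xi> \<theta>\<^sub>0 A B \<theta> = A * sinh (\<xi> * \<theta>)" if "\<bar>\<theta>\<bar> \<le> \<theta>\<^sub>0"
  proof -
    have "max (- \<theta>\<^sub>0) (min \<theta> \<theta>\<^sub>0) = \<theta>" "max \<theta> \<theta>\<^sub>0 = \<theta>\<^sub>0" "min \<theta> (- \<theta>\<^sub>0) = - \<theta>\<^sub>0"
      using that by linarith+
    then show ?thesis by (simp add: profile_def)
  qed
  show "profile \<xi> \<theta>\<^sub>0 A B \<theta> = B * cosh (\<xi> * (pi / 2 - \<theta>))" if "\<theta>\<^sub>0 \<le> \<theta>"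
  proof -
    have "max (- \<theta>\<^sub>0) (min \<theta> \<theta>\<^sub>0) = \<theta>\<^sub>0" "max \<theta> \<theta>\<^sub>0 = \<theta>" "min \<theta> (- \<theta>\<^sub>0) = - \<theta>\<^sub>0"
      using that assms(1) by linarith+
    then show ?thesis using assms(2) by (simp add: profile_def right_diff_distrib)
  qed
  show "profile \<xi> \<theta>\<^sub>0 A B \<theta> = - (B * cosh (\<xi> * (pi / 2 + \<theta>)))" if "\<theta> \<le> - \<theta>\<^sub>0"
  proof -
    have "max (- \<theta>\<^sub>0) (min \<theta> \<theta>\<^sub>0) = - \<theta>\<^sub>0" "max \<theta> \<theta>\<^sub>0 = \<theta>\<^sub>0" "min \<theta> (- \<theta>\<^sub>0) = \<theta>"
      using that assms(1) by linarith+
    then show ?thesis using assms(2) by (simp add: profile_def right_diff_distrib)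
  qed
qed

lemma profile_continuous: "continuous_on UNIV (profile \<xi> \<theta>\<^sub>0 A B)"
  unfolding profile_def sinh_field_def cosh_field_def by (intro continuous_intros) auto

lemma profile_regular:
  assumes \<theta>\<^sub>0: "0 < \<theta>\<^sub>0" and \<theta>: "\<bar>\<theta>\<bar> \<noteq> \<theta>\<^sub>0"
  shows "(profile \<xi> \<theta>\<^sub>0 A B has_real_derivative profile' \<xi> \<theta>\<^sub>0 A B \<theta>) (at \<theta>)"
    and "isCont (profile' \<xi> \<theta>\<^sub>0 A B) \<theta>"
proof -
  consider "\<bar>\<theta>\<bar> < \<theta>\<^sub>0" | "\<theta>\<^sub>0 < \<theta>" | "\<theta> < - \<theta>\<^sub>0" using \<theta> by linarith
  then have "(profile \<xi> \<theta>\<^sub>0 A B has_real_derivative profile' \<xi> \<theta>\<^sub>0 A B \<theta>) (at \<theta>) \<and> isCont (profile' \<xi> \<theta>\<^sub>0 A B) \<theta>"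
  proof cases
    case 1
    let ?S = "{- \<theta>\<^sub>0 <..< \<theta>\<^sub>0}"
    have "((\<lambda>\<theta>. A * sinh (\<xi> * \<theta>)) has_real_derivative profile' \<xi> \<theta>\<^sub>0 A B \<theta>) (at \<theta>)"
      using 1 by (auto intro!: derivative_eq_intros simp: profile'_def)
    then have d: "(profile \<xi> \<theta>\<^sub>0 A B has_real_derivative profile' \<xi> \<theta>\<^sub>0 A B \<theta>) (at \<theta>)"
      by (rule has_field_derivative_transform_within_open[of _ _ _ ?S])
        (use 1 in \<open>auto simp: profile_def\<close>)
    have "isCont (\<lambda>\<theta>. A * \<xi> * cosh (\<xi> * \<theta>)) \<theta>" by (intro continuous_intros)
    then have "isCont (profile' \<xi> \<theta>\<^sub>0 A B) \<theta>"
      by (rule isCont_transform_open[of _ _ ?S])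
        (use 1 in \<open>auto simp: profile'_def\<close>)
    with d show ?thesis by blast
  next
    case 2
    let ?S = "{\<theta>\<^sub>0 <..}"
    have "((\<lambda>\<theta>. A * sinh (\<xi> * \<theta>\<^sub>0) + B * (cosh (\<xi> * (pi / 2 - \<theta>)) - cosh (\<xi> * (pi / 2 - \<theta>\<^sub>0))))
        has_real_derivative profile' \<xi> \<theta>\<^sub>0 A B \<theta>) (at \<theta>)"
      using 2 \<theta>\<^sub>0 by (auto intro!: derivative_eq_intros simp: profile'_def)
    then have d: "(profile \<xi> \<theta>\<^sub>0 A B has_real_derivative profile' \<xi> \<theta>\<^sub>0 A B \<theta>) (at \<theta>)"
      by (rule has_field_derivative_transform_within_open[of _ _ _ ?S])
        (use 2 \<theta>\<^sub>0 in \<open>auto simp: profile_def min_def max_def\<close>)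
    have "isCont (\<lambda>\<theta>. - (B * \<xi> * sinh (\<xi> * (pi / 2 - \<theta>)))) \<theta>" by (intro continuous_intros)
    then have "isCont (profile' \<xi> \<theta>\<^sub>0 A B) \<theta>"
      by (rule isCont_transform_open[of _ _ ?S])
        (use 2 \<theta>\<^sub>0 in \<open>auto simp: profile'_def\<close>)
    with d show ?thesis by blast
  next
    case 3
    let ?S = "{..< - \<theta>\<^sub>0}"
    have "((\<lambda>\<theta>. - (A * sinh (\<xi> * \<theta>\<^sub>0)) + B * (cosh (\<xi> * (pi / 2 - \<theta>\<^sub>0)) - cosh (\<xi> * (pi / 2 + \<theta>))))
        has_real_derivative profile' \<xi> \<theta>\<^sub>0 A B \<theta>) (at \<theta>)"
      using 3 \<theta>\<^sub>0 by (auto intro!: derivative_eq_intros simp: profile'_def)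
    then have d: "(profile \<xi> \<theta>\<^sub>0 A B has_real_derivative profile' \<xi> \<theta>\<^sub>0 A B \<theta>) (at \<theta>)"
      by (rule has_field_derivative_transform_within_open[of _ _ _ ?S])
        (use 3 \<theta>\<^sub>0 in \<open>auto simp: profile_def min_def max_def\<close>)
    have "isCont (\<lambda>\<theta>. - (B * \<xi> * sinh (\<xi> * (pi / 2 + \<theta>)))) \<theta>" by (intro continuous_intros)
    then have "isCont (profile' \<xi> \<theta>\<^sub>0 A B) \<theta>"
      by (rule isCont_transform_open[of _ _ ?S])
        (use 3 \<theta>\<^sub>0 in \<open>auto simp: profile'_def\<close>)
    with d show ?thesis by blast
  qed
  then show "(profile \<xi> \<theta>\<^sub>0 A B has_real_derivative profile' \<xi> \<theta>\<^sub>0 A B \<theta>) (at \<theta>)"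
    and "isCont (profile' \<xi> \<theta>\<^sub>0 A B) \<theta>" by auto
qed

lemma sinh_le_mult_cosh:
  assumes "0 \<le> x"
  shows "sinh x \<le> x * cosh (x::real)"
proof (cases "x = 0")
  case False
  have "(sinh has_real_derivative cosh y) (at y)" for y :: real
    using has_field_derivative_sinh[OF DERIV_ident, of y] by simp
  then obtain z where z: "0 < z" "z < x" "sinh x - sinh 0 = (x - 0) * cosh z"
    using MVT2[of 0 x sinh cosh] assms False by auto
  have "cosh z \<le> cosh x" using cosh_real_nonneg_le_iff[of z x] z by simp
  then show ?thesis using z assms by (simp add: mult_left_mono)
qed simp

text \<open>As a function of \<open>sin \<theta>\<close> the profile has derivative \<open>f'(\<theta>) / cos \<theta>\<close>. It is bounded because
the numerator vanishes to first order at \<open>\<plusminus>\<pi>/2\<close>, where the denominator does.\<close>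

lemma profile'_le_cos:
  assumes \<theta>\<^sub>0: "0 < \<theta>\<^sub>0" "\<theta>\<^sub>0 < pi / 2" and "0 < \<xi>"
  obtains M where "\<And>\<theta>. \<bar>\<theta>\<bar> < pi / 2 \<Longrightarrow> \<bar>\<theta>\<bar> \<noteq> \<theta>\<^sub>0 \<Longrightarrow> \<bar>profile' \<xi> \<theta>\<^sub>0 A B \<theta>\<bar> \<le> M * cos \<theta>"
proof -
  let ?C = "cosh (\<xi> * (pi / 2))"
  define M1 where "M1 = \<bar>A\<bar> * \<xi> * ?C / cos \<theta>\<^sub>0"
  define M2 where "M2 = \<bar>B\<bar> * \<xi> * (\<xi> * ?C) / sin \<theta>\<^sub>0"
  have cos0: "cos \<theta>\<^sub>0 > 0" using \<theta>\<^sub>0 by (intro cos_gt_zero) auto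
  have sin0: "sin \<theta>\<^sub>0 > 0" using \<theta>\<^sub>0 by (intro sin_gt_zero) auto
  have pos: "0 \<le> M1" "0 \<le> M2" using cos0 sin0 \<open>0 < \<xi>\<close> by (auto simp: M1_def M2_def)
  have "\<bar>profile' \<xi> \<theta>\<^sub>0 A B \<theta>\<bar> \<le> (M1 + M2) * cos \<theta>" if \<theta>: "\<bar>\<theta>\<bar> < pi / 2" "\<bar>\<theta>\<bar> \<noteq> \<theta>\<^sub>0" for \<theta>
  proof -
    have cpos: "0 < cos \<theta>" using \<theta>(1) by (intro cos_gt_zero_pi) auto
    have cabs: "cos \<theta> = cos \<bar>\<theta>\<bar>" by simp
    show ?thesis
    proof (cases "\<bar>\<theta>\<bar> < \<theta>\<^sub>0")
      case True
      have "cosh (\<xi> * \<theta>) = cosh (\<xi> * \<bar>\<theta>\<bar>)" by (cases "0 \<le> \<theta>") auto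
      also have "\<dots> \<le> ?C"
        using \<theta> \<open>0 < \<xi>\<close> by (subst cosh_real_nonneg_le_iff) auto
      finally have ch: "cosh (\<xi> * \<theta>) \<le> ?C" .
      have "cos \<theta>\<^sub>0 \<le> cos \<theta>"
        unfolding cabs using True \<theta>\<^sub>0 by (intro cos_monotone_0_pi_le) auto
      have "\<bar>profile' \<xi> \<theta>\<^sub>0 A B \<theta>\<bar> = \<bar>A\<bar> * \<xi> * cosh (\<xi> * \<theta>)"
        using True \<open>0 < \<xi>\<close> by (simp add: profile'_def abs_mult)
      also have "\<dots> \<le> \<bar>A\<bar> * \<xi> * ?C" using ch \<open>0 < \<xi>\<close> by (intro mult_left_mono) auto
      also have "\<dots> = M1 * cos \<theta>\<^sub>0" using cos0 by (simp add: M1_def)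
      also have "\<dots> \<le> M1 * cos \<theta>" using \<open>cos \<theta>\<^sub>0 \<le> cos \<theta>\<close> pos by (intro mult_left_mono)
      also have "\<dots> \<le> (M1 + M2) * cos \<theta>" using pos cpos by (intro mult_right_mono) auto
      finally show ?thesis .
    next
      case False
      define y where "y = pi / 2 - \<bar>\<theta>\<bar>"
      have y: "0 < y" "y < pi / 2 - \<theta>\<^sub>0" using False \<theta> by (auto simp: y_def)
      have cy: "cos \<theta> = sin y" unfolding cabs y_def by (simp add: sin_diff)
      obtain z where z: "0 < z" "z < y" "sin y - sin 0 = (y - 0) * cos z"
        using MVT2[of 0 y sin cos] y DERIV_sin by blast
      have "cos (pi / 2 - \<theta>\<^sub>0) \<le> cos z" using z y \<theta>\<^sub>0 by (intro cos_monotone_0_pi_le) auto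
      then have "sin \<theta>\<^sub>0 \<le> cos z" by (simp add: cos_diff)
      then have sy: "y * sin \<theta>\<^sub>0 \<le> cos \<theta>" using z(3) y cy by (simp add: mult_left_mono)
      have "cosh (\<xi> * y) \<le> ?C"
        using y \<theta>\<^sub>0 \<open>0 < \<xi>\<close> by (subst cosh_real_nonneg_le_iff) auto
      then have "(\<xi> * y) * cosh (\<xi> * y) \<le> (\<xi> * y) * ?C"
        using y \<open>0 < \<xi>\<close> by (intro mult_left_mono) auto
      moreover have "sinh (\<xi> * y) \<le> (\<xi> * y) * cosh (\<xi> * y)"
        using y \<open>0 < \<xi>\<close> by (intro sinh_le_mult_cosh) auto
      ultimately have "sinh (\<xi> * y) \<le> (\<xi> * y) * ?C" by linarith
      moreover have "0 \<le> sinh (\<xi> * y)" using y \<open>0 < \<xi>\<close> by simp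
      ultimately have "\<bar>profile' \<xi> \<theta>\<^sub>0 A B \<theta>\<bar> \<le> \<bar>B\<bar> * \<xi> * ((\<xi> * y) * ?C)"
        using False \<open>0 < \<xi>\<close> by (simp add: profile'_def abs_mult mult_left_mono flip: y_def)
      also have "\<dots> = M2 * (y * sin \<theta>\<^sub>0)" using sin0 by (simp add: M2_def)
      also have "\<dots> \<le> M2 * cos \<theta>" using sy pos by (intro mult_left_mono)
      also have "\<dots> \<le> (M1 + M2) * cos \<theta>" using pos cpos by (intro mult_right_mono) auto
      finally show ?thesis .
    qed
  qed
  then show thesis using that by blast
qed

text \<open>Approximating in the variable \<open>sin \<theta>\<close> matters: for a point of the plane it is \<open>y/r\<close> or
\<open>x/r\<close>, which is smooth away from the origin, so the approximants of functions of the angle are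
smooth as well.\<close>

proposition profile_approximation:
  assumes \<theta>\<^sub>0: "0 < \<theta>\<^sub>0" "\<theta>\<^sub>0 < pi / 2" and \<xi>: "0 < \<xi>"
  obtains p :: "nat \<Rightarrow> real poly" and K where
    "\<And>n c. c \<in> {-1..1} \<Longrightarrow> \<bar>poly (p n) c\<bar> \<le> K" "\<And>n c. c \<in> {-1..1} \<Longrightarrow> \<bar>poly (pderiv (p n)) c\<bar> \<le> K"
    "\<And>\<theta>. \<bar>\<theta>\<bar> \<le> pi / 2 \<Longrightarrow> (\<lambda>n. poly (p n) (sin \<theta>)) \<longlonglongrightarrow> profile \<xi> \<theta>\<^sub>0 A B \<theta>"
    "\<And>\<theta>. \<bar>\<theta>\<bar> < pi / 2 \<Longrightarrow> \<bar>\<theta>\<bar> \<noteq> \<theta>\<^sub>0 \<Longrightarrow>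
      (\<lambda>n. poly (pderiv (p n)) (sin \<theta>) * cos \<theta>) \<longlonglongrightarrow> profile' \<xi> \<theta>\<^sub>0 A B \<theta>"
proof -
  let ?f = "profile \<xi> \<theta>\<^sub>0 A B" and ?f' = "profile' \<xi> \<theta>\<^sub>0 A B"
  define dF where "dF c = ?f' (arcsin c) * inverse (sqrt (1 - c\<^sup>2))" for c
  let ?Z = "{-1, 1, sin \<theta>\<^sub>0, - sin \<theta>\<^sub>0}"
  obtain M where M: "\<And>\<theta>. \<bar>\<theta>\<bar> < pi / 2 \<Longrightarrow> \<bar>\<theta>\<bar> \<noteq> \<theta>\<^sub>0 \<Longrightarrow> \<bar>?f' \<theta>\<bar> \<le> M * cos \<theta>"
    using profile'_le_cos[OF assms] by blast
  have reg: "\<bar>arcsin c\<bar> < pi / 2 \<and> \<bar>arcsin c\<bar> \<noteq> \<theta>\<^sub>0 \<and> -1 < c \<and> c < 1" if "c \<in> {-1..1} - ?Z" for c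
  proof -
    have c: "-1 < c" "c < 1" using that by auto
    have s: "sin (arcsin c) = c" using c by simp
    have "arcsin c \<noteq> \<theta>\<^sub>0" using s that by auto
    moreover have "arcsin c \<noteq> - \<theta>\<^sub>0"
    proof
      assume "arcsin c = - \<theta>\<^sub>0"
      then have "c = - sin \<theta>\<^sub>0" using s by simp
      then show False using that by simp
    qed
    ultimately show ?thesis using arcsin_lt_bounded[OF c] c by (auto simp: abs_if)
  qed
  have cont: "continuous_on {-1..1} (\<lambda>c. ?f (arcsin c))"
    by (rule continuous_on_compose2[OF profile_continuous continuous_on_arcsin']) auto
  have der: "((\<lambda>c. ?f (arcsin c)) has_real_derivative dF c) (at c) \<and> isCont dF c \<and> \<bar>dF c\<bar> \<le> M"
    if c: "c \<in> {-1..1} - ?Z" for c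
  proof (intro conjI)
    note r = reg[OF c]
    show "((\<lambda>c. ?f (arcsin c)) has_real_derivative dF c) (at c)"
      unfolding dF_def
      by (rule DERIV_chain2[OF profile_regular(1) DERIV_arcsin]) (use r \<theta>\<^sub>0 in auto)
    have sq: "c\<^sup>2 < 1" using r by (simp add: abs_square_less_1 abs_less_iff)
    show "isCont dF c"
      unfolding dF_def
      by (intro continuous_intros isCont_o2[OF isCont_arcsin profile_regular(2)])
        (use r \<theta>\<^sub>0 sq in auto)
    have "\<bar>?f' (arcsin c)\<bar> \<le> M * cos (arcsin c)" by (rule M) (use r in auto)
    also have "cos (arcsin c) = sqrt (1 - c\<^sup>2)" using r by (simp add: cos_arcsin)
    finally show "\<bar>dF c\<bar> \<le> M"
      using sq by (simp add: dF_def abs_mult field_simps)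
  qed
  obtain p K where p: "\<And>n c. c \<in> {-1..1} \<Longrightarrow> \<bar>poly (p n) c\<bar> \<le> K"
    "\<And>n c. c \<in> {-1..1} \<Longrightarrow> \<bar>poly (pderiv (p n)) c\<bar> \<le> K"
    "\<And>c. c \<in> {-1..1} \<Longrightarrow> (\<lambda>n. poly (p n) c) \<longlonglongrightarrow> ?f (arcsin c)"
    "\<And>c. c \<in> {-1..1} - ?Z \<Longrightarrow> (\<lambda>n. poly (pderiv (p n)) c) \<longlonglongrightarrow> dF c"
  proof (rule bounded_polynomial_approximation[OF cont, of ?Z dF M])
    show "((\<lambda>c. ?f (arcsin c)) has_real_derivative dF c) (at c)" "isCont dF c" "\<bar>dF c\<bar> \<le> M"
      if "c \<in> {-1..1} - ?Z" for c using der[OF that] by blast+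
    show "finite ?Z" "-1 \<in> ?Z" "1 \<in> ?Z" by auto
  qed (rule that)
  show thesis
  proof (rule that[OF p(1,2)])
    show "(\<lambda>n. poly (p n) (sin \<theta>)) \<longlonglongrightarrow> ?f \<theta>" if "\<bar>\<theta>\<bar> \<le> pi / 2" for \<theta>
      using p(3)[of "sin \<theta>"] that by (simp add: arcsin_sin abs_le_iff)
    show "(\<lambda>n. poly (pderiv (p n)) (sin \<theta>) * cos \<theta>) \<longlonglongrightarrow> ?f' \<theta>"
      if \<theta>: "\<bar>\<theta>\<bar> < pi / 2" "\<bar>\<theta>\<bar> \<noteq> \<theta>\<^sub>0" for \<theta>
    proof -
      have as: "arcsin (sin \<theta>) = \<theta>" using \<theta> by (intro arcsin_sin) auto
      have cpos: "0 < cos \<theta>" using \<theta>(1) by (intro cos_gt_zero_pi) auto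
      have inj: "x = y" if "sin x = sin y" "\<bar>x\<bar> \<le> pi / 2" "\<bar>y\<bar> \<le> pi / 2" for x y
      proof -
        have "arcsin (sin x) = x" "arcsin (sin y) = y"
          by (rule arcsin_sin; use that in linarith)+
        then show ?thesis using arg_cong[OF that(1), of arcsin] by argo
      qed
      have "sin \<theta> \<notin> ?Z"
      proof -
        have ne: "sin \<theta> \<noteq> sin a" if "\<bar>a\<bar> \<le> pi / 2" "\<theta> \<noteq> a" for a
          using inj[of \<theta> a] that \<theta>(1) by fastforce
        have "sin \<theta> \<noteq> sin (pi / 2)" "sin \<theta> \<noteq> sin (- (pi / 2))" "sin \<theta> \<noteq> sin \<theta>\<^sub>0" "sin \<theta> \<noteq> sin (- \<theta>\<^sub>0)"
          by (rule ne; use \<theta> \<theta>\<^sub>0 in linarith)+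
        then show ?thesis by simp
      qed
      then have "(\<lambda>n. poly (pderiv (p n)) (sin \<theta>) * cos \<theta>) \<longlonglongrightarrow> dF (sin \<theta>) * cos \<theta>"
        by (intro tendsto_intros p(4)) auto
      also have "dF (sin \<theta>) * cos \<theta> = ?f' \<theta>"
        using cpos by (simp add: dF_def as cos_squared_eq[symmetric] real_sqrt_abs)
      finally show ?thesis .
    qed
  qed auto
qed


section \<open>Functions with separated variables in polar coordinates\<close>

text \<open>In the variables \<open>ln r\<close> and angle, dilations become translations. The angle enters only
through the cosine of the angle to the unit vector \<open>b\<close>.\<close>

definition separated :: "(real \<Rightarrow> real) \<Rightarrow> real poly \<Rightarrow> 'a::euclidean_space \<Rightarrow> 'a \<Rightarrow> real" where
  "separated g p b x = g (ln (norm x)) * poly p ((x \<bullet> b) / norm x)"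

lemma smooth_poly: "smooth_on UNIV (poly (p :: real poly))"
proof (rule smooth_on_family[of _ "range poly"])
  fix f :: "real \<Rightarrow> real" assume "f \<in> range poly"
  then obtain q where f: "f = poly q" by blast
  show "\<exists>f'\<in>range poly. \<forall>x\<in>UNIV. (f has_real_derivative f' x) (at x)"
    unfolding f by (intro bexI[of _ "poly (pderiv q)"] ballI poly_DERIV) simp
qed auto

text \<open>These formulas express the norm and its inverse by \<open>x \<bullet> x\<close>, a polynomial in the
coordinates, so that smoothness away from \<open>0\<close> follows by composition.\<close>

lemma norm_eq_exp_ln:
  fixes x :: "'a::real_inner"
  assumes "x \<noteq> 0"
  shows "ln (norm x) = (1/2) * ln (x \<bullet> x)" "inverse (norm x) = exp (- (1/2) * ln (x \<bullet> x))"
proof -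
  show 1: "ln (norm x) = (1/2) * ln (x \<bullet> x)"
    unfolding norm_eq_sqrt_inner by (subst ln_sqrt) auto
  have "exp (- (1/2) * ln (x \<bullet> x)) = inverse (exp (ln (norm x)))" by (simp add: 1 exp_minus)
  then show "inverse (norm x) = exp (- (1/2) * ln (x \<bullet> x))" using assms by simp
qed

lemma smooth_separated:
  fixes b :: "'a::euclidean_space"
  assumes g: "smooth_on UNIV g"
  shows "smooth_on (- {0}) (separated g p b)"
proof -
  have op: "open (- {0 :: 'a})" by auto
  have "smooth_on (- {0}) (\<lambda>x::'a. \<Sum>b\<in>Basis. (x \<bullet> b) * (x \<bullet> b))"
    by (intro smooth_on_sum smooth_on_mult smooth_on_linear op bounded_linear_inner_left)
  then have "smooth_on (- {0}) (\<lambda>x::'a. x \<bullet> x)" by (simp add: euclidean_inner[symmetric])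
  from smooth_on_compose[OF op open_greaterThan this smooth_ln]
  have L: "smooth_on (- {0}) (\<lambda>x::'a. ln (x \<bullet> x))" by simp
  have c: "smooth_on (- {0}) (\<lambda>x::'a. c * ln (x \<bullet> x))" for c
    by (rule smooth_on_mult[OF op smooth_on_const[OF op] L])
  have 1: "smooth_on (- {0}) (\<lambda>x::'a. g ((1/2) * ln (x \<bullet> x)))"
    by (rule smooth_on_compose[OF op open_UNIV c g]) simp
  have 2: "smooth_on (- {0}) (\<lambda>x::'a. (x \<bullet> b) * exp (- (1/2) * ln (x \<bullet> x)))"
    by (intro smooth_on_mult op smooth_on_linear bounded_linear_inner_left
        smooth_on_compose[OF op open_UNIV c smooth_exp]) auto
  have 3: "smooth_on (- {0}) (\<lambda>x::'a. poly p ((x \<bullet> b) * exp (- (1/2) * ln (x \<bullet> x))))"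
    by (rule smooth_on_compose[OF op open_UNIV 2 smooth_poly]) simp
  have "smooth_on (- {0}) (\<lambda>x::'a. g ((1/2) * ln (x \<bullet> x)) * poly p ((x \<bullet> b) * exp (- (1/2) * ln (x \<bullet> x))))"
    by (rule smooth_on_mult[OF op 1 3])
  moreover have "separated g p b x = g ((1/2) * ln (x \<bullet> x)) * poly p ((x \<bullet> b) * exp (- (1/2) * ln (x \<bullet> x)))"
    if "x \<in> - {0}" for x
  proof -
    have "x \<noteq> 0" using that by simp
    note n = norm_eq_exp_ln[OF this]
    show ?thesis unfolding separated_def n(1) n(2)[symmetric] by (simp only: divide_inverse)
  qed
  ultimately show ?thesis by (subst smooth_on_cong[OF op]) auto
qed

text \<open>Since \<open>ln 0 = 0\<close>, the value at the origin is a multiple of \<open>g 0\<close>; it is \<open>0\<close> because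
\<open>t\<^sub>2 < 0\<close>.\<close>

lemma test_separated:
  fixes b :: "'a::euclidean_space"
  assumes g: "smooth_on UNIV g" and supp: "\<And>t. t \<notin> {t1..t2} \<Longrightarrow> g t = 0"
    and t2: "t2 < 0" "exp t2 < \<rho>"
  shows "test_function (ball 0 \<rho>) (separated g p b)"
  unfolding test_function_def
proof (intro conjI exI[of _ "cball 0 (exp t2) - ball 0 (exp t1)"] allI impI)
  have g0: "g 0 = 0" using supp[of 0] t2 by simp
  have zero: "separated g p b x = 0" if "norm x < exp t1 \<or> exp t2 < norm x" for x
  proof (cases "x = 0")
    case True then show ?thesis by (simp add: separated_def g0)
  next
    case False
    then have "ln (norm x) < t1 \<or> t2 < ln (norm x)"
      using that by (metis exp_less_cancel_iff exp_ln zero_less_norm_iff)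
    then show ?thesis using supp[of "ln (norm x)"] by (auto simp: separated_def)
  qed
  show "smooth_on UNIV (separated g p b)"
  proof (rule smooth_on_local)
    fix x :: 'a
    show "\<exists>U. open U \<and> x \<in> U \<and> smooth_on U (separated g p b)"
    proof (cases "x = 0")
      case False
      then show ?thesis using smooth_separated[OF g] by (intro exI[of _ "- {0}"]) auto
    next
      case True
      have "smooth_on (ball 0 (exp t1)) (separated g p b)"
        by (subst smooth_on_cong[of _ _ "\<lambda>_. 0"]) (auto intro!: zero)
      then show ?thesis using True by (intro exI[of _ "ball 0 (exp t1)"]) auto
    qed
  qed simp
  show "compact (cball (0::'a) (exp t2) - ball 0 (exp t1))" by (intro compact_diff) auto
  show "cball (0::'a) (exp t2) - ball 0 (exp t1) \<subseteq> ball 0 \<rho>" using t2 by auto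
  show "separated g p b x = 0" if "x \<notin> cball 0 (exp t2) - ball 0 (exp t1)" for x
    using that by (intro zero) auto
qed

lemma grad_eqI:
  assumes "(f has_derivative (\<lambda>h. G \<bullet> h)) (at x)"
  shows "grad f x = G"
  by (rule euclidean_eqI) (simp add: grad_inner frechet_derivative_at[OF assms, symmetric])

lemma grad_separated:
  fixes b :: "'a::euclidean_space"
  assumes g: "\<And>t. (g has_real_derivative g' t) (at t)" and x: "x \<noteq> 0"
  defines "e \<equiv> (1 / norm x) *\<^sub>R x" and "c \<equiv> (x \<bullet> b) / norm x" and "L \<equiv> ln (norm x)"
  shows "grad (separated g p b) x =
    (1 / norm x) *\<^sub>R ((g' L * poly p c) *\<^sub>R e + (g L * poly (pderiv p) c) *\<^sub>R (b - c *\<^sub>R e))"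
proof (rule grad_eqI)
  have n: "norm x > 0" using x by simp
  have dn: "(norm has_derivative (\<lambda>h. sgn x \<bullet> h)) (at x)"
    using has_derivative_norm[OF x] by (simp add: inner_commute)
  have dL: "((\<lambda>x. ln (norm x)) has_derivative (\<lambda>h. (sgn x \<bullet> h) * inverse (norm x))) (at x)"
    using has_derivative_compose[OF dn DERIV_ln[OF n, unfolded has_field_derivative_def]] by (simp add: mult.commute)
  have dc: "((\<lambda>x. (x \<bullet> b) / norm x) has_derivative
      (\<lambda>h. ((h \<bullet> b) * norm x - (x \<bullet> b) * (sgn x \<bullet> h)) / (norm x * norm x))) (at x)"
    by (rule has_derivative_divide'[OF _ dn]) (use x in \<open>auto intro!: derivative_eq_intros\<close>)
  have d1: "((\<lambda>x. g (ln (norm x))) has_derivative (\<lambda>h. g' L * ((sgn x \<bullet> h) * inverse (norm x)))) (at x)"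
    using has_derivative_compose[OF dL g[unfolded has_field_derivative_def]] by (simp add: L_def)
  have d2: "((\<lambda>x. poly p ((x \<bullet> b) / norm x)) has_derivative
      (\<lambda>h. poly (pderiv p) c * (((h \<bullet> b) * norm x - (x \<bullet> b) * (sgn x \<bullet> h)) / (norm x * norm x)))) (at x)"
    using has_derivative_compose[OF dc poly_DERIV[unfolded has_field_derivative_def]] by (simp add: c_def)
  have "(separated g p b has_derivative
      (\<lambda>h. g L * (poly (pderiv p) c * (((h \<bullet> b) * norm x - (x \<bullet> b) * (sgn x \<bullet> h)) / (norm x * norm x)))
         + g' L * ((sgn x \<bullet> h) * inverse (norm x)) * poly p c)) (at x)"
    using has_derivative_mult[OF d1 d2] unfolding separated_def[abs_def] L_def c_def .
  moreover have "g L * (poly (pderiv p) c * (((h \<bullet> b) * norm x - (x \<bullet> b) * (sgn x \<bullet> h)) / (norm x * norm x)))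
         + g' L * ((sgn x \<bullet> h) * inverse (norm x)) * poly p c =
      ((1 / norm x) *\<^sub>R ((g' L * poly p c) *\<^sub>R e + (g L * poly (pderiv p) c) *\<^sub>R (b - c *\<^sub>R e))) \<bullet> h" for h
    using n by (simp add: e_def c_def sgn_div_norm inner_simps field_simps inner_commute)
  ultimately show "(separated g p b has_derivative
      (\<lambda>h. ((1 / norm x) *\<^sub>R ((g' L * poly p c) *\<^sub>R e + (g L * poly (pderiv p) c) *\<^sub>R (b - c *\<^sub>R e))) \<bullet> h)) (at x)"
    by simp
qed

abbreviation e\<^sub>1 :: "real^2" where "e\<^sub>1 \<equiv> axis 1 1"
abbreviation e\<^sub>2 :: "real^2" where "e\<^sub>2 \<equiv> axis 2 1"

lemma norm_frame:
  assumes "norm e = 1"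
  shows "(norm (\<alpha> *\<^sub>R e + \<beta> *\<^sub>R rot e))\<^sup>2 = \<alpha>\<^sup>2 + \<beta>\<^sup>2"
proof -
  have e: "(e $ 1)\<^sup>2 + (e $ 2)\<^sup>2 = 1"
    using assms by (simp add: norm_vec_def L2_set_def sum_2)
  have "(norm (\<alpha> *\<^sub>R e + \<beta> *\<^sub>R rot e))\<^sup>2 = (\<alpha>\<^sup>2 + \<beta>\<^sup>2) * ((e $ 1)\<^sup>2 + (e $ 2)\<^sup>2)"
    unfolding power2_norm_eq_inner inner_real2 by (simp add: power2_eq_square algebra_simps)
  then show ?thesis using e by simp
qed

lemma polar_frame:
  assumes "x \<noteq> 0"
  defines "e \<equiv> (1 / norm x) *\<^sub>R x" and "c \<equiv> (x \<bullet> e\<^sub>1) / norm x" and "s \<equiv> (x \<bullet> e\<^sub>2) / norm x"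
  shows "norm e = 1" "c\<^sup>2 + s\<^sup>2 = 1" "e\<^sub>1 - c *\<^sub>R e = (- s) *\<^sub>R rot e" "e\<^sub>2 - s *\<^sub>R e = c *\<^sub>R rot e"
proof -
  have cs: "e $ 1 = c" "e $ 2 = s" by (simp_all add: e_def c_def s_def inner_axis)
  show n: "norm e = 1" using assms(1) by (simp add: e_def)
  show *: "c\<^sup>2 + s\<^sup>2 = 1" using n cs by (simp add: norm_vec_def L2_set_def sum_2)
  have "1 - c * c = s * s" "1 - s * s = c * c" using * by (simp_all add: power2_eq_square)
  then show "e\<^sub>1 - c *\<^sub>R e = (- s) *\<^sub>R rot e" "e\<^sub>2 - s *\<^sub>R e = c *\<^sub>R rot e"
    by (simp_all add: vec_eq_iff forall_2 cs axis_def)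
qed

text \<open>In the frame of radial and angular unit vectors the gradient of a separated function has
two explicit components. With the radial factor \<open>g'\<close> in the stream function, the radial component
of the residual contains \<open>g'\<close> only, and the angular one \<open>g\<close> and \<open>g''\<close>; this is what makes the
equation \<open>a \<nabla>u = rot \<nabla>S\<close> separate.\<close>

lemma pair_gradients:
  fixes x :: "real^2"
  assumes g: "\<And>t. (g has_real_derivative g' t) (at t)" and g': "\<And>t. (g' has_real_derivative g'' t) (at t)"
    and x: "x \<noteq> 0"
  defines "c \<equiv> (x \<bullet> e\<^sub>1) / norm x" and "s \<equiv> (x \<bullet> e\<^sub>2) / norm x" and "L \<equiv> ln (norm x)"
  shows "(norm (grad (separated g P e\<^sub>1) x))\<^sup>2 =
      ((g' L * poly P c)\<^sup>2 + (g L * (poly (pderiv P) c * s))\<^sup>2) / (norm x)\<^sup>2"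
    and "(norm (a *\<^sub>R grad (separated g P e\<^sub>1) x - rot (grad (separated g' Q e\<^sub>2) x)))\<^sup>2 =
      ((g' L * (a * poly P c + poly (pderiv Q) s * c))\<^sup>2 +
       (a * (g L * (poly (pderiv P) c * s)) + g'' L * poly Q s)\<^sup>2) / (norm x)\<^sup>2"
proof -
  define e where "e = (1 / norm x) *\<^sub>R x"
  note fr = polar_frame[OF x, folded e_def c_def s_def]
  have gu: "grad (separated g P e\<^sub>1) x =
      (1 / norm x) *\<^sub>R ((g' L * poly P c) *\<^sub>R e + (- (g L * (poly (pderiv P) c * s))) *\<^sub>R rot e)"
    using grad_separated[OF g x, of P e\<^sub>1] fr(3) by (simp add: e_def[symmetric] c_def[symmetric] L_def[symmetric])
  have gS: "grad (separated g' Q e\<^sub>2) x =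
      (1 / norm x) *\<^sub>R ((g'' L * poly Q s) *\<^sub>R e + (g' L * (poly (pderiv Q) s * c)) *\<^sub>R rot e)"
    using grad_separated[OF g' x, of Q e\<^sub>2] fr(4) by (simp add: e_def[symmetric] s_def[symmetric] L_def[symmetric])
  have sc: "(norm ((1 / norm x) *\<^sub>R v))\<^sup>2 = (norm v)\<^sup>2 / (norm x)\<^sup>2" for v :: "real^2"
    by (simp add: power_divide)
  show "(norm (grad (separated g P e\<^sub>1) x))\<^sup>2 =
      ((g' L * poly P c)\<^sup>2 + (g L * (poly (pderiv P) c * s))\<^sup>2) / (norm x)\<^sup>2"
    unfolding gu sc norm_frame[OF fr(1)] by simp
  have "a *\<^sub>R grad (separated g P e\<^sub>1) x - rot (grad (separated g' Q e\<^sub>2) x) =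
      (1 / norm x) *\<^sub>R ((g' L * (a * poly P c + poly (pderiv Q) s * c)) *\<^sub>R e +
        (- (a * (g L * (poly (pderiv P) c * s)) + g'' L * poly Q s)) *\<^sub>R rot e)"
    unfolding gu gS by (simp add: vec_eq_iff forall_2 algebra_simps)
  then show "(norm (a *\<^sub>R grad (separated g P e\<^sub>1) x - rot (grad (separated g' Q e\<^sub>2) x)))\<^sup>2 =
      ((g' L * (a * poly P c + poly (pderiv Q) s * c))\<^sup>2 +
       (a * (g L * (poly (pderiv P) c * s)) + g'' L * poly Q s)\<^sup>2) / (norm x)\<^sup>2"
    by (simp only: sc norm_frame[OF fr(1)] power2_minus)
qed

section \<open>Passing to the limit in the angular approximation\<close>

lemma AE_not_hyperplane:
  fixes a :: "'a::euclidean_space"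
  assumes "a \<noteq> 0" shows "AE x in lebesgue. a \<bullet> x \<noteq> 0"
proof -
  have "{x. a \<bullet> x = 0} \<in> null_sets lebesgue"
    using negligible_hyperplane[of a 0] assms by (simp add: negligible_iff_null_sets)
  then show ?thesis using AE_not_in by fastforce
qed

lemma integral_limit_bounded:
  fixes f :: "nat \<Rightarrow> 'a::euclidean_space \<Rightarrow> real"
  assumes m: "\<And>n. meas_leb (f n)" and F: "meas_leb F"
    and bound: "\<And>n. AE x in lebesgue. \<bar>f n x\<bar> \<le> C * indicator (ball 0 1) x"
    and lim: "AE x in lebesgue. (\<lambda>n. f n x) \<longlonglongrightarrow> F x"
  shows "(\<lambda>n. LINT x|lebesgue. f n x) \<longlonglongrightarrow> (LINT x|lebesgue. F x)" "integrable lebesgue F"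
proof -
  have "integrable lebesgue (indicat_real (ball (0::'a) 1))"
    using emeasure_lborel_ball_finite[of "0::'a" 1] by (simp add: integrable_indicator_iff)
  then have i: "integrable lebesgue (\<lambda>x::'a. C * indicat_real (ball 0 1) x)" by simp
  show "(\<lambda>n. LINT x|lebesgue. f n x) \<longlonglongrightarrow> (LINT x|lebesgue. F x)"
    by (rule integral_dominated_convergence[OF F m i lim]) (use bound in simp)
  show "integrable lebesgue F"
    by (rule integrable_dominated_convergence[OF F m i lim]) (use bound in simp)
qed

text \<open>For a point \<open>(c, s)\<close> of the unit circle, \<open>\<bar>arcsin c\<bar>\<close> and \<open>\<bar>arcsin s\<bar>\<close> are its angles to
the second and to the first coordinate axis.\<close>

lemma arcsin_complementary:
  assumes "c\<^sup>2 + s\<^sup>2 = (1::real)"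
  shows "\<bar>arcsin s\<bar> = pi / 2 - \<bar>arcsin c\<bar>" "cos (arcsin c) = \<bar>s\<bar>" "\<bar>c\<bar> \<le> 1"
proof -
  have "c\<^sup>2 \<le> 1" "s\<^sup>2 \<le> 1" using assms zero_le_power2[of c] zero_le_power2[of s] by linarith+
  then have c: "c\<^sup>2 \<le> 1\<^sup>2" "s\<^sup>2 \<le> 1\<^sup>2" by simp_all
  show c1: "\<bar>c\<bar> \<le> 1" using c(1) abs_le_square_iff[of c 1] by simp
  have s1: "\<bar>s\<bar> \<le> 1" using c(2) abs_le_square_iff[of s 1] by simp
  have "1 - c\<^sup>2 = s\<^sup>2" using assms by simp
  then show cc: "cos (arcsin c) = \<bar>s\<bar>" using c1 by (simp add: cos_arcsin abs_le_iff)
  have ab: "\<bar>arcsin t\<bar> = arcsin \<bar>t\<bar>" if "\<bar>t\<bar> \<le> 1" for t :: real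
  proof (cases "0 \<le> t")
    case True
    then have "0 \<le> arcsin t" using arcsin_le_arcsin[of 0 t] that by simp
    then show ?thesis using True by simp
  next
    case False
    then have "0 \<le> arcsin (- t)" using arcsin_le_arcsin[of 0 "- t"] that by simp
    then show ?thesis using False that by (simp add: arcsin_minus)
  qed
  have bd: "- (pi / 2) \<le> arcsin c" "arcsin c \<le> pi / 2"
    using arcsin_bounded[of c] c1 by auto
  have "sin (pi / 2 - \<bar>arcsin c\<bar>) = \<bar>s\<bar>" using cc by (simp add: sin_diff)
  then have "arcsin \<bar>s\<bar> = arcsin (sin (pi / 2 - \<bar>arcsin c\<bar>))" by simp
  also have "\<dots> = pi / 2 - \<bar>arcsin c\<bar>" using bd pi_gt_zero by (intro arcsin_sin) linarith+
  finally show "\<bar>arcsin s\<bar> = pi / 2 - \<bar>arcsin c\<bar>" using ab[OF s1] by simp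
qed


lemma compact_support_derivative:
  fixes g g' :: "real \<Rightarrow> real"
  assumes d: "\<And>t. (g has_real_derivative g' t) (at t)" and z: "\<And>t. t \<notin> {t1..t2} \<Longrightarrow> g t = 0"
    and t: "t \<notin> {t1..t2}"
  shows "g' t = 0"
proof -
  have "((\<lambda>_. 0) has_real_derivative g' t) (at t)"
    by (rule has_field_derivative_transform_within_open[OF d, of "- {t1..t2}"]) (use z t in auto)
  then show ?thesis using DERIV_unique[OF _ DERIV_const] by blast
qed

lemma compact_support_bounded:
  fixes g :: "real \<Rightarrow> real"
  assumes "continuous_on UNIV g" and z: "\<And>t. t \<notin> {t1..t2} \<Longrightarrow> g t = 0"
  shows "\<exists>K>0. \<forall>t. \<bar>g t\<bar> \<le> K"
proof -
  have "compact (g ` {t1..t2})"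
    using assms(1) by (intro compact_continuous_image) (auto intro: continuous_on_subset)
  then obtain K where K: "K > 0" "\<forall>y\<in>g ` {t1..t2}. norm y \<le> K"
    using compact_imp_bounded bounded_pos by metis
  have "\<bar>g t\<bar> \<le> K" for t using K z[of t] by (cases "t \<in> {t1..t2}") auto
  then show ?thesis using K by blast
qed

lemma mult_bound:
  fixes x y a b :: real
  assumes "\<bar>x\<bar> \<le> a" "\<bar>y\<bar> \<le> b"
  shows "\<bar>x * y\<bar> \<le> a * b"
  using mult_mono[OF assms] assms by (simp add: abs_mult)

abbreviation cos_angle :: "real^2 \<Rightarrow> real" where "cos_angle x \<equiv> (x \<bullet> e\<^sub>1) / norm x"
abbreviation sin_angle :: "real^2 \<Rightarrow> real" where "sin_angle x \<equiv> (x \<bullet> e\<^sub>2) / norm x"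

text \<open>The setting is the double sector where the angle to the first axis is less than \<open>\<beta>\<close>, with
\<open>u = g(ln r) \<Phi>(arcsin(x/r))\<close> and \<open>S = g'(ln r) \<Psi>(arcsin(y/r))\<close>. Both angular factors change their
formula on the rays bounding the sector, hence the complementary break points \<open>\<pi>/2 - \<beta>\<close> and \<open>\<beta>\<close>.
The conditions \<open>match\<close> are their continuity there; \<open>inner\<close> and \<open>outer\<close> say that
\<open>(1\<^sub>D - \<mu>) \<nabla>u = rot \<nabla>S\<close> inside and outside the sector as soon as \<open>g'' = - \<xi>\<^sup>2 g\<close>.\<close>

locale transmission =
  fixes \<beta> \<xi> \<mu> A B A' B' :: real
  assumes \<beta>: "0 < \<beta>" "\<beta> < pi / 2" and \<xi>: "0 < \<xi>" and \<mu>: "0 < \<mu>" "\<mu> < 1"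
    and match: "A * sinh (\<xi> * (pi / 2 - \<beta>)) = B * cosh (\<xi> * \<beta>)"
      "A' * sinh (\<xi> * \<beta>) = B' * cosh (\<xi> * (pi / 2 - \<beta>))"
    and inner: "(1 - \<mu>) * B = - (\<xi> * A')" and outer: "- \<mu> * A = \<xi> * B'"
    and nonzero: "A' \<noteq> 0" "B' \<noteq> 0"
begin

definition \<Phi> :: "real \<Rightarrow> real" where "\<Phi> = profile \<xi> (pi / 2 - \<beta>) A B"
definition \<Phi>' :: "real \<Rightarrow> real" where "\<Phi>' = profile' \<xi> (pi / 2 - \<beta>) A B"
definition \<Psi> :: "real \<Rightarrow> real" where "\<Psi> = profile \<xi> \<beta> A' B'"
definition \<Psi>' :: "real \<Rightarrow> real" where "\<Psi>' = profile' \<xi> \<beta> A' B'"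

lemma cos_beta_iff: "\<bar>c\<bar> \<le> 1 \<Longrightarrow> cos \<beta> < \<bar>c\<bar> \<longleftrightarrow> pi / 2 - \<beta> < \<bar>arcsin c\<bar>"
  "\<bar>c\<bar> \<le> 1 \<Longrightarrow> \<bar>c\<bar> = cos \<beta> \<longleftrightarrow> \<bar>arcsin c\<bar> = pi / 2 - \<beta>"
proof -
  assume c: "\<bar>c\<bar> \<le> 1"
  have bd: "\<bar>arcsin c\<bar> \<le> pi / 2" using arcsin_bounded[of c] c by (auto simp: abs_le_iff)
  have s: "sin \<bar>arcsin c\<bar> = \<bar>c\<bar>"
  proof (cases "0 \<le> arcsin c")
    case True
    then have "0 \<le> sin (arcsin c)" using bd by (intro sin_ge_zero) auto
    then show ?thesis using True c by (simp add: abs_le_iff)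
  next
    case False
    then have "0 \<le> sin (- arcsin c)" using bd by (intro sin_ge_zero) auto
    then show ?thesis using False c by (simp add: abs_le_iff)
  qed
  have cb: "cos \<beta> = sin (pi / 2 - \<beta>)" by (simp add: sin_diff)
  have "sin (pi / 2 - \<beta>) < sin \<bar>arcsin c\<bar> \<longleftrightarrow> pi / 2 - \<beta> < \<bar>arcsin c\<bar>"
    using bd \<beta> by (intro sin_mono_less_eq) auto
  then show "cos \<beta> < \<bar>c\<bar> \<longleftrightarrow> pi / 2 - \<beta> < \<bar>arcsin c\<bar>" using s cb by argo
  have "sin (pi / 2 - \<beta>) = sin \<bar>arcsin c\<bar> \<longleftrightarrow> pi / 2 - \<beta> = \<bar>arcsin c\<bar>"
  proof
    assume eq: "sin (pi / 2 - \<beta>) = sin \<bar>arcsin c\<bar>"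
    have "- (pi / 2) \<le> pi / 2 - \<beta>" "pi / 2 - \<beta> \<le> pi / 2" "- (pi / 2) \<le> \<bar>arcsin c\<bar>"
      using bd \<beta> by linarith+
    from sin_inj_pi[OF this bd eq] show "pi / 2 - \<beta> = \<bar>arcsin c\<bar>" .
  qed simp
  then show "\<bar>c\<bar> = cos \<beta> \<longleftrightarrow> \<bar>arcsin c\<bar> = pi / 2 - \<beta>" using s cb by argo
qed

text \<open>These are the two components of \<open>(1\<^sub>D - \<mu>) \<nabla>u = rot \<nabla>S\<close>, with \<open>g''\<close> replaced by \<open>- \<xi>\<^sup>2 g\<close>,
and with \<open>c = x/r\<close>, \<open>s = y/r\<close>. The signs come from \<open>cos(arcsin c) = \<bar>s\<bar>\<close>: differentiating through
the arcsine loses the sign of the other coordinate.\<close>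

lemma profile_identities:
  fixes c s :: real
  assumes cs: "c\<^sup>2 + s\<^sup>2 = 1" "c \<noteq> 0" "s \<noteq> 0" "\<bar>c\<bar> \<noteq> cos \<beta>"
  defines "a \<equiv> (if cos \<beta> < \<bar>c\<bar> then 1 - \<mu> else - \<mu>)"
  shows "a * \<Phi> (arcsin c) + sgn c * \<Psi>' (arcsin s) = 0"
    and "a * (sgn s * \<Phi>' (arcsin c)) = \<xi>\<^sup>2 * \<Psi> (arcsin s)"
proof -
  have cs': "s\<^sup>2 + c\<^sup>2 = 1" using cs(1) by simp
  note ac = arcsin_complementary[OF cs(1)] and as = arcsin_complementary[OF cs']
  define x where "x = arcsin c"
  define y where "y = arcsin s"
  have xy: "\<bar>y\<bar> = pi / 2 - \<bar>x\<bar>" "\<bar>x\<bar> = pi / 2 - \<bar>y\<bar>" using ac(1) by (simp_all add: x_def y_def)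
  have sg: "sgn c = sgn x" "sgn s = sgn y"
  proof -
    have "sgn t = sgn (arcsin t)" if "\<bar>t\<bar> \<le> 1" for t
      using that arcsin_less_arcsin[of 0 t] arcsin_less_arcsin[of t 0]
      by (cases t "0::real" rule: linorder_cases) (auto simp: abs_le_iff)
    then show "sgn c = sgn x" "sgn s = sgn y" using ac(3) as(3) by (auto simp: x_def y_def)
  qed
  have x0: "x \<noteq> 0" "y \<noteq> 0" using sg cs by (auto simp: sgn_if split: if_splits)
  have \<beta>': "0 < pi / 2 - \<beta>" using \<beta> by simp
  have m1: "A * sinh (\<xi> * (pi / 2 - \<beta>)) = B * cosh (\<xi> * (pi / 2 - (pi / 2 - \<beta>)))" using match(1) by simp
  note P1 = profile_values[OF \<beta>' m1] and P2 = profile_values[OF \<beta>(1) match(2)]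
  have "a * \<Phi> x + sgn x * \<Psi>' y = 0 \<and> a * (sgn y * \<Phi>' x) = \<xi>\<^sup>2 * \<Psi> y"
  proof (cases "cos \<beta> < \<bar>c\<bar>")
    case True
    then have big: "pi / 2 - \<beta> < \<bar>x\<bar>" using cos_beta_iff(1)[OF ac(3)] by (simp add: x_def)
    then have small: "\<bar>y\<bar> < \<beta>" using xy by linarith
    have a: "a = 1 - \<mu>" using True by (simp add: a_def)
    have "\<Phi> x = sgn x * (B * cosh (\<xi> * \<bar>y\<bar>))"
    proof (cases "0 < x")
      case True
      then show ?thesis using P1(2)[of x] big xy(1) by (simp add: \<Phi>_def)
    next
      case False
      then have "x \<le> - (pi / 2 - \<beta>)" "sgn x = -1" "\<bar>y\<bar> = pi / 2 + x" using big xy(1) x0 by auto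
      then show ?thesis using P1(3)[of x] by (simp add: \<Phi>_def)
    qed
    moreover have "\<Psi>' y = A' * \<xi> * cosh (\<xi> * \<bar>y\<bar>)"
      using small by (cases "0 \<le> y") (auto simp: \<Psi>'_def profile'_def)
    ultimately have "a * \<Phi> x + sgn x * \<Psi>' y = sgn x * cosh (\<xi> * \<bar>y\<bar>) * ((1 - \<mu>) * B + \<xi> * A')"
      by (simp add: a algebra_simps)
    moreover have "\<Phi>' x = - (B * \<xi> * sinh (\<xi> * \<bar>y\<bar>))"
      using big xy(1) by (simp add: \<Phi>'_def profile'_def)
    moreover have "\<Psi> y = A' * sinh (\<xi> * y)"
      using P2(1)[of y] small by (simp add: \<Psi>_def)
    moreover have "sinh (\<xi> * y) = sgn y * sinh (\<xi> * \<bar>y\<bar>)" by (cases "0 < y") (use x0 in auto)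
    ultimately have "a * \<Phi> x + sgn x * \<Psi>' y = sgn x * cosh (\<xi> * \<bar>y\<bar>) * ((1 - \<mu>) * B + \<xi> * A')"
      "a * (sgn y * \<Phi>' x) = - (sgn y * \<xi> * sinh (\<xi> * \<bar>y\<bar>) * ((1 - \<mu>) * B))"
      "\<xi>\<^sup>2 * \<Psi> y = sgn y * \<xi> * sinh (\<xi> * \<bar>y\<bar>) * (\<xi> * A')"
      by (simp_all add: a power2_eq_square algebra_simps)
    then show ?thesis using inner by simp
  next
    case False
    then have "\<bar>c\<bar> < cos \<beta>" using cs(4) by simp
    then have small: "\<bar>x\<bar> < pi / 2 - \<beta>"
      using cos_beta_iff[OF ac(3)] unfolding x_def by linarith
    then have big: "\<beta> < \<bar>y\<bar>" using xy by linarith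
    have a: "a = - \<mu>" using False by (simp add: a_def)
    have "\<Phi> x = A * sinh (\<xi> * x)"
      using P1(1)[of x] small by (simp add: \<Phi>_def)
    moreover have "sinh (\<xi> * x) = sgn x * sinh (\<xi> * \<bar>x\<bar>)" by (cases "0 < x") (use x0 in auto)
    moreover have "\<Psi>' y = - (B' * \<xi> * sinh (\<xi> * \<bar>x\<bar>))"
      using big xy(2) by (simp add: \<Psi>'_def profile'_def)
    moreover have "\<Phi>' x = A * \<xi> * cosh (\<xi> * \<bar>x\<bar>)"
      using small by (cases "0 \<le> x") (auto simp: \<Phi>'_def profile'_def)
    moreover have "\<Psi> y = sgn y * (B' * cosh (\<xi> * \<bar>x\<bar>))"
    proof (cases "0 < y")
      case True
      then show ?thesis using P2(2)[of y] big xy(2) by (simp add: \<Psi>_def)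
    next
      case False
      then have "y \<le> - \<beta>" "sgn y = -1" "\<bar>x\<bar> = pi / 2 + y" using big xy(2) x0 by auto
      then show ?thesis using P2(3)[of y] by (simp add: \<Psi>_def)
    qed
    ultimately have "a * \<Phi> x + sgn x * \<Psi>' y = sgn x * sinh (\<xi> * \<bar>x\<bar>) * (- \<mu> * A - \<xi> * B')"
      "a * (sgn y * \<Phi>' x) = sgn y * \<xi> * cosh (\<xi> * \<bar>x\<bar>) * (- \<mu> * A)"
      "\<xi>\<^sup>2 * \<Psi> y = sgn y * \<xi> * cosh (\<xi> * \<bar>x\<bar>) * (\<xi> * B')"
      by (simp_all add: a power2_eq_square algebra_simps)
    then show ?thesis unfolding outer by simp
  qed
  then show "a * \<Phi> (arcsin c) + sgn c * \<Psi>' (arcsin s) = 0"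
    and "a * (sgn s * \<Phi>' (arcsin c)) = \<xi>\<^sup>2 * \<Psi> (arcsin s)"
    using sg by (simp_all add: x_def y_def)
qed

text \<open>The energy of \<open>u\<close> will be bounded below by an integral of \<open>\<Psi>\<^sup>2\<close>, which has to be positive.\<close>

lemma \<Psi>_nonzero:
  assumes "\<bar>s\<bar> \<le> 1" "s \<noteq> 0"
  shows "\<Psi> (arcsin s) \<noteq> 0"
proof -
  have "sin (arcsin s) = s" using assms by (simp add: abs_le_iff)
  then have y0: "arcsin s \<noteq> 0" using assms(2) by (metis sin_zero)
  note P2 = profile_values[OF \<beta>(1) match(2)]
  consider "\<bar>arcsin s\<bar> \<le> \<beta>" | "\<beta> \<le> arcsin s" | "arcsin s \<le> - \<beta>" by linarith
  then show ?thesis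
    by cases (use P2[of "arcsin s"] y0 nonzero \<xi> in \<open>auto simp: \<Psi>_def\<close>)
qed

text \<open>The excluded points lie on the axes and on the lines bounding the sector, where the
profiles need not be differentiable.\<close>

lemma AE_generic: "AE x in lebesgue. x \<noteq> 0 \<and> cos_angle x \<noteq> 0 \<and> sin_angle x \<noteq> 0 \<and> \<bar>cos_angle x\<bar> \<noteq> cos \<beta>"
proof -
  let ?p = "sin \<beta> *\<^sub>R e\<^sub>1 - cos \<beta> *\<^sub>R e\<^sub>2" and ?q = "sin \<beta> *\<^sub>R e\<^sub>1 + cos \<beta> *\<^sub>R e\<^sub>2"
  have sb: "sin \<beta> \<noteq> 0" using sin_gt_zero[of \<beta>] \<beta> by simp
  have nz: "e\<^sub>1 \<noteq> 0" "e\<^sub>2 \<noteq> 0" "?p \<noteq> 0" "?q \<noteq> 0"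
    using sb by (auto simp: vec_eq_iff forall_2 axis_def)
  have "AE x in lebesgue. e\<^sub>1 \<bullet> x \<noteq> 0" "AE x in lebesgue. e\<^sub>2 \<bullet> x \<noteq> 0"
    "AE x in lebesgue. ?p \<bullet> x \<noteq> 0" "AE x in lebesgue. ?q \<bullet> x \<noteq> 0"
    by (intro AE_not_hyperplane nz)+
  then show ?thesis
  proof eventually_elim
    case (elim x)
    have x: "x \<noteq> 0" using elim(1) by auto
    have "\<bar>cos_angle x\<bar> \<noteq> cos \<beta>"
    proof
      assume "\<bar>cos_angle x\<bar> = cos \<beta>"
      then have c2: "(cos_angle x)\<^sup>2 = (cos \<beta>)\<^sup>2" by (metis power2_abs)
      moreover have "(cos_angle x)\<^sup>2 + (sin_angle x)\<^sup>2 = 1" by (rule polar_frame(2)[OF x])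
      ultimately have s2: "(sin_angle x)\<^sup>2 = (sin \<beta>)\<^sup>2" using sin_cos_squared_add[of \<beta>] by linarith
      have "x \<bullet> e\<^sub>1 = norm x * cos_angle x" "x \<bullet> e\<^sub>2 = norm x * sin_angle x" using x by auto
      then have "(?p \<bullet> x) * (?q \<bullet> x) =
          (norm x)\<^sup>2 * ((sin \<beta>)\<^sup>2 * (cos_angle x)\<^sup>2 - (cos \<beta>)\<^sup>2 * (sin_angle x)\<^sup>2)"
        by (simp add: inner_simps inner_commute[of _ x] power2_eq_square algebra_simps)
      also have "\<dots> = 0" by (simp add: c2 s2)
      finally show False using elim by simp
    qed
    then show ?case using elim x by (simp add: inner_commute)
  qed
qed

text \<open>The functions \<open>g(ln r) \<Phi>\<close> and \<open>g'(ln r) \<Psi>\<close> are only Lipschitz, but with polynomial angular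
factors they are test functions. Everything is supported in one annulus, where \<open>1/r\<^sup>2\<close> is bounded,
so energy and defect converge. By the identities above, the limit of the defect sees only
\<open>(\<xi>\<^sup>2 g + g'') \<Psi>\<close>. The energy is bounded below through its angular part: \<open>\<bar>1\<^sub>D - \<mu>\<bar> \<le> 1\<close> and
\<open>(1\<^sub>D - \<mu>) \<Phi>' = \<plusminus>\<xi>\<^sup>2 \<Psi>\<close>.\<close>

proposition smooth_approximation:
  assumes g: "smooth_on UNIV g"
    and d1: "\<And>t. (g has_real_derivative g' t) (at t)" and d2: "\<And>t. (g' has_real_derivative g'' t) (at t)"
    and g': "smooth_on UNIV g'" "smooth_on UNIV g''"
    and supp: "\<And>t. t \<notin> {t1..t2} \<Longrightarrow> g t = 0" and t2: "t2 < 0" "exp t2 < \<rho>"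
    and D: "D \<in> sets lebesgue" "\<And>x. x \<in> ball 0 \<rho> \<Longrightarrow> x \<noteq> 0 \<Longrightarrow> x \<in> D \<longleftrightarrow> cos \<beta> < \<bar>cos_angle x\<bar>"
    and e: "0 < e"
  obtains u S where "test_function (ball 0 \<rho>) u" "test_function (ball 0 \<rho>) S"
    "energy u \<ge> \<xi>^4 * (LINT x|lebesgue. (g (ln (norm x)) * \<Psi> (arcsin (sin_angle x)))\<^sup>2 / (norm x)\<^sup>2) - e"
    "defect D \<mu> u S \<le>
      (LINT x|lebesgue. ((\<xi>\<^sup>2 * g (ln (norm x)) + g'' (ln (norm x))) * \<Psi> (arcsin (sin_angle x)))\<^sup>2 / (norm x)\<^sup>2) + e"
    "integrable lebesgue (\<lambda>x. (g (ln (norm x)) * \<Psi> (arcsin (sin_angle x)))\<^sup>2 / (norm x)\<^sup>2)"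
proof -
  have \<beta>': "0 < pi / 2 - \<beta>" "pi / 2 - \<beta> < pi / 2" using \<beta> by auto
  obtain P K1 where P: "\<And>n c. c \<in> {-1..1} \<Longrightarrow> \<bar>poly (P n) c\<bar> \<le> K1"
    "\<And>n c. c \<in> {-1..1} \<Longrightarrow> \<bar>poly (pderiv (P n)) c\<bar> \<le> K1"
    "\<And>\<theta>. \<bar>\<theta>\<bar> \<le> pi / 2 \<Longrightarrow> (\<lambda>n. poly (P n) (sin \<theta>)) \<longlonglongrightarrow> \<Phi> \<theta>"
    "\<And>\<theta>. \<bar>\<theta>\<bar> < pi / 2 \<Longrightarrow> \<bar>\<theta>\<bar> \<noteq> pi / 2 - \<beta> \<Longrightarrow>
      (\<lambda>n. poly (pderiv (P n)) (sin \<theta>) * cos \<theta>) \<longlonglongrightarrow> \<Phi>' \<theta>"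
    unfolding \<Phi>_def \<Phi>'_def using profile_approximation[OF \<beta>' \<xi>, of A B] by blast
  obtain Q K2 where Q: "\<And>n c. c \<in> {-1..1} \<Longrightarrow> \<bar>poly (Q n) c\<bar> \<le> K2"
    "\<And>n c. c \<in> {-1..1} \<Longrightarrow> \<bar>poly (pderiv (Q n)) c\<bar> \<le> K2"
    "\<And>\<theta>. \<bar>\<theta>\<bar> \<le> pi / 2 \<Longrightarrow> (\<lambda>n. poly (Q n) (sin \<theta>)) \<longlonglongrightarrow> \<Psi> \<theta>"
    "\<And>\<theta>. \<bar>\<theta>\<bar> < pi / 2 \<Longrightarrow> \<bar>\<theta>\<bar> \<noteq> \<beta> \<Longrightarrow>
      (\<lambda>n. poly (pderiv (Q n)) (sin \<theta>) * cos \<theta>) \<longlonglongrightarrow> \<Psi>' \<theta>"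
    unfolding \<Psi>_def \<Psi>'_def using profile_approximation[OF \<beta> \<xi>, of A' B'] by blast
  have supp1: "g' t = 0" if "t \<notin> {t1..t2}" for t by (rule compact_support_derivative[OF d1 supp that])
  have supp2: "g'' t = 0" if "t \<notin> {t1..t2}" for t by (rule compact_support_derivative[OF d2 supp1 that])
  obtain G0 G1 G2 where G: "0 < G0" "\<And>t. \<bar>g t\<bar> \<le> G0" "0 < G1" "\<And>t. \<bar>g' t\<bar> \<le> G1" "0 < G2" "\<And>t. \<bar>g'' t\<bar> \<le> G2"
    using compact_support_bounded[OF smooth_on_continuous_on[OF g] supp]
      compact_support_bounded[OF smooth_on_continuous_on[OF g'(1)] supp1]
      compact_support_bounded[OF smooth_on_continuous_on[OF g'(2)] supp2] by metis
  define u where "u n = separated g (P n) e\<^sub>1" for n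
  define S where "S n = separated g' (Q n) e\<^sub>2" for n
  have tu: "test_function (ball 0 \<rho>) (u n)" for n
    unfolding u_def by (rule test_separated[OF g supp t2])
  have tS: "test_function (ball 0 \<rho>) (S n)" for n
    unfolding S_def by (rule test_separated[OF g'(1) supp1 t2])
  let ?L = "\<lambda>x::real^2. ln (norm x)"
  let ?\<psi> = "\<lambda>x. \<Psi> (arcsin (sin_angle x))" and ?\<phi> = "\<lambda>x. \<Phi> (arcsin (cos_angle x))"
  let ?\<psi>' = "\<lambda>x. \<Psi>' (arcsin (sin_angle x))" and ?\<phi>' = "\<lambda>x. \<Phi>' (arcsin (cos_angle x))"
  have ang: "cos_angle x \<in> {-1..1}" "sin_angle x \<in> {-1..1}" "\<bar>cos_angle x\<bar> \<le> 1" "\<bar>sin_angle x\<bar> \<le> 1" for x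
  proof -
    have "\<bar>cos_angle x\<bar> \<le> 1 \<and> \<bar>sin_angle x\<bar> \<le> 1"
    proof (cases "x = 0")
      case False
      then have p: "(cos_angle x)\<^sup>2 + (sin_angle x)\<^sup>2 = 1" by (rule polar_frame(2))
      then have p': "(sin_angle x)\<^sup>2 + (cos_angle x)\<^sup>2 = 1" by simp
      show ?thesis using arcsin_complementary(3)[OF p] arcsin_complementary(3)[OF p'] by blast
    qed simp
    then show "cos_angle x \<in> {-1..1}" "sin_angle x \<in> {-1..1}" "\<bar>cos_angle x\<bar> \<le> 1" "\<bar>sin_angle x\<bar> \<le> 1"
      unfolding atLeastAtMost_iff by linarith+
  qed
  have mL: "g \<in> borel_measurable borel" "g'' \<in> borel_measurable borel"
    using smooth_on_continuous_on[OF g] smooth_on_continuous_on[OF g'(2)]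
    by (auto intro: borel_measurable_continuous_onI)
  have m\<psi> [measurable]: "?\<psi> \<in> borel_measurable borel"
  proof (rule borel_measurable_LIMSEQ_real)
    show "(\<lambda>n. poly (Q n) (sin_angle x)) \<longlonglongrightarrow> ?\<psi> x" for x
      using Q(3)[of "arcsin (sin_angle x)"] ang[of x] arcsin_bounded[of "sin_angle x"] by (auto simp: abs_le_iff)
    show "(\<lambda>x. poly (Q n) (sin_angle x)) \<in> borel_measurable borel" for n
      by (rule measurable_compose[of _ _ borel])
        (auto intro!: borel_measurable_continuous_onI continuous_intros)
  qed
  note [measurable] = mL
  let ?E = "\<lambda>x. (g (?L x) * ?\<psi> x)\<^sup>2 / (norm x)\<^sup>2"
  let ?R = "\<lambda>x. ((\<xi>\<^sup>2 * g (?L x) + g'' (?L x)) * ?\<psi> x)\<^sup>2 / (norm x)\<^sup>2"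
  have mE: "meas_leb ?E" and mR: "meas_leb ?R"
    by (intro measurable_completion; measurable)+
  define f where "f n x = (norm (grad (u n) x))\<^sup>2" for n x
  define h where "h n x = (norm ((indicator D x - \<mu>) *\<^sub>R grad (u n) x - rot (grad (S n) x)))\<^sup>2" for n x
  have mf: "meas_leb (f n)" for n
    unfolding f_def using grad_meas[OF tu[of n]] by measurable
  have mh: "meas_leb (h n)" for n
  proof -
    have [measurable]: "meas_leb (\<lambda>x. rot (grad (S n) x))"
      by (intro continuous_imp_meas_leb bounded_linear.continuous_on[OF bounded_linear_rot]
          continuous_on_grad[OF tS])
    note [measurable] = D(1) grad_meas[OF tu[of n]]
    show ?thesis unfolding h_def by measurable
  qed
  have f_eq: "f n x = ((g' (?L x) * poly (P n) (cos_angle x))\<^sup>2 +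
      (g (?L x) * (poly (pderiv (P n)) (cos_angle x) * sin_angle x))\<^sup>2) / (norm x)\<^sup>2" if "x \<noteq> 0" for n x
    unfolding f_def u_def by (rule pair_gradients(1)[OF d1 d2 that])
  have h_eq: "h n x = ((g' (?L x) * ((indicator D x - \<mu>) * poly (P n) (cos_angle x) + poly (pderiv (Q n)) (sin_angle x) * cos_angle x))\<^sup>2 +
      ((indicator D x - \<mu>) * (g (?L x) * (poly (pderiv (P n)) (cos_angle x) * sin_angle x)) + g'' (?L x) * poly (Q n) (sin_angle x))\<^sup>2) / (norm x)\<^sup>2"
    if "x \<noteq> 0" for n x
    unfolding h_def u_def S_def by (rule pair_gradients(2)[OF d1 d2 that])
  have off: "g (?L x) = 0 \<and> g' (?L x) = 0 \<and> g'' (?L x) = 0" if "?L x \<notin> {t1..t2}" for x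
    using supp supp1 supp2 that by blast
  have inball: "x \<in> ball 0 1 \<and> x \<in> ball 0 \<rho> \<and> 1 / (norm x)\<^sup>2 \<le> exp (- 2 * t1)"
    if "x \<noteq> 0" "?L x \<in> {t1..t2}" for x
  proof -
    have n: "norm x = exp (?L x)" using that by simp
    then have "norm x \<le> exp t2" using that by (metis atLeastAtMost_iff exp_le_cancel_iff)
    moreover from this have "norm x < 1" using t2(1) exp_less_one_iff[of t2] by linarith
    moreover have "1 / (norm x)\<^sup>2 = exp (- 2 * ?L x)"
      by (subst n) (simp add: exp_minus power2_eq_square inverse_eq_divide flip: exp_add)
    ultimately show ?thesis using that t2 by simp
  qed
  have K0: "0 \<le> K1" "0 \<le> K2" using P(1)[of 0 0] Q(1)[of 0 0] by auto
  have bnd: "\<bar>v\<bar> \<le> c * exp (- 2 * t1) * indicator (ball 0 1) x"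
    if x: "x \<noteq> 0" and v: "v = w / (norm x)\<^sup>2" and w: "0 \<le> w" "w \<le> c" and z: "?L x \<notin> {t1..t2} \<Longrightarrow> w = 0"
    for v w c :: real and x :: "real^2"
  proof (cases "?L x \<in> {t1..t2}")
    case True
    have "\<bar>v\<bar> = w * (1 / (norm x)\<^sup>2)" using w v by simp
    also have "\<dots> \<le> c * exp (- 2 * t1)" using inball[OF x True] w by (intro mult_mono) auto
    finally show ?thesis using inball[OF x True] by simp
  next
    case False
    then show ?thesis using z v w by simp
  qed
  have sq: "v\<^sup>2 \<le> k\<^sup>2" if "\<bar>v\<bar> \<le> k" for v k :: real
    using power_mono[OF that, of 2] by simp
  have Pb: "\<bar>poly (P n) (cos_angle x)\<bar> \<le> K1" "\<bar>poly (pderiv (P n)) (cos_angle x) * sin_angle x\<bar> \<le> K1 * 1" for n x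
    by (intro mult_bound P(1,2)[OF ang(1)] ang(4))+
  have Qb: "\<bar>poly (Q n) (sin_angle x)\<bar> \<le> K2" "\<bar>poly (pderiv (Q n)) (sin_angle x) * cos_angle x\<bar> \<le> K2 * 1" for n x
    by (intro mult_bound Q(1,2)[OF ang(2)] ang(3))+
  have f_bound: "\<bar>f n x\<bar> \<le> ((G1 * K1)\<^sup>2 + (G0 * (K1 * 1))\<^sup>2) * exp (- 2 * t1) * indicator (ball 0 1) x"
    if "x \<noteq> 0" for n x
  proof (rule bnd[OF that f_eq[OF that]])
    show "(g' (?L x) * poly (P n) (cos_angle x))\<^sup>2 +
      (g (?L x) * (poly (pderiv (P n)) (cos_angle x) * sin_angle x))\<^sup>2 \<le> (G1 * K1)\<^sup>2 + (G0 * (K1 * 1))\<^sup>2"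
      by (intro add_mono sq mult_bound[OF G(4) Pb(1)] mult_bound[OF G(2) Pb(2)])
  qed (use off in auto)
  have a1: "\<bar>indicator D x - \<mu>\<bar> \<le> 1" for x using \<mu> by (auto simp: indicator_def)
  have h_bound: "\<bar>h n x\<bar> \<le> ((G1 * (1 * K1 + K2 * 1))\<^sup>2 + (1 * (G0 * (K1 * 1)) + G2 * K2)\<^sup>2) * exp (- 2 * t1) * indicator (ball 0 1) x"
    if "x \<noteq> 0" for n x
  proof (rule bnd[OF that h_eq[OF that]])
    have 1: "\<bar>(indicator D x - \<mu>) * poly (P n) (cos_angle x) + poly (pderiv (Q n)) (sin_angle x) * cos_angle x\<bar> \<le> 1 * K1 + K2 * 1"
      by (intro order_trans[OF abs_triangle_ineq] add_mono mult_bound[OF a1 Pb(1)] Qb(2))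
    have 2: "\<bar>(indicator D x - \<mu>) * (g (?L x) * (poly (pderiv (P n)) (cos_angle x) * sin_angle x)) + g'' (?L x) * poly (Q n) (sin_angle x)\<bar>
        \<le> 1 * (G0 * (K1 * 1)) + G2 * K2"
      by (intro order_trans[OF abs_triangle_ineq] add_mono mult_bound[OF a1] mult_bound[OF G(2)] mult_bound[OF G(6)] Pb(2) Qb(1))
    show "(g' (?L x) * ((indicator D x - \<mu>) * poly (P n) (cos_angle x) + poly (pderiv (Q n)) (sin_angle x) * cos_angle x))\<^sup>2 +
      ((indicator D x - \<mu>) * (g (?L x) * (poly (pderiv (P n)) (cos_angle x) * sin_angle x)) + g'' (?L x) * poly (Q n) (sin_angle x))\<^sup>2
      \<le> (G1 * (1 * K1 + K2 * 1))\<^sup>2 + (1 * (G0 * (K1 * 1)) + G2 * K2)\<^sup>2"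
      by (intro add_mono sq mult_bound[OF G(4) 1] 2)
  qed (use off in auto)
  have nz: "AE x::real^2 in lebesgue. x \<noteq> 0" using AE_generic by eventually_elim simp
  have lims: "(\<lambda>n. poly (P n) (cos_angle x)) \<longlonglongrightarrow> ?\<phi> x"
      "(\<lambda>n. poly (pderiv (P n)) (cos_angle x) * sin_angle x) \<longlonglongrightarrow> sgn (sin_angle x) * ?\<phi>' x"
      "(\<lambda>n. poly (Q n) (sin_angle x)) \<longlonglongrightarrow> ?\<psi> x"
      "(\<lambda>n. poly (pderiv (Q n)) (sin_angle x) * cos_angle x) \<longlonglongrightarrow> sgn (cos_angle x) * ?\<psi>' x"
    if x: "x \<noteq> 0" "cos_angle x \<noteq> 0" "sin_angle x \<noteq> 0" "\<bar>cos_angle x\<bar> \<noteq> cos \<beta>" for x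
  proof -
    let ?c = "cos_angle x" and ?s = "sin_angle x"
    have cs: "?c\<^sup>2 + ?s\<^sup>2 = 1" "?s\<^sup>2 + ?c\<^sup>2 = 1" using polar_frame(2)[OF x(1)] by simp_all
    note ac = arcsin_complementary[OF cs(1)] and as = arcsin_complementary[OF cs(2)]
    have c: "sin (arcsin ?c) = ?c" "sin (arcsin ?s) = ?s"
      by (rule sin_arcsin; use ang[of x] in \<open>unfold atLeastAtMost_iff, blast\<close>)+
    have nzero: "arcsin ?c \<noteq> 0" "arcsin ?s \<noteq> 0"
      using x(2,3) c by (metis sin_zero)+
    have "\<bar>arcsin ?c\<bar> \<noteq> pi / 2 - \<beta>" using cos_beta_iff(2)[OF ac(3)] x(4) by blast
    then have ne: "\<bar>arcsin ?s\<bar> \<noteq> \<beta>" "\<bar>arcsin ?c\<bar> \<noteq> pi / 2 - \<beta>" using ac(1) by auto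
    have lt: "\<bar>arcsin ?c\<bar> < pi / 2" "\<bar>arcsin ?s\<bar> < pi / 2" using ac(1) nzero by auto
    show "(\<lambda>n. poly (P n) ?c) \<longlonglongrightarrow> ?\<phi> x" using P(3)[of "arcsin ?c"] lt c by simp
    show "(\<lambda>n. poly (Q n) ?s) \<longlonglongrightarrow> ?\<psi> x" using Q(3)[of "arcsin ?s"] lt c by simp
    have sg: "sgn t * (q * \<bar>t\<bar>) = q * t" for q t :: real by (auto simp: sgn_if)
    have "(\<lambda>n. poly (pderiv (P n)) ?c * \<bar>?s\<bar>) \<longlonglongrightarrow> ?\<phi>' x"
      using P(4)[OF lt(1) ne(2)] c(1) ac(2) by simp
    from tendsto_mult_left[OF this, of "sgn ?s"]
    show "(\<lambda>n. poly (pderiv (P n)) ?c * ?s) \<longlonglongrightarrow> sgn ?s * ?\<phi>' x"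
      by (simp only: sg)
    have "(\<lambda>n. poly (pderiv (Q n)) ?s * \<bar>?c\<bar>) \<longlonglongrightarrow> ?\<psi>' x"
      using Q(4)[OF lt(2) ne(1)] c(2) as(2) by simp
    from tendsto_mult_left[OF this, of "sgn ?c"]
    show "(\<lambda>n. poly (pderiv (Q n)) ?s * ?c) \<longlonglongrightarrow> sgn ?c * ?\<psi>' x"
      by (simp only: sg)
  qed
  have a_eq: "indicator D x - \<mu> = (if cos \<beta> < \<bar>cos_angle x\<bar> then 1 - \<mu> else - \<mu>)"
    if "x \<noteq> 0" "?L x \<in> {t1..t2}" for x
    using D(2)[of x] inball[OF that] that by simp
  define F where "F x = lim (\<lambda>n. f n x)" for x
  have mF: "meas_leb F" unfolding F_def[abs_def] by (rule borel_measurable_lim_metric[OF mf])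
  have fl: "(\<lambda>n. f n x) \<longlonglongrightarrow> ((g' (?L x) * ?\<phi> x)\<^sup>2 + (g (?L x) * (sgn (sin_angle x) * ?\<phi>' x))\<^sup>2) / (norm x)\<^sup>2"
    if x: "x \<noteq> 0" "cos_angle x \<noteq> 0" "sin_angle x \<noteq> 0" "\<bar>cos_angle x\<bar> \<noteq> cos \<beta>" for x
    unfolding f_eq[OF x(1)] using x(1) by (intro tendsto_intros lims x) auto
  have Flim: "AE x in lebesgue. (\<lambda>n. f n x) \<longlonglongrightarrow> F x"
    using AE_generic
  proof eventually_elim
    case (elim x)
    then have x: "x \<noteq> 0" "cos_angle x \<noteq> 0" "sin_angle x \<noteq> 0" "\<bar>cos_angle x\<bar> \<noteq> cos \<beta>" by auto
    show ?case unfolding F_def limI[OF fl[OF x]] by (rule fl[OF x])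
  qed
  have Fge: "AE x in lebesgue. \<xi>^4 * ?E x \<le> F x"
    using AE_generic
  proof eventually_elim
    case (elim x)
    then have x: "x \<noteq> 0" "cos_angle x \<noteq> 0" "sin_angle x \<noteq> 0" "\<bar>cos_angle x\<bar> \<noteq> cos \<beta>" by auto
    have F: "F x = ((g' (?L x) * ?\<phi> x)\<^sup>2 + (g (?L x) * (sgn (sin_angle x) * ?\<phi>' x))\<^sup>2) / (norm x)\<^sup>2"
      unfolding F_def by (rule limI[OF fl[OF x]])
    show ?case
    proof (cases "?L x \<in> {t1..t2}")
      case True
      let ?a = "indicator D x - \<mu>"
      have id: "?a * (sgn (sin_angle x) * ?\<phi>' x) = \<xi>\<^sup>2 * ?\<psi> x"
        unfolding a_eq[OF x(1) True] by (rule profile_identities(2)[OF polar_frame(2)[OF x(1)] x(2-4)])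
      have "\<xi>^4 * (g (?L x) * ?\<psi> x)\<^sup>2 = (g (?L x) * (\<xi>\<^sup>2 * ?\<psi> x))\<^sup>2"
        by (simp add: power_mult_distrib power2_eq_square power4_eq_xxxx)
      also have "\<dots> = ?a\<^sup>2 * (g (?L x) * (sgn (sin_angle x) * ?\<phi>' x))\<^sup>2"
        unfolding id[symmetric] by (simp add: power_mult_distrib)
      also have "\<dots> \<le> 1 * (g (?L x) * (sgn (sin_angle x) * ?\<phi>' x))\<^sup>2"
        using sq[OF a1[of x]] by (intro mult_right_mono) auto
      also have "\<dots> \<le> (g' (?L x) * ?\<phi> x)\<^sup>2 + (g (?L x) * (sgn (sin_angle x) * ?\<phi>' x))\<^sup>2" by simp
      finally show ?thesis unfolding F by (simp add: divide_right_mono)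
    next
      case False
      then show ?thesis unfolding F using off by simp
    qed
  qed
  have fb: "AE x in lebesgue. \<bar>f n x\<bar> \<le> ((G1 * K1)\<^sup>2 + (G0 * (K1 * 1))\<^sup>2) * exp (- 2 * t1) * indicator (ball 0 1) x" for n
    using nz by eventually_elim (rule f_bound)
  have hb: "AE x in lebesgue. \<bar>h n x\<bar> \<le> ((G1 * (1 * K1 + K2 * 1))\<^sup>2 + (1 * (G0 * (K1 * 1)) + G2 * K2)\<^sup>2) * exp (- 2 * t1) * indicator (ball 0 1) x" for n
    using nz by eventually_elim (rule h_bound)
  note Fconv = integral_limit_bounded[OF mf mF fb Flim]
  have iE: "integrable lebesgue ?E"
  proof (rule Bochner_Integration.integrable_bound[OF _ mE])
    show "integrable lebesgue (\<lambda>x. F x / \<xi>^4)" using Fconv(2) by simp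
    show "AE x in lebesgue. norm (?E x) \<le> norm (F x / \<xi>^4)"
      using Fge
    proof eventually_elim
      case (elim x)
      then have "?E x \<le> F x / \<xi>^4" using \<xi> by (simp add: pos_le_divide_eq mult.commute)
      then show ?case by (smt (verit) divide_nonneg_nonneg real_norm_def zero_le_power2)
    qed
  qed
  have E_le: "\<xi>^4 * (LINT x|lebesgue. ?E x) \<le> (LINT x|lebesgue. F x)"
  proof -
    have "(LINT x|lebesgue. \<xi>^4 * ?E x) \<le> (LINT x|lebesgue. F x)"
      by (rule integral_mono_AE[OF integrable_mult_right Fconv(2) Fge]) (rule iE)
    then show ?thesis using Bochner_Integration.integral_mult_right_zero[of lebesgue "\<xi>^4" ?E] by argo
  qed
  have hl: "AE x in lebesgue. (\<lambda>n. h n x) \<longlonglongrightarrow> ?R x"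
    using AE_generic
  proof eventually_elim
    case (elim x)
    then have x: "x \<noteq> 0" "cos_angle x \<noteq> 0" "sin_angle x \<noteq> 0" "\<bar>cos_angle x\<bar> \<noteq> cos \<beta>" by auto
    let ?a = "indicator D x - \<mu>"
    let ?l = "((g' (?L x) * (?a * ?\<phi> x + sgn (cos_angle x) * ?\<psi>' x))\<^sup>2 +
      (?a * (g (?L x) * (sgn (sin_angle x) * ?\<phi>' x)) + g'' (?L x) * ?\<psi> x)\<^sup>2) / (norm x)\<^sup>2"
    have "(\<lambda>n. h n x) \<longlonglongrightarrow> ?l"
      unfolding h_eq[OF x(1)] using x(1) by (intro tendsto_intros lims x) auto
    also have "?l = ?R x"
    proof (cases "?L x \<in> {t1..t2}")
      case True
      note pid = profile_identities[OF polar_frame(2)[OF x(1)] x(2-4), folded a_eq[OF x(1) True]]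
      have "?a * (g (?L x) * (sgn (sin_angle x) * ?\<phi>' x)) = g (?L x) * (\<xi>\<^sup>2 * ?\<psi> x)"
        unfolding pid(2)[symmetric] by simp
      then show ?thesis unfolding pid(1) by (simp add: algebra_simps)
    next
      case False
      then show ?thesis using off by simp
    qed
    finally show ?case .
  qed
  note Rconv = integral_limit_bounded(1)[OF mh mR hb hl]
  have ev1: "\<forall>\<^sub>F n in sequentially. (LINT x|lebesgue. F x) - e < (LINT x|lebesgue. f n x)"
    by (rule order_tendstoD(1)[OF Fconv(1)]) (use e in simp)
  have ev2: "\<forall>\<^sub>F n in sequentially. (LINT x|lebesgue. h n x) < (LINT x|lebesgue. ?R x) + e"
    by (rule order_tendstoD(2)[OF Rconv]) (use e in simp)
  obtain n where n: "(LINT x|lebesgue. F x) - e < (LINT x|lebesgue. f n x)"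
    "(LINT x|lebesgue. h n x) < (LINT x|lebesgue. ?R x) + e"
    using eventually_happens[OF eventually_conj[OF ev1 ev2]] by auto
  show thesis
  proof (rule that[OF tu[of n] tS[of n] _ _ iE])
    show "\<xi>^4 * (LINT x|lebesgue. ?E x) - e \<le> energy (u n)"
      using n(1) E_le unfolding energy_def f_def by linarith
    show "defect D \<mu> (u n) (S n) \<le> (LINT x|lebesgue. ?R x) + e"
      using n(2) unfolding defect_def h_def by linarith
  qed
qed

end


section \<open>Radial cut-offs\<close>

lemma smooth_step_derivatives:
  obtains s' s'' :: "real \<Rightarrow> real" and K where
    "\<And>t. (smooth_step has_real_derivative s' t) (at t)" "\<And>t. (s' has_real_derivative s'' t) (at t)"
    "\<And>t. t \<notin> {0..1} \<Longrightarrow> s' t = 0 \<and> s'' t = 0" "0 < K" "\<And>t. \<bar>s' t\<bar> \<le> K" "\<And>t. \<bar>s'' t\<bar> \<le> K"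
proof -
  obtain s' where s': "smooth_on UNIV s'" "\<And>t. (smooth_step has_real_derivative s' t) (at t)"
    using smooth_real_derivative[OF smooth_step_smooth] by blast
  obtain s'' where s'': "smooth_on UNIV s''" "\<And>t. (s' has_real_derivative s'' t) (at t)"
    using smooth_real_derivative[OF s'(1)] by blast
  have z1: "s' t = 0" if t: "t \<notin> {0..1}" for t
  proof -
    have "((\<lambda>_. smooth_step t) has_real_derivative s' t) (at t)"
    proof (cases "t < 0")
      case True
      show ?thesis
        by (rule has_field_derivative_transform_within_open[OF s'(2), of "{..<0}"]) (use True in auto)
    next
      case False
      show ?thesis
        by (rule has_field_derivative_transform_within_open[OF s'(2), of "{1<..}"]) (use t False in auto)
    qed
    then show ?thesis using DERIV_unique[OF _ DERIV_const] by blast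
  qed
  have z2: "s'' t = 0" if "t \<notin> {0..1}" for t
    by (rule compact_support_derivative[OF s''(2) z1 that])
  obtain K1 where K1: "K1 > 0" "\<forall>t. \<bar>s' t\<bar> \<le> K1"
    using compact_support_bounded[OF smooth_on_continuous_on[OF s'(1)] z1] by blast
  obtain K2 where K2: "K2 > 0" "\<forall>t. \<bar>s'' t\<bar> \<le> K2"
    using compact_support_bounded[OF smooth_on_continuous_on[OF s''(1)] z2] by blast
  show thesis
  proof (rule that[OF s'(2) s''(2)])
    show "\<bar>s' t\<bar> \<le> K1 + K2" "\<bar>s'' t\<bar> \<le> K1 + K2" for t
      using K1(1) K1(2)[rule_format, of t] K2(1) K2(2)[rule_format, of t] by linarith+
  qed (use z1 z2 K1 K2 in auto)
qed

text \<open>In the variable \<open>y = - \<omega> t\<close> the function \<open>g\<close> is \<open>cos(\<xi> t)\<close> times a plateau that rises on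
\<open>[m, m + 1]\<close> and falls on \<open>[M - 1, M]\<close>. Only the derivatives of the plateau contribute to
\<open>\<xi>\<^sup>2 g + g''\<close>. They do not change when the plateau is lengthened, so \<open>C\<close> is independent of \<open>m\<close> and
\<open>M\<close>.\<close>

proposition radial_cutoff:
  fixes \<omega> \<xi> :: real
  assumes \<omega>: "0 < \<omega>" and \<xi>: "0 < \<xi>"
  obtains C where "0 < C"
    "\<And>m M :: real. m + 2 \<le> M \<Longrightarrow> \<exists>g g' g''. smooth_on UNIV g \<and> smooth_on UNIV g' \<and> smooth_on UNIV g'' \<and>
      (\<forall>t. (g has_real_derivative g' t) (at t)) \<and> (\<forall>t. (g' has_real_derivative g'' t) (at t)) \<and>
      (\<forall>t. t \<notin> {- (M / \<omega>)..- (m / \<omega>)} \<longrightarrow> g t = 0) \<and>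
      (\<forall>t. - (\<omega> * t) \<in> {m + 1..M - 1} \<longrightarrow> g t = cos (\<xi> * t)) \<and>
      (\<forall>t. \<bar>\<xi>\<^sup>2 * g t + g'' t\<bar> \<le> C) \<and>
      (\<forall>t. - (\<omega> * t) \<notin> {m..m + 1} \<union> {M - 1..M} \<longrightarrow> \<xi>\<^sup>2 * g t + g'' t = 0)"
proof -
  obtain s' s'' K where s': "\<And>t. (smooth_step has_real_derivative s' t) (at t)"
    and s'': "\<And>t. (s' has_real_derivative s'' t) (at t)"
    and z: "\<And>t. t \<notin> {0..1} \<Longrightarrow> s' t = 0 \<and> s'' t = 0"
    and K: "0 < K" "\<And>t. \<bar>s' t\<bar> \<le> K" "\<And>t. \<bar>s'' t\<bar> \<le> K"
    by (rule smooth_step_derivatives) blast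
  define C where "C = 2 * \<xi> * (\<omega> * (2 * K)) + \<omega>\<^sup>2 * (2 * K + 2 * (K * K))"
  have "0 < C"
    unfolding C_def by (intro add_pos_pos mult_pos_pos zero_less_power) (use \<omega> \<xi> K(1) in auto)
  moreover have "\<exists>g g' g''. smooth_on UNIV g \<and> smooth_on UNIV g' \<and> smooth_on UNIV g'' \<and>
      (\<forall>t. (g has_real_derivative g' t) (at t)) \<and> (\<forall>t. (g' has_real_derivative g'' t) (at t)) \<and>
      (\<forall>t. t \<notin> {- (M / \<omega>)..- (m / \<omega>)} \<longrightarrow> g t = 0) \<and>
      (\<forall>t. - (\<omega> * t) \<in> {m + 1..M - 1} \<longrightarrow> g t = cos (\<xi> * t)) \<and>
      (\<forall>t. \<bar>\<xi>\<^sup>2 * g t + g'' t\<bar> \<le> C) \<and>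
      (\<forall>t. - (\<omega> * t) \<notin> {m..m + 1} \<union> {M - 1..M} \<longrightarrow> \<xi>\<^sup>2 * g t + g'' t = 0)" if mM: "m + 2 \<le> M" for m M :: real
  proof -
    define p where "p t = - \<omega> * t - m" for t
    define q where "q t = M + \<omega> * t" for t
    define k where "k t = smooth_step (p t) * smooth_step (q t)" for t
    define k' where "k' t = \<omega> * (smooth_step (p t) * s' (q t) - s' (p t) * smooth_step (q t))" for t
    define k'' where "k'' t = \<omega>\<^sup>2 * (s'' (p t) * smooth_step (q t) + smooth_step (p t) * s'' (q t) - 2 * (s' (p t) * s' (q t)))" for t
    define g where "g t = cos (\<xi> * t) * k t" for t
    have dp: "(p has_real_derivative - \<omega>) (at t)" and dq: "(q has_real_derivative \<omega>) (at t)" for t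
      unfolding p_def q_def by (auto intro!: derivative_eq_intros)
    have dk: "(k has_real_derivative k' t) (at t)" for t
      unfolding k_def k'_def
      by (rule derivative_eq_intros DERIV_chain2[OF s' dp] DERIV_chain2[OF s' dq] refl)+
        (simp add: algebra_simps)
    have dk': "(k' has_real_derivative k'' t) (at t)" for t
      unfolding k'_def k''_def
      by (rule derivative_eq_intros DERIV_chain2[OF s' dp] DERIV_chain2[OF s' dq]
          DERIV_chain2[OF s'' dp] DERIV_chain2[OF s'' dq] refl)+
        (simp add: algebra_simps power2_eq_square)
    have smp: "smooth_on UNIV p" "smooth_on UNIV q"
      unfolding p_def q_def
      by (intro smooth_on_diff smooth_on_add smooth_on_linear bounded_linear_mult_right smooth_on_const open_UNIV)+
    have sk: "smooth_on UNIV k"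
      unfolding k_def
      by (intro smooth_on_mult open_UNIV smooth_on_compose[OF open_UNIV open_UNIV _ smooth_step_smooth] smp) auto
    have sg: "smooth_on UNIV g"
      unfolding g_def by (intro smooth_on_mult open_UNIV smooth_cos sk)
    obtain g' where g': "smooth_on UNIV g'" "\<And>t. (g has_real_derivative g' t) (at t)"
      using smooth_real_derivative[OF sg] by blast
    obtain g'' where g'': "smooth_on UNIV g''" "\<And>t. (g' has_real_derivative g'' t) (at t)"
      using smooth_real_derivative[OF g'(1)] by blast
    have g'_eq: "g' = (\<lambda>t. cos (\<xi> * t) * k' t - \<xi> * sin (\<xi> * t) * k t)"
    proof
      fix t
      have "(g has_real_derivative cos (\<xi> * t) * k' t - \<xi> * sin (\<xi> * t) * k t) (at t)"
        unfolding g_def by (rule derivative_eq_intros dk refl)+ (simp add: algebra_simps)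
      then show "g' t = cos (\<xi> * t) * k' t - \<xi> * sin (\<xi> * t) * k t" using DERIV_unique g'(2) by blast
    qed
    have g''_eq: "g'' t = cos (\<xi> * t) * k'' t - 2 * \<xi> * sin (\<xi> * t) * k' t - \<xi>\<^sup>2 * g t" for t
    proof -
      have "(g' has_real_derivative cos (\<xi> * t) * k'' t - 2 * \<xi> * sin (\<xi> * t) * k' t - \<xi>\<^sup>2 * g t) (at t)"
        unfolding g'_eq g_def
        by (rule derivative_eq_intros dk dk' refl)+ (simp add: algebra_simps power2_eq_square)
      then show ?thesis using DERIV_unique g''(2) by blast
    qed
    have res: "\<xi>\<^sup>2 * g t + g'' t = cos (\<xi> * t) * k'' t - 2 * \<xi> * sin (\<xi> * t) * k' t" for t
      by (simp add: g''_eq)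
    have st: "\<bar>smooth_step x\<bar> \<le> 1" for x using smooth_step_bounds[of x] by simp
    have k'_bound: "\<bar>k' t\<bar> \<le> \<omega> * (2 * K)" for t
    proof -
      have "\<bar>smooth_step (p t) * s' (q t)\<bar> \<le> 1 * K" "\<bar>s' (p t) * smooth_step (q t)\<bar> \<le> K * 1"
        by (rule mult_bound; rule st K)+
      then have "\<bar>smooth_step (p t) * s' (q t) - s' (p t) * smooth_step (q t)\<bar> \<le> 2 * K" by linarith
      then show ?thesis using \<omega> by (simp add: k'_def abs_mult mult_left_mono)
    qed
    have k''_bound: "\<bar>k'' t\<bar> \<le> \<omega>\<^sup>2 * (2 * K + 2 * (K * K))" for t
    proof -
      have "\<bar>s'' (p t) * smooth_step (q t)\<bar> \<le> K * 1" "\<bar>smooth_step (p t) * s'' (q t)\<bar> \<le> 1 * K"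
        "\<bar>s' (p t) * s' (q t)\<bar> \<le> K * K"
        by (rule mult_bound; rule st K)+
      then have "\<bar>s'' (p t) * smooth_step (q t) + smooth_step (p t) * s'' (q t) - 2 * (s' (p t) * s' (q t))\<bar> \<le> 2 * K + 2 * (K * K)"
        by linarith
      then show ?thesis by (simp add: k''_def abs_mult mult_left_mono)
    qed
    have b: "\<bar>\<xi>\<^sup>2 * g t + g'' t\<bar> \<le> C" for t
    proof -
      have "\<bar>cos (\<xi> * t) * k'' t\<bar> \<le> 1 * (\<omega>\<^sup>2 * (2 * K + 2 * (K * K)))"
        by (rule mult_bound[OF _ k''_bound]) simp
      moreover have "\<bar>sin (\<xi> * t) * k' t\<bar> \<le> 1 * (\<omega> * (2 * K))"
        by (rule mult_bound[OF _ k'_bound]) simp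
      then have "2 * \<xi> * \<bar>sin (\<xi> * t) * k' t\<bar> \<le> 2 * \<xi> * (1 * (\<omega> * (2 * K)))"
        using \<xi> by (intro mult_left_mono) auto
      moreover have "\<bar>2 * \<xi> * sin (\<xi> * t) * k' t\<bar> = 2 * \<xi> * \<bar>sin (\<xi> * t) * k' t\<bar>" using \<xi> by (simp add: abs_mult)
      ultimately show ?thesis unfolding res C_def by linarith
    qed
    have supp: "g t = 0" if "t \<notin> {- (M / \<omega>)..- (m / \<omega>)}" for t
    proof -
      have "p t \<le> 0 \<or> q t \<le> 0" using that \<omega> by (auto simp: p_def q_def field_simps)
      then show ?thesis by (auto simp: g_def k_def)
    qed
    have plateau: "g t = cos (\<xi> * t)" if "- (\<omega> * t) \<in> {m + 1..M - 1}" for t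
    proof -
      have "1 \<le> p t" "1 \<le> q t" using that by (auto simp: p_def q_def)
      then show ?thesis by (simp add: g_def k_def)
    qed
    have vanish: "\<xi>\<^sup>2 * g t + g'' t = 0" if "- (\<omega> * t) \<notin> {m..m + 1} \<union> {M - 1..M}" for t
    proof -
      have "p t \<notin> {0..1}" "q t \<notin> {0..1}" using that by (auto simp: p_def q_def)
      then show ?thesis unfolding res k'_def k''_def by (simp add: z)
    qed
    show ?thesis
      by (intro exI[of _ g] exI[of _ g'] exI[of _ g''] conjI allI impI sg g' g'' b supp plateau vanish)
  qed
  ultimately show thesis by (rule that)
qed

section \<open>Scale invariance\<close>

lemma integral_scale:
  fixes f :: "real^2 \<Rightarrow> real"
  assumes [measurable]: "f \<in> borel_measurable borel" and c: "0 < c"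
  shows "(LINT x|lborel. f x) = c\<^sup>2 * (LINT x|lborel. f (c *\<^sub>R x))"
proof -
  have "(LINT x|lborel. f x) = (LINT x|density (distr lborel borel (\<lambda>x. 0 + c *\<^sub>R x)) (\<lambda>_. ennreal (\<bar>c\<bar>^DIM(real^2))). f x)"
    using lborel_affine[of c "0 :: real^2"] c by (simp add: ennreal_power)
  also have "\<dots> = (LINT x|distr lborel borel (\<lambda>x::real^2. 0 + c *\<^sub>R x). (\<bar>c\<bar>^DIM(real^2)) *\<^sub>R f x)"
    by (rule integral_density) (use c in auto)
  also have "\<dots> = (LINT x|lborel. (\<bar>c\<bar>^DIM(real^2)) *\<^sub>R f (0 + c *\<^sub>R x))"
    by (rule integral_distr) auto
  finally show ?thesis using c by simp
qed

text \<open>The contribution of the \<open>k\<close>-th annulus in the logarithmic scale \<open>- \<omega> ln r\<close>. The half-open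
intervals make the annuli disjoint.\<close>

definition annulus_part :: "real \<Rightarrow> (real^2 \<Rightarrow> real) \<Rightarrow> (real \<Rightarrow> real) \<Rightarrow> nat \<Rightarrow> real^2 \<Rightarrow> real" where
  "annulus_part \<omega> \<psi> q k x = (if x \<noteq> 0 \<and> real k \<le> - (\<omega> * ln (norm x)) \<and> - (\<omega> * ln (norm x)) < real k + 1
     then (q (- (\<omega> * ln (norm x))) * \<psi> x)\<^sup>2 / (norm x)\<^sup>2 else 0)"

lemma annulus_part_nonneg: "0 \<le> annulus_part \<omega> \<psi> q k x"
  by (simp add: annulus_part_def)

lemma sum_annulus_part:
  assumes "finite I"
  shows "(\<Sum>k\<in>I. annulus_part \<omega> \<psi> q k x) =
    (if x \<noteq> 0 \<and> 0 \<le> - (\<omega> * ln (norm x)) \<and> nat \<lfloor>- (\<omega> * ln (norm x))\<rfloor> \<in> I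
     then (q (- (\<omega> * ln (norm x))) * \<psi> x)\<^sup>2 / (norm x)\<^sup>2 else 0)"
proof -
  let ?Y = "- (\<omega> * ln (norm x))" and ?v = "(q (- (\<omega> * ln (norm x))) * \<psi> x)\<^sup>2 / (norm x)\<^sup>2"
  have iff: "real k \<le> ?Y \<and> ?Y < real k + 1 \<longleftrightarrow> 0 \<le> ?Y \<and> k = nat \<lfloor>?Y\<rfloor>" for k
    by linarith
  have "(\<Sum>k\<in>I. annulus_part \<omega> \<psi> q k x) = (\<Sum>k\<in>I. if k = nat \<lfloor>?Y\<rfloor> then (if x \<noteq> 0 \<and> 0 \<le> ?Y then ?v else 0) else 0)"
    unfolding annulus_part_def iff by (intro sum.cong) auto
  then show ?thesis using assms by (simp add: sum.delta)
qed

lemma annulus_part_measurable: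
  assumes [measurable]: "\<psi> \<in> borel_measurable borel" "q \<in> borel_measurable borel"
  shows "annulus_part \<omega> \<psi> q k \<in> borel_measurable borel"
  unfolding annulus_part_def[abs_def] by measurable

lemma annulus_part_integrable:
  assumes m: "\<psi> \<in> borel_measurable borel" "q \<in> borel_measurable borel" and \<omega>: "0 < \<omega>"
    and K: "\<And>x. \<bar>\<psi> x\<bar> \<le> K" and q: "\<And>y. \<bar>q y\<bar> \<le> 1"
  shows "integrable lborel (annulus_part \<omega> \<psi> q k)"
proof (rule Bochner_Integration.integrable_bound)
  let ?C = "(1 * K)\<^sup>2 * exp (2 * (real k + 1) / \<omega>)"
  show "integrable lborel (\<lambda>x::real^2. ?C * indicat_real (cball 0 1) x)"
    using emeasure_lborel_cball_finite[of "0::real^2" 1] by (simp add: integrable_indicator_iff)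
  show "AE x in lborel. norm (annulus_part \<omega> \<psi> q k x) \<le> norm (?C * indicat_real (cball 0 1) x)"
  proof (rule AE_I2)
    fix x :: "real^2"
    show "norm (annulus_part \<omega> \<psi> q k x) \<le> norm (?C * indicat_real (cball 0 1) x)"
    proof (cases "x \<noteq> 0 \<and> real k \<le> - (\<omega> * ln (norm x)) \<and> - (\<omega> * ln (norm x)) < real k + 1")
      case True
      let ?L = "ln (norm x)"
      have n: "norm x = exp ?L" using True by simp
      have "\<omega> * ?L \<le> 0" using True by linarith
      then have "?L \<le> 0" using \<omega> by (simp add: mult_le_0_iff)
      then have "norm x \<le> 1" using True by simp
      have "- ?L \<le> (real k + 1) / \<omega>" using True \<omega> by (simp add: field_simps)
      moreover have "2 * (real k + 1) / \<omega> = 2 * ((real k + 1) / \<omega>)" by simp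
      ultimately have "- 2 * ?L \<le> 2 * (real k + 1) / \<omega>" by linarith
      moreover have "1 / (norm x)\<^sup>2 = exp (- 2 * ?L)"
        by (subst n) (simp add: exp_minus power2_eq_square inverse_eq_divide flip: exp_add)
      ultimately have 1: "1 / (norm x)\<^sup>2 \<le> exp (2 * (real k + 1) / \<omega>)" by simp
      have "\<bar>q (- (\<omega> * ?L)) * \<psi> x\<bar> \<le> 1 * K" by (rule mult_bound[OF q K])
      then have 2: "(q (- (\<omega> * ?L)) * \<psi> x)\<^sup>2 \<le> (1 * K)\<^sup>2" using power_mono[of "\<bar>q (- (\<omega> * ?L)) * \<psi> x\<bar>" "1 * K" 2] by simp
      have "annulus_part \<omega> \<psi> q k x = (q (- (\<omega> * ?L)) * \<psi> x)\<^sup>2 * (1 / (norm x)\<^sup>2)"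
        using True by (simp add: annulus_part_def)
      also have "\<dots> \<le> ?C" by (rule mult_mono[OF 2 1]) auto
      finally show ?thesis using \<open>norm x \<le> 1\<close> annulus_part_nonneg[of \<omega> \<psi> q k x] by simp
    next
      case False
      then have "annulus_part \<omega> \<psi> q k x = 0" unfolding annulus_part_def by (rule if_not_P)
      then show ?thesis by simp
    qed
  qed
qed (use annulus_part_measurable[OF m] in simp)

text \<open>The dilation by \<open>e\<^sup>-\<^sup>1\<^sup>/\<^sup>\<omega>\<close> carries each annulus to the next one, the measure \<open>dx / \<bar>x\<bar>\<^sup>2\<close>
is invariant under dilations, and so are \<open>\<psi>\<close> and, by periodicity, \<open>q\<close>.\<close>

lemma annulus_part_scale_invariant:
  assumes m: "\<psi> \<in> borel_measurable borel" "q \<in> borel_measurable borel" and \<omega>: "0 < \<omega>"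
    and hom: "\<And>c x. 0 < c \<Longrightarrow> \<psi> (c *\<^sub>R x) = \<psi> x" and per: "\<And>y. q (y + 1) = q y"
  shows "(LINT x|lborel. annulus_part \<omega> \<psi> q k x) = (LINT x|lborel. annulus_part \<omega> \<psi> q 0 x)"
proof (induction k)
  case (Suc k)
  define c where "c = exp (- (1 / \<omega>))"
  have c: "0 < c" by (simp add: c_def)
  have "c\<^sup>2 * annulus_part \<omega> \<psi> q (Suc k) (c *\<^sub>R x) = annulus_part \<omega> \<psi> q k x" for x
  proof (cases "x = 0")
    case True then show ?thesis by (simp add: annulus_part_def)
  next
    case False
    have "ln (norm (c *\<^sub>R x)) = - (1 / \<omega>) + ln (norm x)"
      using c False by (simp add: ln_mult c_def)
    then have Y: "- (\<omega> * ln (norm (c *\<^sub>R x))) = - (\<omega> * ln (norm x)) + 1"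
      using \<omega> by (simp add: field_simps)
    show ?thesis
      unfolding annulus_part_def Y per hom[OF c] using c False by (simp add: power_mult_distrib)
  qed
  then have "(LINT x|lborel. annulus_part \<omega> \<psi> q (Suc k) x) = (LINT x|lborel. annulus_part \<omega> \<psi> q k x)"
    using integral_scale[OF annulus_part_measurable[OF m] c, of \<omega> "Suc k"]
    by (simp flip: Bochner_Integration.integral_mult_right_zero)
  then show ?case using Suc by simp
qed simp

context transmission begin

lemma \<Psi>_bounded:
  obtains K where "\<And>x. \<bar>\<Psi> (arcsin (sin_angle x))\<bar> \<le> K" "(\<lambda>x. \<Psi> (arcsin (sin_angle x))) \<in> borel_measurable borel"
proof -
  obtain Q K2 where Q: "\<And>n c. c \<in> {-1..1} \<Longrightarrow> \<bar>poly (Q n) c\<bar> \<le> K2"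
    "\<And>n c. c \<in> {-1..1} \<Longrightarrow> \<bar>poly (pderiv (Q n)) c\<bar> \<le> K2"
    "\<And>\<theta>. \<bar>\<theta>\<bar> \<le> pi / 2 \<Longrightarrow> (\<lambda>n. poly (Q n) (sin \<theta>)) \<longlonglongrightarrow> \<Psi> \<theta>"
    "\<And>\<theta>. \<bar>\<theta>\<bar> < pi / 2 \<Longrightarrow> \<bar>\<theta>\<bar> \<noteq> \<beta> \<Longrightarrow>
      (\<lambda>n. poly (pderiv (Q n)) (sin \<theta>) * cos \<theta>) \<longlonglongrightarrow> \<Psi>' \<theta>"
    unfolding \<Psi>_def \<Psi>'_def using profile_approximation[OF \<beta> \<xi>, of A' B'] by blast
  have ang: "\<bar>sin_angle x\<bar> \<le> 1" for x
    using Cauchy_Schwarz_ineq2[of x e\<^sub>2] by (cases "x = 0") (simp_all add: field_simps)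
  have lim: "(\<lambda>n. poly (Q n) (sin_angle x)) \<longlonglongrightarrow> \<Psi> (arcsin (sin_angle x))" for x
  proof -
    have s: "-1 \<le> sin_angle x" "sin_angle x \<le> 1" using ang[of x] by linarith+
    have "\<bar>arcsin (sin_angle x)\<bar> \<le> pi / 2" using arcsin_bounded[OF s] by linarith
    from Q(3)[OF this] show ?thesis unfolding sin_arcsin[OF s] .
  qed
  show thesis
  proof
    show "\<bar>\<Psi> (arcsin (sin_angle x))\<bar> \<le> K2" for x
    proof (rule LIMSEQ_le_const2[OF tendsto_rabs[OF lim]])
      show "\<exists>N. \<forall>n\<ge>N. \<bar>poly (Q n) (sin_angle x)\<bar> \<le> K2"
      proof -
        have "sin_angle x \<in> {-1..1}" using ang[of x] unfolding atLeastAtMost_iff by linarith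
        then show ?thesis using Q(1) by blast
      qed
    qed
    show "(\<lambda>x. \<Psi> (arcsin (sin_angle x))) \<in> borel_measurable borel"
    proof (rule borel_measurable_LIMSEQ_real[OF lim])
      show "(\<lambda>x. poly (Q n) (sin_angle x)) \<in> borel_measurable borel" for n
        by (rule measurable_compose[of _ _ borel])
          (auto intro!: borel_measurable_continuous_onI continuous_intros)
    qed
  qed
qed

text \<open>Take \<open>g = cos(\<xi> t)\<close> cut off to \<open>N\<close> logarithmic annuli near the origin. By scale invariance
each of them adds the same positive amount to the lower bound for the energy, while the defect
arises only where the cut-off varies, so it stays bounded as \<open>N\<close> grows.\<close>

theorem Weyl_pair:
  assumes \<rho>: "0 < \<rho>"
    and D: "D \<in> sets lebesgue" "\<And>x. x \<in> ball 0 \<rho> \<Longrightarrow> x \<noteq> 0 \<Longrightarrow> x \<in> D \<longleftrightarrow> cos \<beta> < \<bar>cos_angle x\<bar>"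
    and \<epsilon>: "0 < \<epsilon>"
  shows "\<exists>u S. test_function (ball 0 \<rho>) u \<and> test_function (ball 0 \<rho>) S \<and> 0 < energy u \<and>
    defect D \<mu> u S \<le> \<epsilon> * energy u"
proof -
  \<comment> \<open>With this \<open>\<omega>\<close> the function \<open>cos(\<xi> ln r)\<close> has period \<open>1\<close> in \<open>- \<omega> ln r\<close>.\<close>
  define \<omega> where "\<omega> = \<xi> / (2 * pi)"
  have \<omega>: "0 < \<omega>" using \<xi> by (simp add: \<omega>_def)
  have cosY: "cos (\<xi> * t) = cos (2 * pi * (- (\<omega> * t)))" for t
    by (simp add: \<omega>_def)
  let ?\<psi> = "\<lambda>x. \<Psi> (arcsin (sin_angle x))" and ?c = "\<lambda>y. cos (2 * pi * y)" and ?one = "\<lambda>_. 1 :: real"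
  obtain K where K: "\<And>x. \<bar>?\<psi> x\<bar> \<le> K" and m\<psi>: "?\<psi> \<in> borel_measurable borel"
    using \<Psi>_bounded by blast
  have mq: "?c \<in> borel_measurable borel" "?one \<in> borel_measurable borel" by measurable
  have hom: "?\<psi> (c *\<^sub>R x) = ?\<psi> x" if "0 < c" for c x using that by simp
  have per: "?c (y + 1) = ?c y" for y by (simp add: distrib_left)
  let ?P = "annulus_part \<omega> ?\<psi> ?c" and ?U = "annulus_part \<omega> ?\<psi> ?one"
  define J where "J = (LINT x|lborel. ?P 0 x)"
  define W where "W = (LINT x|lborel. ?U 0 x)"
  have iP: "integrable lborel (?P k)" and iU: "integrable lborel (?U k)" for k
    by (rule annulus_part_integrable[OF m\<psi> _ \<omega> K]; use mq in simp)+
  have P_eq: "(LINT x|lborel. ?P k x) = J" for k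
    unfolding J_def by (rule annulus_part_scale_invariant[OF m\<psi> mq(1) \<omega> hom per])
  have U_eq: "(LINT x|lborel. ?U k x) = W" for k
    unfolding W_def by (rule annulus_part_scale_invariant[OF m\<psi> mq(2) \<omega> hom refl])
  have W0: "0 \<le> W" unfolding W_def by (rule Bochner_Integration.integral_nonneg) (rule annulus_part_nonneg)
  have J0: "0 < J"
  proof -
    have "J \<noteq> 0"
    proof
      assume "J = 0"
      then have "AE x in lborel. ?P 0 x = 0"
        unfolding J_def using iP annulus_part_nonneg by (subst (asm) integral_nonneg_eq_0_iff_AE) auto
      then have "AE x in lebesgue. ?P 0 x = 0" by (rule AE_completion)
      \<comment> \<open>On the part of annulus \<open>0\<close> where the cosine has not reached its first zero, \<open>\<Psi>\<close> can vanish only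
        on the first axis.\<close>
      moreover define V where "V = {x::real^2. exp (- (1 / (4 * \<omega>))) < norm x \<and> norm x < 1 \<and> x \<bullet> e\<^sub>2 \<noteq> 0}"
      have "?P 0 x \<noteq> 0" if "x \<in> V" for x
      proof -
        have "0 < exp (- (1 / (4 * \<omega>)))" by simp
        then have x: "x \<noteq> 0" "0 < norm x" using that by (auto simp: V_def)
        have "exp (- (1 / (4 * \<omega>))) < exp (ln (norm x))" using that x by (simp add: V_def)
        then have "- (1 / (4 * \<omega>)) < ln (norm x)" by (simp only: exp_less_cancel_iff)
        then have Y: "- (\<omega> * ln (norm x)) < 1 / 4" using \<omega> by (simp add: field_simps)
        have "ln (norm x) < 0" using that x by (simp add: V_def)
        then have Y0: "0 < - (\<omega> * ln (norm x))" using \<omega> by (simp add: mult_less_0_iff)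
        have "0 < cos (2 * pi * (- (\<omega> * ln (norm x))))"
        proof (rule cos_gt_zero)
          have "2 * pi * (- (\<omega> * ln (norm x))) < 2 * pi * (1 / 4)"
            using Y by (intro mult_strict_left_mono) auto
          then show "2 * pi * (- (\<omega> * ln (norm x))) < pi / 2" by simp
          show "0 < 2 * pi * (- (\<omega> * ln (norm x)))"
            by (intro mult_pos_pos Y0) auto
        qed
        moreover have "?\<psi> x \<noteq> 0"
        proof (rule \<Psi>_nonzero)
          show "\<bar>sin_angle x\<bar> \<le> 1" using Cauchy_Schwarz_ineq2[of x e\<^sub>2] x by simp
          show "sin_angle x \<noteq> 0" using that x by (simp add: V_def)
        qed
        ultimately show ?thesis
          using Y Y0 x unfolding annulus_part_def by simp
      qed
      ultimately have "AE x in lebesgue. x \<notin> V" by (auto elim!: eventually_mono)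
      have "open V"
        unfolding V_def by (intro open_Collect_conj open_Collect_less open_Collect_neq continuous_intros)
      have "V \<in> null_sets lebesgue"
        using \<open>AE x in lebesgue. x \<notin> V\<close> \<open>open V\<close> by (subst AE_iff_null_sets) auto
      moreover note \<open>open V\<close>
      moreover have "((1 + exp (- (1 / (4 * \<omega>)))) / 2) *\<^sub>R e\<^sub>2 \<in> V"
      proof -
        define t where "t = exp (- (1 / (4 * \<omega>)))"
        have t: "0 < t" "t < 1" using \<omega> by (auto simp: t_def)
        then have "0 < (1 + t) / 2" "t < (1 + t) / 2" "(1 + t) / 2 < 1" by simp_all
        moreover define t' where "t' = (1 + t) / 2"
        ultimately show ?thesis unfolding V_def t_def[symmetric] t'_def[symmetric]
          by (simp add: inner_axis)
      qed
      ultimately show False using open_not_negligible[of V] negligible_iff_null_sets[of V] by blast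
    qed
    moreover have "0 \<le> J" unfolding J_def by (rule Bochner_Integration.integral_nonneg) (rule annulus_part_nonneg)
    ultimately show ?thesis by simp
  qed
  obtain C where C: "0 < C" and cut: "\<And>m M :: real. m + 2 \<le> M \<Longrightarrow> \<exists>g g' g''. smooth_on UNIV g \<and> smooth_on UNIV g' \<and> smooth_on UNIV g'' \<and>
      (\<forall>t. (g has_real_derivative g' t) (at t)) \<and> (\<forall>t. (g' has_real_derivative g'' t) (at t)) \<and>
      (\<forall>t. t \<notin> {- (M / \<omega>)..- (m / \<omega>)} \<longrightarrow> g t = 0) \<and>
      (\<forall>t. - (\<omega> * t) \<in> {m + 1..M - 1} \<longrightarrow> g t = cos (\<xi> * t)) \<and>
      (\<forall>t. \<bar>\<xi>\<^sup>2 * g t + g'' t\<bar> \<le> C) \<and>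
      (\<forall>t. - (\<omega> * t) \<notin> {m..m + 1} \<union> {M - 1..M} \<longrightarrow> \<xi>\<^sup>2 * g t + g'' t = 0)"
    using radial_cutoff[OF \<omega> \<xi>] by blast
  obtain m :: nat where m: "1 \<le> m" "exp (- (real m / \<omega>)) < \<rho>"
  proof -
    obtain n where n: "\<bar>\<omega> * ln \<rho>\<bar> < real n" using reals_Archimedean2 by blast
    have "- (real (Suc n) / \<omega>) < ln \<rho>" using n \<omega> by (simp add: field_simps abs_less_iff)
    then have "exp (- (real (Suc n) / \<omega>)) < exp (ln \<rho>)" by (simp only: exp_less_cancel_iff)
    then show ?thesis using that[of "Suc n"] \<rho> by simp
  qed
  \<comment> \<open>\<open>T\<close> bounds the defect for every \<open>N\<close>; the summand \<open>1\<close> is the error made in smoothing the angular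
    factors.\<close>
  define T where "T = 4 * C\<^sup>2 * W + 1"
  obtain N :: nat where N: "((T / \<epsilon>) + 1) / (\<xi>^4 * J) < real N" "1 \<le> N"
  proof -
    obtain n where "((T / \<epsilon>) + 1) / (\<xi>^4 * J) < real n" using reals_Archimedean2 by blast
    then show ?thesis using that[of "Suc n"] by simp
  qed
  have T0: "0 < T" using W0 C by (simp add: T_def add_nonneg_pos)
  have NJ: "T / \<epsilon> + 1 < \<xi>^4 * (real N * J)"
    using N(1) J0 \<xi> by (simp add: pos_divide_less_eq mult_ac)
  define M where "M = m + N + 2"
  have "real m + 2 \<le> real M" by (simp add: M_def)
  from cut[OF this] obtain g g' g'' where g: "smooth_on UNIV g" "smooth_on UNIV g'" "smooth_on UNIV g''"
    "\<And>t. (g has_real_derivative g' t) (at t)" "\<And>t. (g' has_real_derivative g'' t) (at t)"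
    and supp: "\<And>t. t \<notin> {- (real M / \<omega>)..- (real m / \<omega>)} \<Longrightarrow> g t = 0"
    and plateau: "\<And>t. - (\<omega> * t) \<in> {real m + 1..real M - 1} \<Longrightarrow> g t = cos (\<xi> * t)"
    and b: "\<And>t. \<bar>\<xi>\<^sup>2 * g t + g'' t\<bar> \<le> C"
    and vanish: "\<And>t. - (\<omega> * t) \<notin> {real m..real m + 1} \<union> {real M - 1..real M} \<Longrightarrow> \<xi>\<^sup>2 * g t + g'' t = 0"
    by blast
  have t2: "- (real m / \<omega>) < 0" using m \<omega> by simp
  let ?L = "\<lambda>x::real^2. ln (norm x)"
  let ?E = "\<lambda>x. (g (?L x) * ?\<psi> x)\<^sup>2 / (norm x)\<^sup>2"
  let ?R = "\<lambda>x. ((\<xi>\<^sup>2 * g (?L x) + g'' (?L x)) * ?\<psi> x)\<^sup>2 / (norm x)\<^sup>2"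
  obtain u S where u: "test_function (ball 0 \<rho>) u" and S: "test_function (ball 0 \<rho>) S"
    and E: "energy u \<ge> \<xi>^4 * (LINT x|lebesgue. ?E x) - 1"
    and R: "defect D \<mu> u S \<le> (LINT x|lebesgue. ?R x) + 1" and iE: "integrable lebesgue ?E"
    by (rule smooth_approximation[OF g(1,4,5,2,3) supp t2 m(2) D zero_less_one])
      (assumption | (rule that; assumption))+
  have leb: "integrable lebesgue f \<and> (LINT x|lebesgue. f x) = (LINT x|lborel. f x)"
    if "integrable lborel f" for f :: "real^2 \<Rightarrow> real"
    using that integrable_completion[of f lborel] integral_completion[of f lborel] borel_measurable_integrable[OF that] by auto
  \<comment> \<open>Each of the \<open>N\<close> annuli of the plateau contributes \<open>J\<close>.\<close>
  have "real N * J \<le> (LINT x|lebesgue. ?E x)"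
  proof -
    let ?I = "{m + 1..<M - 1}"
    have isum: "integrable lborel (\<lambda>x. \<Sum>k\<in>?I. ?P k x)" by (intro Bochner_Integration.integrable_sum iP)
    have "(LINT x|lborel. (\<Sum>k\<in>?I. ?P k x)) = (\<Sum>k\<in>?I. J)"
      by (subst Bochner_Integration.integral_sum) (use iP P_eq in auto)
    also have "\<dots> = real N * J" by (simp add: M_def)
    finally have "real N * J = (LINT x|lebesgue. (\<Sum>k\<in>?I. ?P k x))" using leb[OF isum] by simp
    also have "\<dots> \<le> (LINT x|lebesgue. ?E x)"
    proof (rule integral_mono)
      show "integrable lebesgue (\<lambda>x. \<Sum>k\<in>?I. ?P k x)" using leb[OF isum] by simp
      fix x :: "real^2"
      let ?Y = "- (\<omega> * ?L x)"
      have "(if x \<noteq> 0 \<and> 0 \<le> ?Y \<and> nat \<lfloor>?Y\<rfloor> \<in> ?I then (cos (2 * pi * ?Y) * ?\<psi> x)\<^sup>2 / (norm x)\<^sup>2 else 0) \<le> ?E x"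
      proof (cases "x \<noteq> 0 \<and> 0 \<le> ?Y \<and> nat \<lfloor>?Y\<rfloor> \<in> ?I")
        case True
        then have "m + 1 \<le> nat \<lfloor>?Y\<rfloor>" "nat \<lfloor>?Y\<rfloor> < M - 1" by auto
        then have "real m + 1 \<le> ?Y" "?Y \<le> real M - 1"
          using True by (auto simp: M_def) linarith+
        then have "g (?L x) = cos (2 * pi * ?Y)" using plateau[of "?L x"] cosY[of "?L x"] by simp
        then show ?thesis using True by simp
      next
        case False
        then show ?thesis by (subst if_not_P) auto
      qed
      then show "(\<Sum>k\<in>?I. ?P k x) \<le> ?E x" by (subst sum_annulus_part) simp_all
    qed (rule iE)
    finally show ?thesis .
  qed
  then have "\<xi>^4 * (real N * J) \<le> \<xi>^4 * (LINT x|lebesgue. ?E x)" by (intro mult_left_mono) auto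
  then have en: "T / \<epsilon> < energy u" using E NJ by linarith
  \<comment> \<open>The residual of \<open>g\<close> lives on the two transition layers, which meet four annuli.\<close>
  have "(LINT x|lebesgue. ?R x) \<le> 4 * C\<^sup>2 * W"
  proof -
    let ?I = "{m, m + 1, M - 1, M}"
    have cI: "card ?I = 4" using N(2) by (simp add: M_def)
    have isum: "integrable lborel (\<lambda>x. C\<^sup>2 * (\<Sum>k\<in>?I. ?U k x))"
      by (intro integrable_mult_right Bochner_Integration.integrable_sum iU)
    have "(LINT x|lebesgue. ?R x) \<le> (LINT x|lebesgue. C\<^sup>2 * (\<Sum>k\<in>?I. ?U k x))"
    proof (rule integral_mono')
      show "integrable lebesgue (\<lambda>x. C\<^sup>2 * (\<Sum>k\<in>?I. ?U k x))" using leb[OF isum] by simp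
      fix x :: "real^2"
      show "0 \<le> C\<^sup>2 * (\<Sum>k\<in>?I. ?U k x)"
        by (intro mult_nonneg_nonneg sum_nonneg annulus_part_nonneg) auto
      let ?Y = "- (\<omega> * ?L x)"
      show "?R x \<le> C\<^sup>2 * (\<Sum>k\<in>?I. ?U k x)"
      proof (cases "x \<noteq> 0 \<and> ?Y \<in> {real m..real m + 1} \<union> {real M - 1..real M}")
        case True
        then have Y0: "0 \<le> ?Y" by (auto simp: M_def)
        have "nat \<lfloor>?Y\<rfloor> \<in> ?I" 
        proof -
          have "?Y \<in> {real m..real m + 1} \<or> ?Y \<in> {real M - 1..real M}" using True by blast
          then have "(int m \<le> \<lfloor>?Y\<rfloor> \<and> \<lfloor>?Y\<rfloor> \<le> int m + 1) \<or> (int M - 1 \<le> \<lfloor>?Y\<rfloor> \<and> \<lfloor>?Y\<rfloor> \<le> int M)"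
            by (auto simp: le_floor_iff floor_le_iff)
          then show ?thesis by (auto simp: M_def)
        qed
        then have "(\<Sum>k\<in>?I. ?U k x) = (1 * ?\<psi> x)\<^sup>2 / (norm x)\<^sup>2"
          using True Y0 by (subst sum_annulus_part) auto
        moreover have "(\<xi>\<^sup>2 * g (?L x) + g'' (?L x))\<^sup>2 \<le> C\<^sup>2"
          using power_mono[OF b[of "?L x"], of 2] by simp
        then have "(\<xi>\<^sup>2 * g (?L x) + g'' (?L x))\<^sup>2 * ((?\<psi> x)\<^sup>2 / (norm x)\<^sup>2) \<le> C\<^sup>2 * ((?\<psi> x)\<^sup>2 / (norm x)\<^sup>2)"
          by (intro mult_right_mono) auto
        ultimately show ?thesis by (simp add: power_mult_distrib)
      next
        case False
        then have "?R x = 0" using vanish[of "?L x"] by (cases "x = 0") auto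
        moreover have "0 \<le> C\<^sup>2 * (\<Sum>k\<in>?I. ?U k x)"
          by (intro mult_nonneg_nonneg sum_nonneg annulus_part_nonneg) auto
        ultimately show ?thesis by linarith
      qed
    qed
    also have "\<dots> = (LINT x|lborel. C\<^sup>2 * (\<Sum>k\<in>?I. ?U k x))" using leb[OF isum] by simp
    also have "\<dots> = C\<^sup>2 * (\<Sum>k\<in>?I. LINT x|lborel. ?U k x)"
      using iU by (simp only: Bochner_Integration.integral_mult_right_zero Bochner_Integration.integral_sum)
    also have "\<dots> = C\<^sup>2 * (real (card ?I) * W)" by (simp only: U_eq sum_constant)
    finally show ?thesis unfolding cI by simp
  qed
  then have "defect D \<mu> u S \<le> T" using R unfolding T_def by linarith
  also have "T \<le> \<epsilon> * energy u" using en \<epsilon> by (simp add: pos_divide_less_eq mult.commute)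
  finally have "defect D \<mu> u S \<le> \<epsilon> * energy u" .
  moreover have "0 < energy u" using en divide_pos_pos[OF T0 \<epsilon>] by linarith
  ultimately show ?thesis using u S by blast
qed

end


section \<open>The approximate point spectrum near the corner\<close>

text \<open>Approximate solutions, supported in the disc of radius \<open>\<rho>\<close>, of the transmission problem for
the coefficient \<open>1\<^sub>D - \<mu>\<close>. Unlike the spectrum, this notion depends on \<open>D\<close> only inside the disc.\<close>

definition approx_transmission :: "real \<Rightarrow> (real^2) set \<Rightarrow> real \<Rightarrow> bool" where
  "approx_transmission \<rho> D \<mu> \<longleftrightarrow> (\<forall>\<epsilon>>0. \<exists>u S. test_function (ball 0 \<rho>) u \<and> test_function (ball 0 \<rho>) S \<and>
     0 < energy u \<and> defect D \<mu> u S \<le> \<epsilon> * energy u)"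

text \<open>Changing \<open>\<nu>\<close> to \<open>\<mu>\<close> alters the residual by \<open>(\<nu> - \<mu>) \<nabla>u\<close>, which is small relative to the
energy of \<open>u\<close>.\<close>

lemma approx_transmission_closed:
  assumes D: "D \<in> sets lebesgue"
    and near: "\<And>\<delta>. 0 < \<delta> \<Longrightarrow> \<exists>\<nu>. \<bar>\<nu> - \<mu>\<bar> < \<delta> \<and> approx_transmission \<rho> D \<nu>"
  shows "approx_transmission \<rho> D \<mu>"
  unfolding approx_transmission_def
proof (intro allI impI)
  fix \<epsilon> :: real assume \<epsilon>: "0 < \<epsilon>"
  then obtain \<nu> where \<nu>: "\<bar>\<nu> - \<mu>\<bar> < sqrt (\<epsilon> / 4)" "approx_transmission \<rho> D \<nu>" using near[of "sqrt (\<epsilon> / 4)"] by auto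
  have sq: "(\<nu> - \<mu>)\<^sup>2 \<le> \<epsilon> / 4"
  proof -
    have "\<bar>\<nu> - \<mu>\<bar>\<^sup>2 \<le> (sqrt (\<epsilon> / 4))\<^sup>2" using \<nu>(1) by (intro power_mono) auto
    then show ?thesis using \<epsilon> by simp
  qed
  have "0 < \<epsilon> / 4" using \<epsilon> by simp
  then obtain u S where u: "test_function (ball 0 \<rho>) u" and S: "test_function (ball 0 \<rho>) S"
    and e: "0 < energy u" "defect D \<nu> u S \<le> (\<epsilon> / 4) * energy u"
    using \<nu>(2) unfolding approx_transmission_def by blast
  have "defect D \<mu> u S \<le> (LINT x|lebesgue. 2 * (norm ((indicator D x - \<nu>) *\<^sub>R grad u x - rot (grad S x)))\<^sup>2
      + 2 * ((\<epsilon> / 4) * (norm (grad u x))\<^sup>2))"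
    unfolding defect_def
  proof (rule integral_mono)
    show "integrable lebesgue (\<lambda>x. (norm ((indicator D x - \<mu>) *\<^sub>R grad u x - rot (grad S x)))\<^sup>2)"
      by (rule residual_integrable[OF D u S])
    show "integrable lebesgue (\<lambda>x. 2 * (norm ((indicator D x - \<nu>) *\<^sub>R grad u x - rot (grad S x)))\<^sup>2
      + 2 * ((\<epsilon> / 4) * (norm (grad u x))\<^sup>2))"
      using residual_integrable[OF D u S, of \<nu>] integrable_norm_grad_sq[OF u] by simp
    fix x
    have "(indicator D x - \<mu>) *\<^sub>R grad u x - rot (grad S x) =
        ((indicator D x - \<nu>) *\<^sub>R grad u x - rot (grad S x)) + (\<nu> - \<mu>) *\<^sub>R grad u x"
      by (simp add: algebra_simps)
    then have "(norm ((indicator D x - \<mu>) *\<^sub>R grad u x - rot (grad S x)))\<^sup>2 \<le>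
        2 * (norm ((indicator D x - \<nu>) *\<^sub>R grad u x - rot (grad S x)))\<^sup>2 + 2 * (norm ((\<nu> - \<mu>) *\<^sub>R grad u x))\<^sup>2"
      by (simp only: norm_add_sq_le)
    also have "(norm ((\<nu> - \<mu>) *\<^sub>R grad u x))\<^sup>2 \<le> (\<epsilon> / 4) * (norm (grad u x))\<^sup>2"
      using mult_right_mono[OF sq, of "(norm (grad u x))\<^sup>2"] by (simp add: power_mult_distrib)
    finally show "(norm ((indicator D x - \<mu>) *\<^sub>R grad u x - rot (grad S x)))\<^sup>2 \<le>
        2 * (norm ((indicator D x - \<nu>) *\<^sub>R grad u x - rot (grad S x)))\<^sup>2 + 2 * ((\<epsilon> / 4) * (norm (grad u x))\<^sup>2)"
      by simp
  qed
  also have "\<dots> = 2 * defect D \<nu> u S + 2 * ((\<epsilon> / 4) * energy u)"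
    using residual_integrable[OF D u S, of \<nu>] integrable_norm_grad_sq[OF u]
    by (simp add: defect_def energy_def)
  also have "\<dots> \<le> \<epsilon> * energy u" using e by simp
  finally show "\<exists>u S. test_function (ball 0 \<rho>) u \<and> test_function (ball 0 \<rho>) S \<and>
     0 < energy u \<and> defect D \<mu> u S \<le> \<epsilon> * energy u"
    using u S e by blast
qed

lemma grad_scale:
  assumes "test_function \<Omega> u"
  shows "grad (\<lambda>x. c * u x) x = c *\<^sub>R grad u x"
proof (rule grad_eqI)
  have "((\<lambda>x. c * u x) has_derivative (\<lambda>h. c * frechet_derivative u (at x) h)) (at x)"
    by (intro has_derivative_mult_right test_has_derivative[OF assms])
  moreover have "frechet_derivative u (at x) h = grad u x \<bullet> h" for h
  proof -
    have "frechet_derivative u (at x) h = frechet_derivative u (at x) (\<Sum>b\<in>Basis. (h \<bullet> b) *\<^sub>R b)"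
      by (simp add: euclidean_representation)
    also have "\<dots> = (\<Sum>b\<in>Basis. (h \<bullet> b) * partial u b x)"
      using has_derivative_linear[OF test_has_derivative[OF assms, of x]]
      by (simp add: linear_sum linear_scale)
    also have "\<dots> = grad u x \<bullet> h"
      unfolding grad_def inner_sum_left inner_scaleR_left
      by (intro sum.cong refl) (simp add: inner_commute mult.commute)
    finally show ?thesis .
  qed
  ultimately show "((\<lambda>x. c * u x) has_derivative (\<lambda>h. (c *\<^sub>R grad u x) \<bullet> h)) (at x)" by simp
qed

text \<open>The function \<open>u\<close> and its stream function exchange roles. With \<open>a = 1\<^sub>D - \<mu>\<close> and
\<open>a' = 1\<^sub>D - (1 - \<mu>)\<close> the product \<open>a' a = \<mu>(1 - \<mu>)\<close> is constant, so multiplying \<open>a \<nabla>u \<approx> rot \<nabla>S\<close> by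
\<open>a'\<close> and rotating gives \<open>a' \<nabla>S \<approx> rot \<nabla>v\<close> with \<open>v = - \<mu>(1 - \<mu>) u\<close>. The energy of \<open>S\<close> is comparable
to that of \<open>u\<close> because \<open>a\<close> is bounded away from \<open>0\<close>.\<close>

lemma approx_transmission_dual:
  assumes D: "D \<in> sets lebesgue" and \<mu>: "0 < \<mu>" "\<mu> < 1" and sv: "approx_transmission \<rho> D \<mu>"
  shows "approx_transmission \<rho> D (1 - \<mu>)"
  unfolding approx_transmission_def
proof (intro allI impI)
  fix \<epsilon> :: real assume \<epsilon>: "0 < \<epsilon>"
  define m where "m = (min \<mu> (1 - \<mu>))\<^sup>2"
  have m: "0 < m" using \<mu> by (simp add: m_def)
  \<comment> \<open>The first bound keeps the energy of \<open>S\<close> above \<open>m/4\<close> times that of \<open>u\<close>; the second then makes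
    the defect small relative to the energy of \<open>S\<close>.\<close>
  define \<delta> where "\<delta> = min (m / 4) (\<epsilon> * m / 4)"
  have \<delta>: "0 < \<delta>" "\<delta> \<le> m / 4" "\<delta> \<le> \<epsilon> * m / 4" using m \<epsilon> by (auto simp: \<delta>_def)
  obtain u S where u: "test_function (ball 0 \<rho>) u" and S: "test_function (ball 0 \<rho>) S"
    and e: "0 < energy u" "defect D \<mu> u S \<le> \<delta> * energy u"
    using sv \<delta>(1) unfolding approx_transmission_def by blast
  define v where "v x = - (\<mu> * (1 - \<mu>)) * u x" for x
  have v: "test_function (ball 0 \<rho>) v" unfolding v_def by (rule test_scale[OF u])
  let ?a = "\<lambda>x. indicator D x - \<mu>" and ?a' = "\<lambda>x. indicator D x - (1 - \<mu>)"
  let ?R = "\<lambda>x. ?a x *\<^sub>R grad u x - rot (grad S x)"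
  have Ri: "integrable lebesgue (\<lambda>x. (norm (?R x))\<^sup>2)" by (rule residual_integrable[OF D u S])
  have Si: "integrable lebesgue (\<lambda>x. (norm (grad S x))\<^sup>2)" by (rule integrable_norm_grad_sq[OF S])
  have aa: "?a' x * ?a x = \<mu> * (1 - \<mu>)" for x by (auto simp: indicator_def algebra_simps)
  have "defect D (1 - \<mu>) S v \<le> defect D \<mu> u S"
    unfolding defect_def
  proof (rule integral_mono[OF residual_integrable[OF D S v] Ri])
    fix x
    have "?a' x *\<^sub>R grad S x - rot (grad v x) = ?a' x *\<^sub>R rot (?R x)"
      unfolding v_def grad_scale[OF u] rot_diff rot_scale rot_rot scaleR_diff_right scaleR_scaleR aa
      by simp
    moreover have "\<bar>?a' x\<bar> \<le> 1" using \<mu> by (auto simp: indicator_def)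
    ultimately have "norm (?a' x *\<^sub>R grad S x - rot (grad v x)) \<le> norm (?R x)"
      using mult_right_mono[of "\<bar>?a' x\<bar>" 1 "norm (?R x)"] by simp
    then show "(norm (?a' x *\<^sub>R grad S x - rot (grad v x)))\<^sup>2 \<le> (norm (?R x))\<^sup>2" by (rule power_mono) simp
  qed
  then have d: "defect D (1 - \<mu>) S v \<le> \<delta> * energy u" using e by linarith
  have "m * energy u \<le> (LINT x|lebesgue. 2 * (norm (?R x))\<^sup>2 + 2 * (norm (grad S x))\<^sup>2)"
    unfolding energy_def Bochner_Integration.integral_mult_right_zero[symmetric]
  proof (rule integral_mono)
    show "integrable lebesgue (\<lambda>x. m * (norm (grad u x))\<^sup>2)" using integrable_norm_grad_sq[OF u] by simp
    show "integrable lebesgue (\<lambda>x. 2 * (norm (?R x))\<^sup>2 + 2 * (norm (grad S x))\<^sup>2)" using Ri Si by simp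
    fix x
    have "min \<mu> (1 - \<mu>) \<le> \<bar>?a x\<bar>" using \<mu> by (auto simp: indicator_def)
    then have "m \<le> \<bar>?a x\<bar>\<^sup>2" unfolding m_def using \<mu> by (intro power_mono) auto
    then have "m * (norm (grad u x))\<^sup>2 \<le> (norm (?a x *\<^sub>R grad u x))\<^sup>2"
      by (simp add: power_mult_distrib mult_right_mono)
    also have "\<dots> = (norm (?R x + rot (grad S x)))\<^sup>2" by simp
    also have "\<dots> \<le> 2 * (norm (?R x))\<^sup>2 + 2 * (norm (rot (grad S x)))\<^sup>2" by (rule norm_add_sq_le)
    finally show "m * (norm (grad u x))\<^sup>2 \<le> 2 * (norm (?R x))\<^sup>2 + 2 * (norm (grad S x))\<^sup>2" by simp
  qed
  also have "\<dots> = 2 * defect D \<mu> u S + 2 * energy S" using Ri Si by (simp add: defect_def energy_def)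
  also have "\<dots> \<le> 2 * (\<delta> * energy u) + 2 * energy S" using e by simp
  also have "\<dots> \<le> 2 * (m / 4 * energy u) + 2 * energy S" using \<delta>(2) e(1) by (simp add: mult_right_mono)
  finally have eS: "m / 4 * energy u \<le> energy S" by simp
  have "\<delta> * energy u \<le> \<epsilon> * m / 4 * energy u" using \<delta>(3) e(1) by (intro mult_right_mono) auto
  also have "\<dots> = \<epsilon> * (m / 4 * energy u)" by simp
  also have "\<dots> \<le> \<epsilon> * energy S" using eS \<epsilon> by (intro mult_left_mono) auto
  finally have "defect D (1 - \<mu>) S v \<le> \<epsilon> * energy S" using d by linarith
  moreover have "0 < energy S"
  proof -
    have "0 < m / 4 * energy u" using m e(1) by simp
    then show ?thesis using eS by linarith
  qed
  ultimately show "\<exists>u S. test_function (ball 0 \<rho>) u \<and> test_function (ball 0 \<rho>) S \<and>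
     0 < energy u \<and> defect D (1 - \<mu>) u S \<le> \<epsilon> * energy u"
    using S v by blast
qed

text \<open>The product of hyperbolic tangents grows continuously from \<open>0\<close> to the limit \<open>1\<close>.\<close>

lemma dispersion_relation:
  fixes a b \<tau> :: real
  assumes ab: "0 < a" "0 < b" and \<tau>: "0 < \<tau>" "\<tau> < 1"
  obtains \<xi> where "0 < \<xi>" "tanh (\<xi> * a) * tanh (\<xi> * b) = \<tau>"
proof -
  have t: "filterlim (\<lambda>\<xi>. \<xi> * c) at_top at_top" if "0 < c" for c :: real
    using filterlim_tendsto_pos_mult_at_top[OF tendsto_const that filterlim_ident] by (simp add: mult.commute)
  have "((\<lambda>\<xi>. tanh (\<xi> * a) * tanh (\<xi> * b)) \<longlongrightarrow> 1 * 1) at_top"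
    by (intro tendsto_mult filterlim_compose[OF tanh_real_at_top] t ab)
  then have "\<forall>\<^sub>F \<xi> in at_top. \<tau> < tanh (\<xi> * a) * tanh (\<xi> * b)"
    using \<tau> by (intro order_tendstoD(1)) auto
  then obtain X where X: "\<And>\<xi>. X \<le> \<xi> \<Longrightarrow> \<tau> < tanh (\<xi> * a) * tanh (\<xi> * b)"
    by (auto simp: eventually_at_top_linorder)
  have "\<exists>\<xi>\<ge>0. \<xi> \<le> max X 0 \<and> tanh (\<xi> * a) * tanh (\<xi> * b) = \<tau>"
  proof (rule IVT')
    show "tanh (0 * a) * tanh (0 * b) \<le> \<tau>" using \<tau> by simp
    show "\<tau> \<le> tanh (max X 0 * a) * tanh (max X 0 * b)" using X[of "max X 0"] by simp
    show "continuous_on {0..max X 0} (\<lambda>\<xi>. tanh (\<xi> * a) * tanh (\<xi> * b))"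
      by (intro continuous_intros) (simp_all add: cosh_real_nonzero)
  qed simp
  then obtain \<xi> where \<xi>: "0 \<le> \<xi>" "tanh (\<xi> * a) * tanh (\<xi> * b) = \<tau>" by blast
  moreover have "\<xi> \<noteq> 0" using \<xi>(2) \<tau> by auto
  ultimately show thesis using that[of \<xi>] by simp
qed

text \<open>Eliminating the four coefficients from the matching conditions leaves
\<open>\<mu> / (1 - \<mu>) = tanh(\<xi>\<beta>) tanh(\<xi>(\<pi>/2 - \<beta>))\<close>, which has a real solution \<open>\<xi>\<close> for \<open>0 < \<mu> < 1/2\<close>.
Duality covers the values above \<open>1/2\<close>, and closedness the remaining points \<open>0\<close>, \<open>1/2\<close> and \<open>1\<close>.\<close>

proposition approx_transmission_double_sector:
  assumes \<rho>: "0 < \<rho>" and D: "D \<in> sets lebesgue" and \<beta>: "0 < \<beta>" "\<beta> < pi / 2"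
    and sector: "\<And>x. x \<in> ball 0 \<rho> \<Longrightarrow> x \<noteq> 0 \<Longrightarrow> x \<in> D \<longleftrightarrow> cos \<beta> < \<bar>cos_angle x\<bar>"
    and \<mu>: "\<mu> \<in> {0..1}"
  shows "approx_transmission \<rho> D \<mu>"
proof -
  have half: "approx_transmission \<rho> D \<mu>" if \<mu>: "0 < \<mu>" "\<mu> < 1 / 2" for \<mu>
  proof -
    define \<tau> where "\<tau> = \<mu> / (1 - \<mu>)"
    have \<tau>: "0 < \<tau>" "\<tau> < 1" using \<mu> by (auto simp: \<tau>_def field_simps)
    obtain \<xi> where \<xi>: "0 < \<xi>" "tanh (\<xi> * \<beta>) * tanh (\<xi> * (pi / 2 - \<beta>)) = \<tau>"
      using dispersion_relation[of \<beta> "pi / 2 - \<beta>" \<tau>] \<beta> \<tau> by auto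
    \<comment> \<open>\<open>A\<close> and \<open>B\<close> satisfy the first matching condition identically, \<open>A'\<close> and \<open>B'\<close> are forced by the flux
      conditions, and the second matching condition is then the dispersion relation.\<close>
    define A where "A = cosh (\<xi> * \<beta>)"
    define B where "B = sinh (\<xi> * (pi / 2 - \<beta>))"
    define A' where "A' = - ((1 - \<mu>) * B / \<xi>)"
    define B' where "B' = - (\<mu> * A / \<xi>)"
    have pos: "0 < A" "0 < B" using \<xi>(1) \<beta> by (auto simp: A_def B_def)
    have key: "(1 - \<mu>) * (sinh (\<xi> * \<beta>) * sinh (\<xi> * (pi / 2 - \<beta>))) =
        \<mu> * (cosh (\<xi> * \<beta>) * cosh (\<xi> * (pi / 2 - \<beta>)))"
      using \<xi>(2) \<mu> unfolding \<tau>_def tanh_def by (simp add: field_simps)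
    interpret transmission \<beta> \<xi> \<mu> A B A' B'
    proof
      show "A * sinh (\<xi> * (pi / 2 - \<beta>)) = B * cosh (\<xi> * \<beta>)" by (simp add: A_def B_def)
      show "A' * sinh (\<xi> * \<beta>) = B' * cosh (\<xi> * (pi / 2 - \<beta>))"
        using key \<xi>(1) unfolding A'_def B'_def A_def B_def by (simp add: field_simps)
      show "A' \<noteq> 0" "B' \<noteq> 0" using pos \<mu> \<xi>(1) by (auto simp: A'_def B'_def)
    qed (use \<beta> \<xi>(1) \<mu> in \<open>auto simp: A'_def B'_def\<close>)
    show ?thesis unfolding approx_transmission_def using Weyl_pair[OF \<rho> D sector] by blast
  qed
  have gen: "approx_transmission \<rho> D \<nu>" if \<nu>: "0 < \<nu>" "\<nu> < 1" "\<nu> \<noteq> 1 / 2" for \<nu>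
  proof (cases "\<nu> < 1 / 2")
    case False
    then have "approx_transmission \<rho> D (1 - \<nu>)" using \<nu> by (intro half) auto
    then show ?thesis using approx_transmission_dual[OF D, of "1 - \<nu>"] \<nu> by simp
  qed (use half \<nu> in simp)
  show ?thesis
  proof (rule approx_transmission_closed[OF D])
    fix \<delta> :: real assume \<delta>: "0 < \<delta>"
    define d where "d = min \<delta> (1 / 4) / 2"
    have d: "0 < d" "d < \<delta>" "d \<le> 1 / 8" using \<delta> by (auto simp: d_def)
    show "\<exists>\<nu>. \<bar>\<nu> - \<mu>\<bar> < \<delta> \<and> approx_transmission \<rho> D \<nu>"
    proof (cases "\<mu> < 1 / 2")
      case True
      show ?thesis
      proof (cases "\<mu> = 0")
        case True
        then show ?thesis using gen[of d] d by (intro exI[of _ d]) auto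
      next
        case False
        then show ?thesis using gen[of \<mu>] True \<mu> \<delta> by (intro exI[of _ \<mu>]) auto
      qed
    next
      case False
      then show ?thesis
      proof (cases "\<mu> = 1 \<or> \<mu> = 1 / 2")
        case True
        then show ?thesis using gen[of "\<mu> - d"] d by (intro exI[of _ "\<mu> - d"]) auto
      next
        case False
        then show ?thesis using gen[of \<mu>] \<mu> \<delta> \<open>\<not> \<mu> < 1 / 2\<close> by (intro exI[of _ \<mu>]) auto
      qed
    qed
  qed
qed

section \<open>Bowties\<close>

text \<open>In polar coordinates the two sectors are the points whose direction makes an angle less
than \<open>\<alpha>/2\<close> with one of the two halves of the first axis.\<close>

lemma bowtie_near_corner:
  fixes D\<^sub>1 D\<^sub>2 :: "(real^2) set"
  assumes \<alpha>: "0 < \<alpha>" "\<alpha> < pi"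
    and D1: "D\<^sub>1 \<inter> ball 0 r\<^sub>0 = sector r\<^sub>0 (- \<alpha> / 2) (\<alpha> / 2)"
    and D2: "D\<^sub>2 \<inter> ball 0 r\<^sub>0 = sector r\<^sub>0 (pi - \<alpha> / 2) (pi + \<alpha> / 2)"
    and x: "x \<in> ball 0 r\<^sub>0" "x \<noteq> 0"
  shows "x \<in> D\<^sub>1 \<union> D\<^sub>2 \<longleftrightarrow> cos (\<alpha> / 2) < \<bar>cos_angle x\<bar>"
proof -
  have polar: "cos_angle y = cos \<theta>" if "y = vector [r * cos \<theta>, r * sin \<theta>]" "0 < r" for y :: "real^2" and r \<theta>
  proof -
    have "norm y = sqrt (r\<^sup>2 * (cos \<theta>)\<^sup>2 + r\<^sup>2 * (sin \<theta>)\<^sup>2)"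
      unfolding that(1) by (simp add: norm_vec_def L2_set_def sum_2 power_mult_distrib)
    also have "\<dots> = sqrt (r\<^sup>2 * ((cos \<theta>)\<^sup>2 + (sin \<theta>)\<^sup>2))" by (simp only: distrib_left)
    finally have "norm y = r" using that(2) by simp
    then show ?thesis using that by (simp add: inner_axis)
  qed
  have le: "cos (\<alpha> / 2) < cos t" if "\<bar>t\<bar> < \<alpha> / 2" for t
  proof -
    have "cos (\<alpha> / 2) < cos \<bar>t\<bar>" by (rule cos_monotone_0_pi) (use that \<alpha> in auto)
    then show ?thesis by simp
  qed
  have x_eq: "x \<in> D\<^sub>1 \<union> D\<^sub>2 \<longleftrightarrow> x \<in> sector r\<^sub>0 (- \<alpha> / 2) (\<alpha> / 2) \<union> sector r\<^sub>0 (pi - \<alpha> / 2) (pi + \<alpha> / 2)"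
    using D1 D2 x by blast
  show ?thesis
    unfolding x_eq
  proof
    assume "x \<in> sector r\<^sub>0 (- \<alpha> / 2) (\<alpha> / 2) \<union> sector r\<^sub>0 (pi - \<alpha> / 2) (pi + \<alpha> / 2)"
    then show "cos (\<alpha> / 2) < \<bar>cos_angle x\<bar>"
    proof
      assume "x \<in> sector r\<^sub>0 (- \<alpha> / 2) (\<alpha> / 2)"
      then obtain r \<theta> where "x = vector [r * cos \<theta>, r * sin \<theta>]" "0 < r" "- \<alpha> / 2 < \<theta>" "\<theta> < \<alpha> / 2"
        by (auto simp: sector_def)
      then have "cos_angle x = cos \<theta>" "cos (\<alpha> / 2) < cos \<theta>"
        by (auto intro: polar le)
      then show ?thesis by linarith
    next
      assume "x \<in> sector r\<^sub>0 (pi - \<alpha> / 2) (pi + \<alpha> / 2)"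
      then obtain r \<theta> where p: "x = vector [r * cos \<theta>, r * sin \<theta>]" "0 < r" "pi - \<alpha> / 2 < \<theta>" "\<theta> < pi + \<alpha> / 2"
        by (auto simp: sector_def)
      have "\<bar>\<theta> - pi\<bar> < \<alpha> / 2" using p(3,4) by linarith
      then have "cos (\<alpha> / 2) < cos (\<theta> - pi)" by (rule le)
      then show ?thesis using polar[OF p(1,2)] by (simp add: cos_diff)
    qed
  next
    assume c: "cos (\<alpha> / 2) < \<bar>cos_angle x\<bar>"
    define r where "r = norm x"
    have r: "0 < r" "r < r\<^sub>0" using x by (auto simp: r_def)
    have cs: "(cos_angle x)\<^sup>2 + (sin_angle x)\<^sup>2 = 1" by (rule polar_frame(2)[OF x(2)])
    then have sc: "(sin_angle x)\<^sup>2 + (cos_angle x)\<^sup>2 = 1" by simp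
    note as = arcsin_complementary[OF sc]
    define \<theta> where "\<theta> = arcsin (sin_angle x)"
    have cos_\<theta>: "cos \<theta> = \<bar>cos_angle x\<bar>" using as(2) by (simp only: \<theta>_def)
    have s1: "-1 \<le> sin_angle x" "sin_angle x \<le> 1" using as(3) by linarith+
    have sin_\<theta>: "sin \<theta> = sin_angle x" unfolding \<theta>_def by (rule sin_arcsin[OF s1])
    have xcs: "x = vector [r * cos_angle x, r * sin_angle x]"
      using x(2) by (simp add: vec_eq_iff forall_2 inner_axis r_def)
    have \<theta>_small: "\<bar>\<theta>\<bar> < \<alpha> / 2"
    proof (rule ccontr)
      assume "\<not> \<bar>\<theta>\<bar> < \<alpha> / 2"
      moreover have "\<bar>\<theta>\<bar> \<le> pi" using arcsin_bounded[OF s1] unfolding \<theta>_def by linarith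
      ultimately have "cos \<bar>\<theta>\<bar> \<le> cos (\<alpha> / 2)" using \<alpha> by (intro cos_monotone_0_pi_le) auto
      then show False using c cos_\<theta> by simp
    qed
    have "0 < cos (\<alpha> / 2)" using \<alpha> by (intro cos_gt_zero) auto
    then have "cos_angle x \<noteq> 0" using c by linarith
    then consider "0 < cos_angle x" | "cos_angle x < 0" by linarith
    then show "x \<in> sector r\<^sub>0 (- \<alpha> / 2) (\<alpha> / 2) \<union> sector r\<^sub>0 (pi - \<alpha> / 2) (pi + \<alpha> / 2)"
    proof cases
      case 1
      then have "cos \<theta> = cos_angle x" using cos_\<theta> by linarith
      then have "x = vector [r * cos \<theta>, r * sin \<theta>]" unfolding sin_\<theta> by (simp only: xcs[symmetric])
      moreover have "- \<alpha> / 2 < \<theta>" "\<theta> < \<alpha> / 2" using \<theta>_small by linarith+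
      ultimately have "x \<in> sector r\<^sub>0 (- \<alpha> / 2) (\<alpha> / 2)" using r unfolding sector_def by blast
      then show ?thesis by blast
    next
      case 2
      have "cos (pi - \<theta>) = - \<bar>cos_angle x\<bar>" using cos_\<theta> by (simp add: cos_diff)
      also have "\<dots> = cos_angle x" using 2 by linarith
      finally have "cos (pi - \<theta>) = cos_angle x" .
      moreover have "sin (pi - \<theta>) = sin_angle x" using sin_\<theta> by (simp add: sin_diff)
      ultimately have "x = vector [r * cos (pi - \<theta>), r * sin (pi - \<theta>)]" by (simp only: xcs[symmetric])
      moreover have "pi - \<alpha> / 2 < pi - \<theta>" "pi - \<theta> < pi + \<alpha> / 2" using \<theta>_small by linarith+
      ultimately have "x \<in> sector r\<^sub>0 (pi - \<alpha> / 2) (pi + \<alpha> / 2)" using r unfolding sector_def by blast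
      then show ?thesis by blast
    qed
  qed
qed

theorem theorem1:
  fixes \<Omega> D D\<^sub>1 D\<^sub>2 :: "(real^2) set"
  assumes "open \<Omega>" and "bounded \<Omega>" and "0 \<in> \<Omega>"
    and "\<forall>p \<in> frontier \<Omega>. smooth_boundary_at \<Omega> p"
    and "bowtie \<Omega> D\<^sub>1 D\<^sub>2" and "D = D\<^sub>1 \<union> D\<^sub>2"
  shows "discrete_spectrum (H10 \<Omega>) (H10_inner \<Omega>) (poincare_op \<Omega> D) = {} \<and>
    op_spectrum (H10 \<Omega>) (H10_inner \<Omega>) (poincare_op \<Omega> D) =
      essential_spectrum (H10 \<Omega>) (H10_inner \<Omega>) (poincare_op \<Omega> D) \<and>
    essential_spectrum (H10 \<Omega>) (H10_inner \<Omega>) (poincare_op \<Omega> D) = {0..1}"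
proof -
  interpret planar_domain \<Omega>
    by unfold_locales (fact assms)+
  let ?\<sigma> = "op_spectrum (H10 \<Omega>) (H10_inner \<Omega>) (poincare_op \<Omega> D)"
  obtain r\<^sub>0 \<alpha> where r\<^sub>0: "0 < r\<^sub>0" and \<alpha>: "0 < \<alpha>" "\<alpha> < pi"
    and corner: "D\<^sub>1 \<inter> ball 0 r\<^sub>0 = sector r\<^sub>0 (- \<alpha> / 2) (\<alpha> / 2)"
      "D\<^sub>2 \<inter> ball 0 r\<^sub>0 = sector r\<^sub>0 (pi - \<alpha> / 2) (pi + \<alpha> / 2)"
    using assms(5) unfolding bowtie_def by blast
  have "open D" using assms(5,6) by (auto simp: bowtie_def)
  then have D: "D \<in> sets lebesgue" by simp
  have D\<Omega>: "D \<subseteq> \<Omega>" using assms(5,6) closure_subset[of D] by (auto simp: bowtie_def)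
  obtain \<rho>' where \<rho>': "0 < \<rho>'" "ball 0 \<rho>' \<subseteq> \<Omega>" using assms(1,3) openE by blast
  define \<rho> where "\<rho> = min r\<^sub>0 \<rho>'"
  have \<rho>: "0 < \<rho>" "ball (0::real^2) \<rho> \<subseteq> \<Omega>" "ball (0::real^2) \<rho> \<subseteq> ball 0 r\<^sub>0"
    using r\<^sub>0 \<rho>' by (auto simp: \<rho>_def)
  have "\<mu> \<in> ?\<sigma>" if \<mu>: "\<mu> \<in> {0..1}" for \<mu>
  proof (rule poincare_spectrum_Weyl[OF D D\<Omega>])
    have "approx_transmission \<rho> D \<mu>"
    proof (rule approx_transmission_double_sector[OF \<rho>(1) D, of "\<alpha> / 2"])
      show "x \<in> D \<longleftrightarrow> cos (\<alpha> / 2) < \<bar>cos_angle x\<bar>" if "x \<in> ball 0 \<rho>" "x \<noteq> 0" for x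
        unfolding assms(6) by (rule bowtie_near_corner[OF \<alpha> corner]) (use that \<rho>(3) in auto)
    qed (use \<alpha> \<mu> in auto)
    then show "\<exists>u S. test_function \<Omega> u \<and> test_function \<Omega> S \<and> 0 < energy u \<and>
      defect D \<mu> u S \<le> \<epsilon> * energy u" if "0 < \<epsilon>" for \<epsilon>
      using that test_mono[OF _ \<rho>(2)] unfolding approx_transmission_def by blast
  qed
  then have \<sigma>: "?\<sigma> = {0..1}"
    using poincare_spectrum_subset[OF D D\<Omega>] by blast
  have "\<not> \<mu> isolated_in {0..1::real}" for \<mu> :: real
  proof
    assume *: "\<mu> isolated_in {0..1::real}"
    have "\<mu> islimpt {0..1}"
      by (rule connected_imp_perfect) (use * in \<open>auto simp: isolated_in_islimpt_iff\<close>)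
    then show False using * by (simp add: isolated_in_islimpt_iff)
  qed
  then have "discrete_spectrum (H10 \<Omega>) (H10_inner \<Omega>) (poincare_op \<Omega> D) = {}"
    by (simp add: discrete_spectrum_def \<sigma>)
  then show ?thesis by (simp add: essential_spectrum_def \<sigma>)
qed

end
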